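(* Let $p$ be a prime, $\mathcal L_p=\{0,1,+,-,\times\}\cup\{P_n:n>1\}$, and let $\mathcal L\supseteq\mathcal L_p$. Let $T$ be a $P$-minimal $\mathcal L$-theory with definable Skolem functions. Then $T$ has the strong $\mathrm{VC}2$ property, and for every model $\mathbf M$ of $T$ and every finite set $\Delta(x;y)$ of partitioned $\mathcal L$-formulas, the dual VC density of $\Delta$ in $\mathbf M$ is at most $2|x|-1$.
   Context: $\mathrm{pCF}$ denotes the $\mathcal L_p$-theory of the field $\mathbb Q_p$ of $p$-adic numbers in which each $P_n$ is interpreted as the set of $n$th powers. An $\mathcal L$-theory $T\supseteq\mathrm{pCF}$ is $P$-minimal if in every model of $T$, every definable (with parameters) subset of the model (in one variable) is definable by a quantifier-free $\mathcal L_p$-formula with parameters. For a structure $\mathbf M$, a finite set $\Delta(x;y)$ of partitioned formulas and a finite $B\subseteq M^{|y|}$, $S^\Delta(B)$ is the set of $\Delta$-types $\mathrm{tp}^\Delta(a/B)=\{\varphi(x;b):\mathbf M\models\varphi(a;b)\}\cup\{\neg\varphi(x;b):\mathbf M\not\models\varphi(a;b)\}$ ($\varphi\in\Delta,b\in B$), $a\in M^{|x|}$; $\pi^*_\Delta(t)=\max\{|S^\Delta(B)|:|B|=t\}$; the dual VC density of $\Delta$ is $\inf\{r\ge0:\pi^*_\Delta(t)=O(t^r)\}$. A uniform definition of $\Delta(x;B)$-types over finite sets with $d$ parameters is a finite family $(\mathcal F_i)_{i\in I}$, $\mathcal F_i=(\varphi_i(y;y_1,\dots,y_d))_{\varphi\in\Delta}$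 ($|y_j|=|y|$), such that for every finite $B\subseteq M^{|y|}$ and $q\in S^\Delta(B)$ there exist $b_1,\dots,b_d\in B$ and $i\in I$ with $\varphi(x;b)\in q\iff\mathbf M\models\varphi_i(b;b_1,\dots,b_d)$ for all $\varphi\in\Delta,b\in B$. It is coherent if moreover for every $i\in I$ and all $b_1,\dots,b_d\in M^{|y|}$ the set $\{\varphi(x;b):\varphi\in\Delta,b\in M^{|y|},\mathbf M\models\varphi_i(b;b_1,\dots,b_d)\}$ is consistent with $\mathbf M$. A structure has the strong $\mathrm{VC}d$ property if every finite nonempty $\Delta(x;y)$ with $|x|=1$ has a coherent uniform definition of $\Delta(x;B)$-types over finite sets with $d$ parameters; a theory has it if all its models do. *)

theory Defs
  imports
    "HOL-Computational_Algebra.Primes"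
    "HOL-Library.Extended_Real"
    "HOL-Library.Landau_Symbols"
begin

section \<open>First-order logic\<close>

text \<open>
  A language is a set of function symbols and a set of relation symbols, with arities
  (constants are function symbols of arity 0). The symbols are drawn from types, but need
  not exhaust them.
\<close>

record ('f, 'r) language =
  fsyms :: "'f set"
  rsyms :: "'r set"
  farity :: "'f \<Rightarrow> nat"
  rarity :: "'r \<Rightarrow> nat"

definition sublanguage :: "('f, 'r) language \<Rightarrow> ('f, 'r) language \<Rightarrow> bool" where
  "sublanguage K L \<longleftrightarrow>
     fsyms K \<subseteq> fsyms L \<and> rsyms K \<subseteq> rsyms L \<and>
     (\<forall>f\<in>fsyms K. farity K f = farity L f) \<and> (\<forall>r\<in>rsyms K. rarity K r = rarity L r)"

datatype 'f tm = Var nat | Fn 'f "'f tm list"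

datatype ('f, 'r) fm =
    Eq "'f tm" "'f tm"
  | Rel 'r "'f tm list"
  | Neg "('f, 'r) fm"
  | Conj "('f, 'r) fm" "('f, 'r) fm"
  | Ex nat "('f, 'r) fm"

primrec tm_in :: "('f, 'r) language \<Rightarrow> 'f tm \<Rightarrow> bool" where
  "tm_in L (Var i) \<longleftrightarrow> True"
| "tm_in L (Fn f ts) \<longleftrightarrow> f \<in> fsyms L \<and> length ts = farity L f \<and> list_all (tm_in L) ts"

primrec fm_in :: "('f, 'r) language \<Rightarrow> ('f, 'r) fm \<Rightarrow> bool" where
  "fm_in L (Eq s t) \<longleftrightarrow> tm_in L s \<and> tm_in L t"
| "fm_in L (Rel r ts) \<longleftrightarrow> r \<in> rsyms L \<and> length ts = rarity L r \<and> list_all (tm_in L) ts"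
| "fm_in L (Neg \<phi>) \<longleftrightarrow> fm_in L \<phi>"
| "fm_in L (Conj \<phi> \<psi>) \<longleftrightarrow> fm_in L \<phi> \<and> fm_in L \<psi>"
| "fm_in L (Ex i \<phi>) \<longleftrightarrow> fm_in L \<phi>"

primrec tm_vars :: "'f tm \<Rightarrow> nat set" where
  "tm_vars (Var i) = {i}"
| "tm_vars (Fn f ts) = \<Union> (set (map tm_vars ts))"

primrec free_vars :: "('f, 'r) fm \<Rightarrow> nat set" where
  "free_vars (Eq s t) = tm_vars s \<union> tm_vars t"
| "free_vars (Rel r ts) = \<Union> (set (map tm_vars ts))"
| "free_vars (Neg \<phi>) = free_vars \<phi>"
| "free_vars (Conj \<phi> \<psi>) = free_vars \<phi> \<union> free_vars \<psi>"
| "free_vars (Ex i \<phi>) = free_vars \<phi> - {i}"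

primrec quantifier_free :: "('f, 'r) fm \<Rightarrow> bool" where
  "quantifier_free (Eq s t) \<longleftrightarrow> True"
| "quantifier_free (Rel r ts) \<longleftrightarrow> True"
| "quantifier_free (Neg \<phi>) \<longleftrightarrow> quantifier_free \<phi>"
| "quantifier_free (Conj \<phi> \<psi>) \<longleftrightarrow> quantifier_free \<phi> \<and> quantifier_free \<psi>"
| "quantifier_free (Ex i \<phi>) \<longleftrightarrow> False"

text \<open>The \<open>L\<close>-formulas in the variables \<open>v\<^sub>0, \<dots>, v\<^bsub>k-1\<^esub>\<close>.\<close>

definition formulas :: "('f, 'r) language \<Rightarrow> nat \<Rightarrow> ('f, 'r) fm set" where
  "formulas L k = {\<phi>. fm_in L \<phi> \<and> free_vars \<phi> \<subseteq> {..<k}}"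

definition sentences :: "('f, 'r) language \<Rightarrow> ('f, 'r) fm set" where
  "sentences L = formulas L 0"

record ('f, 'r, 'u) struct =
  univ :: "'u set"
  fun_int :: "'f \<Rightarrow> 'u list \<Rightarrow> 'u"
  rel_int :: "'r \<Rightarrow> 'u list \<Rightarrow> bool"

definition tuples :: "('f, 'r, 'u) struct \<Rightarrow> nat \<Rightarrow> 'u list set" where
  "tuples M n = {a. length a = n \<and> set a \<subseteq> univ M}"

definition is_struct :: "('f, 'r) language \<Rightarrow> ('f, 'r, 'u) struct \<Rightarrow> bool" where
  "is_struct L M \<longleftrightarrow>
     univ M \<noteq> {} \<and> (\<forall>f\<in>fsyms L. \<forall>a\<in>tuples M (farity L f). fun_int M f a \<in> univ M)"

primrec tm_val :: "('f, 'r, 'u) struct \<Rightarrow> (nat \<Rightarrow> 'u) \<Rightarrow> 'f tm \<Rightarrow> 'u" where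
  "tm_val M e (Var i) = e i"
| "tm_val M e (Fn f ts) = fun_int M f (map (tm_val M e) ts)"

primrec sat :: "('f, 'r, 'u) struct \<Rightarrow> (nat \<Rightarrow> 'u) \<Rightarrow> ('f, 'r) fm \<Rightarrow> bool" where
  "sat M e (Eq s t) \<longleftrightarrow> tm_val M e s = tm_val M e t"
| "sat M e (Rel r ts) \<longleftrightarrow> rel_int M r (map (tm_val M e) ts)"
| "sat M e (Neg \<phi>) \<longleftrightarrow> \<not> sat M e \<phi>"
| "sat M e (Conj \<phi> \<psi>) \<longleftrightarrow> sat M e \<phi> \<and> sat M e \<psi>"
| "sat M e (Ex i \<phi>) \<longleftrightarrow> (\<exists>u\<in>univ M. sat M (e(i := u)) \<phi>)"

text \<open>
  \<open>holds M \<phi> a\<close> is \<open>M \<Turnstile> \<phi>(a)\<close>: the entries of \<open>a\<close> are assigned to \<open>v\<^sub>0, v\<^sub>1, \<dots>\<close>; it is only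
  used for \<open>\<phi>\<close> in \<open>formulas L (length a)\<close>, so the values of the other variables are irrelevant.
\<close>

definition holds :: "('f, 'r, 'u) struct \<Rightarrow> ('f, 'r) fm \<Rightarrow> 'u list \<Rightarrow> bool" where
  "holds M \<phi> a \<longleftrightarrow> sat M (\<lambda>i. if i < length a then a ! i else undefined) \<phi>"

definition is_model ::
  "('f, 'r) language \<Rightarrow> ('f, 'r) fm set \<Rightarrow> ('f, 'r, 'u) struct \<Rightarrow> bool" where
  "is_model L T M \<longleftrightarrow> is_struct L M \<and> (\<forall>\<phi>\<in>T. holds M \<phi> [])"

text \<open>
  Properties of a theory that refer to all its models take a type argument \<open>'u\<close> and refer to the
  models whose universe is a subset of \<open>'u\<close>. The theorem is about types of the following form.
  As \<open>'a\<close> is arbitrary, structures of every cardinality occur; and because of the first summand,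
  the type has at least as many elements as there are formulas, so that by the downward
  Loewenheim-Skolem theorem the properties below mean the same as for the class of all models.
\<close>

type_synonym ('f, 'r, 'a) universe = "('f, 'r) fm + 'a"

text \<open>
  Skolem functions are definable without parameters, by the same formula in all models. Here
  \<open>\<psi>(x, y)\<close> defines a choice function on the set \<open>\<exists>y \<phi>(x, y)\<close>.
\<close>

definition definable_skolem_functions ::
  "'u itself \<Rightarrow> ('f, 'r) language \<Rightarrow> ('f, 'r) fm set \<Rightarrow> bool" where
  "definable_skolem_functions U L T \<longleftrightarrow>
     (\<forall>n. \<forall>\<phi>\<in>formulas L (n + 1). \<exists>\<psi>\<in>formulas L (n + 1).
        \<forall>M :: ('f, 'r, 'u) struct. is_model L T M \<longrightarrow>
          (\<forall>a\<in>tuples M n. (\<exists>b\<in>univ M. holds M \<phi> (a @ [b])) \<longrightarrow>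
             (\<exists>!b. b \<in> univ M \<and> holds M \<psi> (a @ [b])) \<and>
             (\<forall>b\<in>univ M. holds M \<psi> (a @ [b]) \<longrightarrow> holds M \<phi> (a @ [b]))))"


section \<open>The field of p-adic numbers and P-minimality\<close>

text \<open>
  \<open>\<rat>\<^sub>p\<close> is the completion of \<open>\<rat>\<close> for the p-adic absolute value, i.e. the set of
  Cauchy sequences modulo null sequences.
\<close>

definition padic_val :: "nat \<Rightarrow> rat \<Rightarrow> int" where
  "padic_val p q =
     int (multiplicity (int p) (fst (quotient_of q))) -
     int (multiplicity (int p) (snd (quotient_of q)))"

definition padic_abs :: "nat \<Rightarrow> rat \<Rightarrow> real" where
  "padic_abs p q = (if q = 0 then 0 else real p powi (- padic_val p q))"

definition padic_Cauchy :: "nat \<Rightarrow> (nat \<Rightarrow> rat) set" where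
  "padic_Cauchy p = {X. \<forall>e>0. \<exists>N. \<forall>m\<ge>N. \<forall>n\<ge>N. padic_abs p (X m - X n) < e}"

definition padic_rel :: "nat \<Rightarrow> ((nat \<Rightarrow> rat) \<times> (nat \<Rightarrow> rat)) set" where
  "padic_rel p = {(X, Y). X \<in> padic_Cauchy p \<and> Y \<in> padic_Cauchy p \<and>
                          (\<lambda>n. padic_abs p (X n - Y n)) \<longlonglongrightarrow> 0}"

type_synonym padic = "(nat \<Rightarrow> rat) set"

definition Qp :: "nat \<Rightarrow> padic set" where
  "Qp p = padic_Cauchy p // padic_rel p"

definition Qp_of_rat :: "nat \<Rightarrow> rat \<Rightarrow> padic" where
  "Qp_of_rat p q = padic_rel p `` {\<lambda>_. q}"

definition Qp_lift2 :: "nat \<Rightarrow> (rat \<Rightarrow> rat \<Rightarrow> rat) \<Rightarrow> padic \<Rightarrow> padic \<Rightarrow> padic" where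
  "Qp_lift2 p g A B = (\<Union>X\<in>A. \<Union>Y\<in>B. padic_rel p `` {\<lambda>n. g (X n) (Y n)})"

definition Qp_power :: "nat \<Rightarrow> padic \<Rightarrow> nat \<Rightarrow> padic" where
  "Qp_power p A n = (Qp_lift2 p (*) A ^^ n) (Qp_of_rat p 1)"

text \<open>
  The symbols of \<open>\<L>\<^sub>p\<close> and of its extensions; \<open>Sub\<close> is binary subtraction and \<open>Pow n\<close> stands
  for \<open>P\<^sub>n\<close>.
\<close>

datatype 'f fsym = Zero | One | Add | Sub | Mul | OtherF 'f

datatype 'r rsym = Pow nat | OtherR 'r

definition Lp :: "('f fsym, 'r rsym) language" where
  "Lp = \<lparr>fsyms = {Zero, One, Add, Sub, Mul}, rsyms = {Pow n |n. n > 1},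
         farity = (\<lambda>f. if f \<in> {Zero, One} then 0 else 2), rarity = (\<lambda>r. 1)\<rparr>"

text \<open>The interpretation of symbols outside \<open>\<L>\<^sub>p\<close> is irrelevant.\<close>

definition Qp_struct :: "nat \<Rightarrow> ('f fsym, 'r rsym, padic) struct" where
  "Qp_struct p =
    \<lparr>univ = Qp p,
     fun_int = (\<lambda>f as. case f of
         Zero \<Rightarrow> Qp_of_rat p 0
       | One \<Rightarrow> Qp_of_rat p 1
       | Add \<Rightarrow> Qp_lift2 p (+) (as ! 0) (as ! 1)
       | Sub \<Rightarrow> Qp_lift2 p (-) (as ! 0) (as ! 1)
       | Mul \<Rightarrow> Qp_lift2 p (*) (as ! 0) (as ! 1)
       | OtherF _ \<Rightarrow> Qp_of_rat p 0),
     rel_int = (\<lambda>r as. case r of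
         Pow n \<Rightarrow> (\<exists>B\<in>Qp p. as ! 0 = Qp_power p B n)
       | OtherR _ \<Rightarrow> False)\<rparr>"

definition pCF :: "nat \<Rightarrow> ('f fsym, 'r rsym) fm set" where
  "pCF p = {\<phi> \<in> sentences Lp. holds (Qp_struct p) \<phi> []}"

definition definable_subset ::
  "('f, 'r, 'u) struct \<Rightarrow> (nat \<Rightarrow> ('f, 'r) fm set) \<Rightarrow> 'u set \<Rightarrow> bool" where
  "definable_subset M \<Phi> X \<longleftrightarrow>
     (\<exists>n. \<exists>\<phi>\<in>\<Phi> (1 + n). \<exists>c\<in>tuples M n. X = {a \<in> univ M. holds M \<phi> ([a] @ c)})"

definition P_minimal ::
  "'u itself \<Rightarrow> nat \<Rightarrow> ('f fsym, 'r rsym) language \<Rightarrow> ('f fsym, 'r rsym) fm set \<Rightarrow> bool" where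
  "P_minimal U p L T \<longleftrightarrow>
     T \<subseteq> sentences L \<and> pCF p \<subseteq> T \<and>
     (\<forall>M :: ('f fsym, 'r rsym, 'u) struct. is_model L T M \<longrightarrow>
        (\<forall>X. definable_subset M (formulas L) X \<longrightarrow>
             definable_subset M (\<lambda>k. {\<phi> \<in> formulas Lp k. quantifier_free \<phi>}) X))"


section \<open>Types over finite sets\<close>

text \<open>
  A partitioned formula \<open>\<phi>(x; y)\<close> with \<open>|x| = m\<close> and \<open>|y| = n\<close> is an element of
  \<open>formulas L (m + n)\<close>, where \<open>x\<close> consists of the first \<open>m\<close> variables and \<open>y\<close> of the next \<open>n\<close>.
  The elements \<open>\<phi>(x; b)\<close> and \<open>\<not> \<phi>(x; b)\<close> of a type are represented by \<open>(True, \<phi>, b)\<close> and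
  \<open>(False, \<phi>, b)\<close>.
\<close>

definition tp ::
  "('f, 'r, 'u) struct \<Rightarrow> ('f, 'r) fm set \<Rightarrow> 'u list \<Rightarrow> 'u list set \<Rightarrow>
     (bool \<times> ('f, 'r) fm \<times> 'u list) set" where
  "tp M \<Delta> a B = {(True, \<phi>, b) |\<phi> b. \<phi> \<in> \<Delta> \<and> b \<in> B \<and> holds M \<phi> (a @ b)} \<union>
                {(False, \<phi>, b) |\<phi> b. \<phi> \<in> \<Delta> \<and> b \<in> B \<and> \<not> holds M \<phi> (a @ b)}"

definition types ::
  "('f, 'r, 'u) struct \<Rightarrow> nat \<Rightarrow> ('f, 'r) fm set \<Rightarrow> 'u list set \<Rightarrow>
     (bool \<times> ('f, 'r) fm \<times> 'u list) set set" where
  "types M m \<Delta> B = {tp M \<Delta> a B |a. a \<in> tuples M m}"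

text \<open>
  The supremum is a maximum, as there are at most \<open>2 ^ (card \<Delta> * t)\<close> types; the maximum of the
  empty set (which only occurs for \<open>n = 0\<close> or finite \<open>M\<close>) is 0.
\<close>

definition dual_shatter ::
  "('f, 'r, 'u) struct \<Rightarrow> nat \<Rightarrow> nat \<Rightarrow> ('f, 'r) fm set \<Rightarrow> nat \<Rightarrow> nat" where
  "dual_shatter M m n \<Delta> t =
     (SUP B\<in>{B. B \<subseteq> tuples M n \<and> finite B \<and> card B = t}. card (types M m \<Delta> B))"

definition dual_vc_density ::
  "('f, 'r, 'u) struct \<Rightarrow> nat \<Rightarrow> nat \<Rightarrow> ('f, 'r) fm set \<Rightarrow> ereal" where
  "dual_vc_density M m n \<Delta> =
     Inf {ereal r |r. r \<ge> 0 \<and>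
            (\<lambda>t. real (dual_shatter M m n \<Delta> t)) \<in> O[sequentially](\<lambda>t. real t powr r)}"

text \<open>
  In a uniform definition with \<open>d\<close> parameters, \<open>F i \<phi>\<close> is the formula
  \<open>\<phi>\<^sub>i(y; y\<^sub>1, \<dots>, y\<^sub>d)\<close>, in \<open>(1 + d) * n\<close> variables. The set \<open>B\<close> has to be nonempty, as otherwise
  there are no parameters to choose.
\<close>

definition uniform_def_types ::
  "('f, 'r) language \<Rightarrow> ('f, 'r, 'u) struct \<Rightarrow> nat \<Rightarrow> nat \<Rightarrow> ('f, 'r) fm set \<Rightarrow> nat \<Rightarrow>
     nat set \<Rightarrow> (nat \<Rightarrow> ('f, 'r) fm \<Rightarrow> ('f, 'r) fm) \<Rightarrow> bool" where
  "uniform_def_types L M m n \<Delta> d I F \<longleftrightarrow>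
     finite I \<and> (\<forall>i\<in>I. \<forall>\<phi>\<in>\<Delta>. F i \<phi> \<in> formulas L ((1 + d) * n)) \<and>
     (\<forall>B q. B \<subseteq> tuples M n \<and> finite B \<and> B \<noteq> {} \<and> q \<in> types M m \<Delta> B \<longrightarrow>
        (\<exists>bs. length bs = d \<and> set bs \<subseteq> B \<and>
           (\<exists>i\<in>I. \<forall>\<phi>\<in>\<Delta>. \<forall>b\<in>B. (True, \<phi>, b) \<in> q \<longleftrightarrow> holds M (F i \<phi>) (b @ concat bs))))"

text \<open>
  A set of formulas \<open>\<phi>(x; b)\<close> with parameters in \<open>M\<close>, given as pairs \<open>(\<phi>, b)\<close>, is consistent
  with \<open>M\<close> (i.e. with the elementary diagram of \<open>M\<close>) if it is finitely satisfiable in \<open>M\<close>.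
\<close>

definition consistent_with ::
  "('f, 'r, 'u) struct \<Rightarrow> nat \<Rightarrow> (('f, 'r) fm \<times> 'u list) set \<Rightarrow> bool" where
  "consistent_with M m S \<longleftrightarrow>
     (\<forall>S'. S' \<subseteq> S \<and> finite S' \<longrightarrow> (\<exists>a\<in>tuples M m. \<forall>(\<phi>, b)\<in>S'. holds M \<phi> (a @ b)))"

definition coherent_def_types ::
  "('f, 'r) language \<Rightarrow> ('f, 'r, 'u) struct \<Rightarrow> nat \<Rightarrow> nat \<Rightarrow> ('f, 'r) fm set \<Rightarrow> nat \<Rightarrow>
     nat set \<Rightarrow> (nat \<Rightarrow> ('f, 'r) fm \<Rightarrow> ('f, 'r) fm) \<Rightarrow> bool" where
  "coherent_def_types L M m n \<Delta> d I F \<longleftrightarrow>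
     uniform_def_types L M m n \<Delta> d I F \<and>
     (\<forall>i\<in>I. \<forall>bs. length bs = d \<and> set bs \<subseteq> tuples M n \<longrightarrow>
        consistent_with M m
          {(\<phi>, b) |\<phi> b. \<phi> \<in> \<Delta> \<and> b \<in> tuples M n \<and> holds M (F i \<phi>) (b @ concat bs)})"

definition strong_VC :: "nat \<Rightarrow> ('f, 'r) language \<Rightarrow> ('f, 'r, 'u) struct \<Rightarrow> bool" where
  "strong_VC d L M \<longleftrightarrow>
     (\<forall>n \<Delta>. finite \<Delta> \<and> \<Delta> \<noteq> {} \<and> \<Delta> \<subseteq> formulas L (1 + n) \<longrightarrow>
        (\<exists>I F. coherent_def_types L M 1 n \<Delta> d I F))"

definition theory_strong_VC ::
  "'u itself \<Rightarrow> nat \<Rightarrow> ('f, 'r) language \<Rightarrow> ('f, 'r) fm set \<Rightarrow> bool" where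
  "theory_strong_VC U d L T \<longleftrightarrow>
     (\<forall>M :: ('f, 'r, 'u) struct. is_model L T M \<longrightarrow> strong_VC d L M)"

end

theory Submission
  imports Defs "HOL-Computational_Algebra.Polynomial" "HOL-Number_Theory.Cong"
begin

text \<open>
  In a p-adic field, call \<open>x\<close> and \<open>x'\<close> similar with respect to a finite set \<open>C\<close> of centres if for all
  \<open>c, d \<in> C\<close> the elements \<open>x - c\<close> and \<open>x' - c\<close> lie in the same coset of the \<open>n\<close>th powers for \<open>n \<le> s\<close>, and
  their norms compare in the same way with \<open>p\<^sup>j \<bar>d - c\<bar>\<close> for \<open>-s \<le> j \<le> s\<close>. Three facts hold for \<open>\<rat>\<^sub>p\<close>.

  (1) For a polynomial \<open>f\<close> of bounded degree there are boundedly many centres such that the coset of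
  \<open>f(x)\<close> modulo \<open>n\<close>th powers depends only on the similarity class of \<open>x\<close>: take the roots of \<open>f\<close> and of its
  derivatives, and further points whose distances from these roots are given by the slopes of the
  Newton polygons of the Taylor expansions there. Indeed, if \<open>c\<close> is the root next to \<open>x\<close>, then \<open>f(x)\<close> is not
  much smaller than the largest term of the Taylor expansion around \<open>c\<close>: by induction this holds for \<open>f'\<close>,
  and if it failed for \<open>f\<close>, then Hensel's lemma would give a root of \<open>f\<close> that is closer to \<open>x\<close>.

  (2) Every \<open>x\<close> is similar to \<open>c + (d - c) r\<close> for some \<open>c, d \<in> C\<close> and some \<open>r\<close> in a finite set of rational
  numbers that depends only on \<open>s\<close>.

  (3) The number of similarity classes is linear in the size of \<open>C\<close>, as there are at most \<open>\<bar>C\<bar>\<close> balls with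
  centre \<open>c\<close> and radius \<open>\<bar>d - c\<bar>\<close> for distinct \<open>c, d \<in> C\<close>.

  For fixed bounds these are first-order sentences, so they hold in the models of \<open>T\<close>. By P-minimality
  and compactness, every formula \<open>\<phi>(x; y)\<close> with a single variable \<open>x\<close> has finitely many definable
  functions of \<open>y\<close> as centres; compactness is applied in the form of an ultrapower that consists of
  definable functions only, which are represented by formulas, so that it lives on the given type. By (2)
  every type over \<open>B\<close> is then realised by the value of a definable function at two elements of \<open>B\<close>, which
  gives the strong VC2 property. By (3) there are \<open>O(t)\<close> types in one variable, and by (2) each further
  variable contributes a factor \<open>O(t\<^sup>2)\<close>, for the choice of the two elements.
\<close>

section \<open>Variables and derived connectives\<close>

text \<open>Two demands on similarity pull in opposite directions. Cosets of powers determine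
  \<open>|x - c|\<close> only modulo a power of p, and this freedom is what makes (2) possible:
  \<open>x - c\<close> can be rescaled until it is comparable to some \<open>d - c\<close>. But the
  dominant term of a Taylor expansion changes with \<open>|x - c|\<close>, so the norm must be
  pinned down wherever such a change can occur. The comparisons with \<open>p^j |d - c|\<close> do
  exactly this, in a bounded window around each distance of centres.

  The obstacle in (1) is that a polynomial may be small near a root outside the field. Such places
  are controlled by the roots of the derivatives, which is why these are centres as well.

  The constants in (2) and (3) depend on the precision s but not on the number of centres. This is
  decisive, since s belongs to the formula, whereas the centres of all elements of B are used
  together and their number grows with B.

  P-minimality bounds nothing uniformly: the quantifier-free formula may change with the parameter.
  The ultrapower serves to replace all parameters by a single generic one.\<close>

lemma tm_val_cong:
  "(\<And>i. i \<in> tm_vars t \<Longrightarrow> e i = e' i) \<Longrightarrow> tm_val M e t = tm_val M e' t"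
proof (induction t)
  case (Fn f ts)
  have "map (tm_val M e) ts = map (tm_val M e') ts"
    using Fn by (intro map_cong) auto
  then show ?case by (simp only: tm_val.simps)
qed simp

lemma sat_cong:
  "(\<And>i. i \<in> free_vars \<phi> \<Longrightarrow> e i = e' i) \<Longrightarrow> sat M e \<phi> \<longleftrightarrow> sat M e' \<phi>"
proof (induction \<phi> arbitrary: e e')
  case (Eq s t)
  then show ?case using tm_val_cong[of s e e' M] tm_val_cong[of t e e' M] by simp
next
  case (Rel r ts)
  have "map (tm_val M e) ts = map (tm_val M e') ts"
    using Rel by (intro map_cong refl tm_val_cong) auto
  then show ?case by (simp only: sat.simps)
next
  case (Neg \<phi>)
  from Neg.IH[of e e'] Neg.prems show ?case by simp
next
  case (Conj \<phi> \<psi>)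
  from Conj.IH[of e e'] Conj.prems show ?case by simp
next
  case (Ex i \<phi>)
  have "sat M (e(i := u)) \<phi> \<longleftrightarrow> sat M (e'(i := u)) \<phi>" for u
    by (rule Ex.IH) (use Ex.prems in auto)
  then show ?case by simp
qed

definition list_env :: "'u list \<Rightarrow> nat \<Rightarrow> 'u" where
  "list_env a = (\<lambda>i. if i < length a then a ! i else undefined)"

lemma holds_list_env: "holds M \<phi> a \<longleftrightarrow> sat M (list_env a) \<phi>"
  by (simp add: holds_def list_env_def)

lemma list_env_nth [simp]: "i < length a \<Longrightarrow> list_env a i = a ! i"
  by (simp add: list_env_def)

lemma list_env_upd: "(list_env a)(length a := u) = list_env (a @ [u])"
  by (auto simp: list_env_def fun_eq_iff nth_append)

primrec rename_tm :: "(nat \<Rightarrow> nat) \<Rightarrow> 'f tm \<Rightarrow> 'f tm" where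
  "rename_tm h (Var i) = Var (h i)"
| "rename_tm h (Fn f ts) = Fn f (map (rename_tm h) ts)"

text \<open>Capture is avoided for every \<open>h\<close>, injective or not: the bound variable
  becomes an index larger than the images of all free variables of the body. The map is the second
  argument so that the recursion can change it below a quantifier.\<close>

primrec rename :: "('f, 'r) fm \<Rightarrow> (nat \<Rightarrow> nat) \<Rightarrow> ('f, 'r) fm" where
  "rename (Eq s t) = (\<lambda>h. Eq (rename_tm h s) (rename_tm h t))"
| "rename (Rel r ts) = (\<lambda>h. Rel r (map (rename_tm h) ts))"
| "rename (Neg \<phi>) = (\<lambda>h. Neg (rename \<phi> h))"
| "rename (Conj \<phi> \<psi>) = (\<lambda>h. Conj (rename \<phi> h) (rename \<psi> h))"
| "rename (Ex i \<phi>) = (\<lambda>h. let j = Suc (Max (insert 0 (h ` free_vars \<phi>)))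
                          in Ex j (rename \<phi> (h(i := j))))"

lemma finite_tm_vars: "finite (tm_vars t)"
  by (induction t) auto

lemma finite_free_vars: "finite (free_vars \<phi>)"
  by (induction \<phi>) (auto simp: finite_tm_vars)

lemma tm_vars_rename: "tm_vars (rename_tm h t) = h ` tm_vars t"
  by (induction t) auto

lemma tm_val_rename: "tm_val M e (rename_tm h t) = tm_val M (e \<circ> h) t"
proof (induction t)
  case (Fn f ts)
  have "map (tm_val M e \<circ> rename_tm h) ts = map (tm_val M (e \<circ> h)) ts"
    by (intro map_cong refl) (simp only: comp_apply[of "tm_val M e"] Fn)
  then show ?case by (simp only: tm_val.simps rename_tm.simps map_map)
qed simp

lemma tm_in_rename: "tm_in L (rename_tm h t) \<longleftrightarrow> tm_in L t"
  by (induction t) (auto simp: list_all_iff)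

lemma fm_in_rename: "fm_in L (rename \<phi> h) \<longleftrightarrow> fm_in L \<phi>"
  by (induction \<phi> arbitrary: h) (auto simp: tm_in_rename list_all_iff Let_def)

lemma free_vars_rename: "free_vars (rename \<phi> h) \<subseteq> h ` free_vars \<phi>"
proof (induction \<phi> arbitrary: h)
  case (Ex i \<phi>)
  define j where "j = Suc (Max (insert 0 (h ` free_vars \<phi>)))"
  have "free_vars (rename \<phi> (h(i := j))) \<subseteq> (h(i := j)) ` free_vars \<phi>" by (rule Ex)
  then show ?case by (auto simp: Let_def j_def[symmetric] image_iff split: if_splits)
next
  case (Conj \<phi> \<psi>)
  from Conj(1)[of h] Conj(2)[of h] show ?case by auto
qed (auto simp: tm_vars_rename)

lemma sat_rename: "sat M e (rename \<phi> h) \<longleftrightarrow> sat M (e \<circ> h) \<phi>"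
proof (induction \<phi> arbitrary: e h)
  case (Ex i \<phi>)
  define j where "j = Suc (Max (insert 0 (h ` free_vars \<phi>)))"
  have less: "h k < j" if "k \<in> free_vars \<phi>" for k
    unfolding j_def using that by (simp add: le_imp_less_Suc finite_free_vars)
  have "sat M (e(j := u)) (rename \<phi> (h(i := j))) \<longleftrightarrow> sat M ((e \<circ> h)(i := u)) \<phi>" for u
    unfolding Ex by (rule sat_cong) (use less in fastforce)
  then show ?case by (simp only: rename.simps Let_def j_def[symmetric] sat.simps)
next
  case (Eq s t)
  show ?case by (simp only: rename.simps sat.simps tm_val_rename)
next
  case (Rel r ts)
  have "map (tm_val M e \<circ> rename_tm h) ts = map (tm_val M (e \<circ> h)) ts"
    by (intro map_cong) (auto simp: tm_val_rename)
  then show ?case by (simp only: rename.simps sat.simps map_map)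
qed simp_all

definition subst_vars :: "nat list \<Rightarrow> ('f, 'r) fm \<Rightarrow> ('f, 'r) fm" where
  "subst_vars ks \<phi> = rename \<phi> (\<lambda>i. ks ! i)"

lemma subst_vars_formulas:
  assumes "\<phi> \<in> formulas L k" "length ks = k" "set ks \<subseteq> {..<m}"
  shows "subst_vars ks \<phi> \<in> formulas L m"
proof -
  have "free_vars (subst_vars ks \<phi>) \<subseteq> (\<lambda>i. ks ! i) ` {..<k}"
    using free_vars_rename[of \<phi> "\<lambda>i. ks ! i"] assms unfolding subst_vars_def formulas_def by blast
  also have "\<dots> \<subseteq> {..<m}" using assms by (auto dest: nth_mem)
  finally show ?thesis using assms by (simp add: formulas_def subst_vars_def fm_in_rename)
qed

lemma holds_subst_vars:
  assumes "free_vars \<phi> \<subseteq> {..<length ks}" "set ks \<subseteq> {..<length a}"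
  shows "holds M (subst_vars ks \<phi>) a \<longleftrightarrow> holds M \<phi> (map ((!) a) ks)"
  unfolding holds_list_env subst_vars_def sat_rename
proof (rule sat_cong)
  fix i assume "i \<in> free_vars \<phi>"
  then have "i < length ks" using assms by auto
  moreover from this have "ks ! i < length a" using assms(2) nth_mem by fastforce
  ultimately show "(list_env a \<circ> (!) ks) i = list_env (map ((!) a) ks) i" by simp
qed

lemma formulas_mono: "k \<le> m \<Longrightarrow> formulas L k \<subseteq> formulas L m"
  by (auto simp: formulas_def)

lemma holds_append:
  assumes "free_vars \<phi> \<subseteq> {..<length a}"
  shows "holds M \<phi> (a @ b) \<longleftrightarrow> holds M \<phi> a"
  unfolding holds_list_env by (rule sat_cong) (use assms in \<open>auto simp: nth_append\<close>)

definition Imp :: "('f, 'r) fm \<Rightarrow> ('f, 'r) fm \<Rightarrow> ('f, 'r) fm" where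
  "Imp \<phi> \<psi> = Neg (Conj \<phi> (Neg \<psi>))"

definition Iff :: "('f, 'r) fm \<Rightarrow> ('f, 'r) fm \<Rightarrow> ('f, 'r) fm" where
  "Iff \<phi> \<psi> = Conj (Imp \<phi> \<psi>) (Imp \<psi> \<phi>)"

definition All :: "nat \<Rightarrow> ('f, 'r) fm \<Rightarrow> ('f, 'r) fm" where
  "All i \<phi> = Neg (Ex i (Neg \<phi>))"

text \<open>The empty conjunction is a closed formula, so that it belongs to
  \<open>formulas L n\<close> for every \<open>n\<close>, including 0.\<close>

definition Conjs :: "('f, 'r) fm list \<Rightarrow> ('f, 'r) fm" where
  "Conjs \<phi>s = foldr Conj \<phi>s (All 0 (Eq (Var 0) (Var 0)))"

definition Disjs :: "('f, 'r) fm list \<Rightarrow> ('f, 'r) fm" where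
  "Disjs \<phi>s = Neg (Conjs (map Neg \<phi>s))"

definition Exs :: "nat \<Rightarrow> nat \<Rightarrow> ('f, 'r) fm \<Rightarrow> ('f, 'r) fm" where
  "Exs i k \<phi> = foldr Ex [i..<i + k] \<phi>"

definition Alls :: "nat \<Rightarrow> nat \<Rightarrow> ('f, 'r) fm \<Rightarrow> ('f, 'r) fm" where
  "Alls i k \<phi> = Neg (Exs i k (Neg \<phi>))"

lemma sat_connectives [simp]:
  "sat M e (Imp \<phi> \<psi>) \<longleftrightarrow> (sat M e \<phi> \<longrightarrow> sat M e \<psi>)"
  "sat M e (Iff \<phi> \<psi>) \<longleftrightarrow> (sat M e \<phi> \<longleftrightarrow> sat M e \<psi>)"
  "sat M e (All i \<phi>) \<longleftrightarrow> (\<forall>u\<in>univ M. sat M (e(i := u)) \<phi>)"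
  by (auto simp: Imp_def Iff_def All_def)

lemma sat_Conjs [simp]: "sat M e (Conjs \<phi>s) \<longleftrightarrow> (\<forall>\<phi>\<in>set \<phi>s. sat M e \<phi>)"
  by (induction \<phi>s) (auto simp: Conjs_def)

lemma sat_Disjs [simp]: "sat M e (Disjs \<phi>s) \<longleftrightarrow> (\<exists>\<phi>\<in>set \<phi>s. sat M e \<phi>)"
  by (simp add: Disjs_def)

lemma holds_connectives [simp]:
  "holds M (Eq s t) a \<longleftrightarrow> tm_val M (list_env a) s = tm_val M (list_env a) t"
  "holds M (Neg \<phi>) a \<longleftrightarrow> \<not> holds M \<phi> a"
  "holds M (Conj \<phi> \<psi>) a \<longleftrightarrow> holds M \<phi> a \<and> holds M \<psi> a"
  "holds M (Imp \<phi> \<psi>) a \<longleftrightarrow> (holds M \<phi> a \<longrightarrow> holds M \<psi> a)"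
  "holds M (Iff \<phi> \<psi>) a \<longleftrightarrow> (holds M \<phi> a \<longleftrightarrow> holds M \<psi> a)"
  "holds M (Conjs \<phi>s) a \<longleftrightarrow> (\<forall>\<phi>\<in>set \<phi>s. holds M \<phi> a)"
  "holds M (Disjs \<phi>s) a \<longleftrightarrow> (\<exists>\<phi>\<in>set \<phi>s. holds M \<phi> a)"
  by (simp_all add: holds_list_env)

lemma holds_Ex: "n = length a \<Longrightarrow> holds M (Ex n \<phi>) a \<longleftrightarrow> (\<exists>u\<in>univ M. holds M \<phi> (a @ [u]))"
  by (simp add: holds_list_env list_env_upd)

lemma holds_All: "n = length a \<Longrightarrow> holds M (All n \<phi>) a \<longleftrightarrow> (\<forall>u\<in>univ M. holds M \<phi> (a @ [u]))"
  by (simp add: holds_list_env list_env_upd)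

lemma tuples_0 [simp]: "tuples M 0 = {[]}"
  by (auto simp: tuples_def)

lemma tuples_Suc_iff: "c \<in> tuples M (Suc k) \<longleftrightarrow> (\<exists>u c'. c = u # c' \<and> u \<in> univ M \<and> c' \<in> tuples M k)"
  by (auto simp: tuples_def length_Suc_conv)

lemma tuples_append: "a \<in> tuples M m \<Longrightarrow> b \<in> tuples M n \<Longrightarrow> a @ b \<in> tuples M (m + n)"
  by (auto simp: tuples_def)

lemma tuples_length: "a \<in> tuples M m \<Longrightarrow> length a = m"
  by (simp add: tuples_def)

lemma tuples_nth: "a \<in> tuples M m \<Longrightarrow> i < m \<Longrightarrow> a ! i \<in> univ M"
  by (auto simp: tuples_def)

lemma tuples_split:
  assumes "a \<in> tuples M (m + n)"
  obtains b c where "a = b @ c" "b \<in> tuples M m" "c \<in> tuples M n"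
proof
  show "a = take m a @ drop m a" by simp
  show "take m a \<in> tuples M m" "drop m a \<in> tuples M n"
    using assms by (auto simp: tuples_def dest: in_set_takeD in_set_dropD)
qed

lemma holds_Exs:
  "n = length a \<Longrightarrow> holds M (Exs n k \<phi>) a \<longleftrightarrow> (\<exists>c\<in>tuples M k. holds M \<phi> (a @ c))"
proof (induction k arbitrary: n a)
  case 0
  then show ?case by (simp add: Exs_def)
next
  case (Suc k)
  have "Exs n (Suc k) \<phi> = Ex n (Exs (Suc n) k \<phi>)"
    by (simp add: Exs_def upt_conv_Cons del: upt_Suc)
  then have "holds M (Exs n (Suc k) \<phi>) a \<longleftrightarrow> (\<exists>u\<in>univ M. holds M (Exs (Suc n) k \<phi>) (a @ [u]))"
    using Suc.prems by (simp add: holds_Ex)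
  also have "\<dots> \<longleftrightarrow> (\<exists>u\<in>univ M. \<exists>c\<in>tuples M k. holds M \<phi> (a @ u # c))"
    using Suc.IH[of "Suc n" "a @ [u]" for u] Suc.prems by simp
  also have "\<dots> \<longleftrightarrow> (\<exists>c\<in>tuples M (Suc k). holds M \<phi> (a @ c))"
    by (auto simp: tuples_Suc_iff Bex_def)
  finally show ?case .
qed

lemma holds_Alls:
  "n = length a \<Longrightarrow> holds M (Alls n k \<phi>) a \<longleftrightarrow> (\<forall>c\<in>tuples M k. holds M \<phi> (a @ c))"
  by (simp add: Alls_def holds_Exs)

lemma fm_in_connectives [simp]:
  "fm_in L (Imp \<phi> \<psi>) \<longleftrightarrow> fm_in L \<phi> \<and> fm_in L \<psi>"
  "fm_in L (Iff \<phi> \<psi>) \<longleftrightarrow> fm_in L \<phi> \<and> fm_in L \<psi>"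
  "fm_in L (All i \<phi>) \<longleftrightarrow> fm_in L \<phi>"
  by (auto simp: Imp_def Iff_def All_def)

lemma formulas_connectives:
  "Neg \<phi> \<in> formulas L n \<longleftrightarrow> \<phi> \<in> formulas L n"
  "Conj \<phi> \<psi> \<in> formulas L n \<longleftrightarrow> \<phi> \<in> formulas L n \<and> \<psi> \<in> formulas L n"
  "Imp \<phi> \<psi> \<in> formulas L n \<longleftrightarrow> \<phi> \<in> formulas L n \<and> \<psi> \<in> formulas L n"
  "Iff \<phi> \<psi> \<in> formulas L n \<longleftrightarrow> \<phi> \<in> formulas L n \<and> \<psi> \<in> formulas L n"
  by (auto simp: formulas_def Imp_def Iff_def)

lemma formulas_Conjs: "Conjs \<phi>s \<in> formulas L n \<longleftrightarrow> set \<phi>s \<subseteq> formulas L n"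
  by (induction \<phi>s) (auto simp: formulas_def Conjs_def All_def)

lemma formulas_Disjs: "Disjs \<phi>s \<in> formulas L n \<longleftrightarrow> set \<phi>s \<subseteq> formulas L n"
  by (auto simp: Disjs_def formulas_connectives formulas_Conjs)

lemma formulas_Ex: "\<phi> \<in> formulas L (Suc n) \<Longrightarrow> Ex n \<phi> \<in> formulas L n"
  by (auto simp: formulas_def less_Suc_eq)

lemma formulas_All: "\<phi> \<in> formulas L (Suc n) \<Longrightarrow> All n \<phi> \<in> formulas L n"
  by (simp add: All_def formulas_connectives formulas_Ex)

lemma formulas_Exs: "\<phi> \<in> formulas L (n + k) \<Longrightarrow> Exs n k \<phi> \<in> formulas L n"
proof (induction k arbitrary: \<phi>)
  case 0
  then show ?case by (simp add: Exs_def)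
next
  case (Suc k)
  have "Exs n (Suc k) \<phi> = Exs n k (Ex (n + k) \<phi>)" by (simp add: Exs_def)
  with Suc show ?case by (simp add: formulas_Ex)
qed

lemma formulas_Alls: "\<phi> \<in> formulas L (n + k) \<Longrightarrow> Alls n k \<phi> \<in> formulas L n"
  by (simp add: Alls_def formulas_connectives formulas_Exs)

lemma tm_in_sublanguage: "sublanguage K L \<Longrightarrow> tm_in K t \<Longrightarrow> tm_in L t"
proof (induction t)
  case (Fn f ts)
  then have "f \<in> fsyms K" by simp
  then have "f \<in> fsyms L" "farity K f = farity L f"
    using Fn.prems(1) unfolding sublanguage_def by blast+
  then show ?case using Fn by (simp add: list_all_iff)
qed simp

lemma fm_in_sublanguage: "sublanguage K L \<Longrightarrow> fm_in K \<phi> \<Longrightarrow> fm_in L \<phi>"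
proof (induction \<phi>)
  case (Rel r ts)
  then have "r \<in> rsyms K" by simp
  then have "r \<in> rsyms L" "rarity K r = rarity L r"
    using Rel.prems(1) unfolding sublanguage_def by blast+
  then show ?case using Rel by (simp add: list_all_iff tm_in_sublanguage)
qed (simp_all add: tm_in_sublanguage)

lemma formulas_sublanguage: "sublanguage K L \<Longrightarrow> formulas K n \<subseteq> formulas L n"
  by (auto simp: formulas_def fm_in_sublanguage)

lemma tuples_snoc_iff: "a \<in> tuples M (Suc k) \<longleftrightarrow> (\<exists>b u. a = b @ [u] \<and> b \<in> tuples M k \<and> u \<in> univ M)"
  by (auto simp: tuples_def length_Suc_conv_rev)

section \<open>Similarity as a first-order formula\<close>

abbreviation zeroT :: "'f fsym tm" where "zeroT \<equiv> Fn Zero []"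
abbreviation oneT :: "'f fsym tm" where "oneT \<equiv> Fn One []"
abbreviation addT :: "'f fsym tm \<Rightarrow> 'f fsym tm \<Rightarrow> 'f fsym tm" where "addT s t \<equiv> Fn Add [s, t]"
abbreviation subT :: "'f fsym tm \<Rightarrow> 'f fsym tm \<Rightarrow> 'f fsym tm" where "subT s t \<equiv> Fn Sub [s, t]"
abbreviation mulT :: "'f fsym tm \<Rightarrow> 'f fsym tm \<Rightarrow> 'f fsym tm" where "mulT s t \<equiv> Fn Mul [s, t]"

primrec numT :: "nat \<Rightarrow> 'f fsym tm" where
  "numT 0 = zeroT"
| "numT (Suc n) = addT (numT n) oneT"

primrec powT :: "'f fsym tm \<Rightarrow> nat \<Rightarrow> 'f fsym tm" where
  "powT t 0 = oneT"
| "powT t (Suc n) = mulT t (powT t n)"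

text \<open>In a p-adic field, \<open>leF p i s t\<close> says \<open>\<bar>s\<bar> \<le> \<bar>t\<bar>\<close>; \<open>i\<close> is a fresh variable. If \<open>t \<noteq> 0\<close>, then
  \<open>y\<^sup>2 + y t = p s\<^sup>2\<close> reads \<open>z\<^sup>2 + z = p (s / t)\<^sup>2\<close> for \<open>z = y / t\<close>, which is solvable by Hensel's lemma
  if \<open>\<bar>s\<bar> \<le> \<bar>t\<bar>\<close>, and otherwise unsolvable as the valuation of the right-hand side is odd.\<close>

definition leF :: "nat \<Rightarrow> nat \<Rightarrow> 'f fsym tm \<Rightarrow> 'f fsym tm \<Rightarrow> ('f fsym, 'r rsym) fm" where
  "leF p i s t = Ex i (Eq (addT (mulT (Var i) (Var i)) (mulT (Var i) t)) (mulT (numT p) (mulT s s)))"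

definition pclF :: "nat \<Rightarrow> nat \<Rightarrow> 'f fsym tm \<Rightarrow> 'f fsym tm \<Rightarrow> ('f fsym, 'r rsym) fm" where
  "pclF i n s t = Ex i (Conj (Neg (Eq (Var i) zeroT)) (Eq t (mulT (powT (Var i) n) s)))"

text \<open>The variables are x, x', c, d in this order; index 4 is left for the quantifiers of the
  subformulas. As \<open>p\<close> has norm 1/p, the comparisons at \<open>j\<close> mean
  \<open>|x - c| p^j \<le> |d - c|\<close> and \<open>|x - c| \<le> p^j |d - c|\<close>.\<close>

definition sim1F :: "nat \<Rightarrow> nat \<Rightarrow> ('f fsym, 'r rsym) fm" where
  "sim1F p s =
     (let y = subT (Var 0) (Var 2); y' = subT (Var 1) (Var 2); d = subT (Var 3) (Var 2) in
      Conjs (map (\<lambda>n. pclF 4 n y y') [1..<Suc s] @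
        map (\<lambda>j. Conj
          (Iff (leF p 4 y (mulT (powT (numT p) j) d)) (leF p 4 y' (mulT (powT (numT p) j) d)))
          (Iff (leF p 4 (mulT (powT (numT p) j) y) d) (leF p 4 (mulT (powT (numT p) j) y') d)))
        [0..<Suc s]))"

definition simM :: "('f fsym, 'r rsym, 'u) struct \<Rightarrow> nat \<Rightarrow> nat \<Rightarrow> 'u set \<Rightarrow> 'u \<Rightarrow> 'u \<Rightarrow> bool" where
  "simM M p s C x x' \<longleftrightarrow> (\<forall>c\<in>C. \<forall>d\<in>C. holds M (sim1F p s) [x, x', c, d])"

text \<open>Similarity of \<open>v\<^sub>i\<close> and \<open>v\<^sub>j\<close> with respect to the centres \<open>v\<^sub>k, \<dots>, v\<^bsub>k+K-1\<^esub>\<close>.\<close>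

definition simF :: "nat \<Rightarrow> nat \<Rightarrow> nat \<Rightarrow> nat \<Rightarrow> nat \<Rightarrow> nat \<Rightarrow> ('f fsym, 'r rsym) fm" where
  "simF p s k K i j = Conjs [subst_vars [i, j, c, d] (sim1F p s). c \<leftarrow> [k..<k + K], d \<leftarrow> [k..<k + K]]"

text \<open>The parameters come first, then the \<open>K\<close> centres, then the two points.
  \<open>K\<close> is at once the number of centres and the precision of the similarity: with one
  bound for both, \<open>goodF\<close> becomes weaker as \<open>K\<close> grows, as a compactness
  argument requires. The first two centres differ because (2) and (3) need two distinct
  centres.\<close>

definition centresF :: "nat \<Rightarrow> ('f fsym, 'r rsym) fm \<Rightarrow> nat \<Rightarrow> nat \<Rightarrow> ('f fsym, 'r rsym) fm" where
  "centresF p \<phi> n K = Conj (Neg (Eq (Var n) (Var (Suc n))))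
     (All (n + K) (All (Suc (n + K)) (Imp (simF p K n K (n + K) (Suc (n + K)))
       (Iff (subst_vars ((n + K) # [0..<n]) \<phi>) (subst_vars (Suc (n + K) # [0..<n]) \<phi>)))))"

definition goodF :: "nat \<Rightarrow> ('f fsym, 'r rsym) fm \<Rightarrow> nat \<Rightarrow> nat \<Rightarrow> ('f fsym, 'r rsym) fm" where
  "goodF p \<phi> n K = Exs n K (centresF p \<phi> n K)"

text \<open>The equation \<open>x = c + (d - c) u / p^W\<close> without division, for the variables
  c, d, x in this order.\<close>

definition pointF :: "nat \<Rightarrow> nat \<Rightarrow> nat \<Rightarrow> ('f fsym, 'r rsym) fm" where
  "pointF p W u = Eq (mulT (powT (numT p) W) (subT (Var 2) (Var 0))) (mulT (numT u) (subT (Var 1) (Var 0)))"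

definition representF :: "nat \<Rightarrow> nat \<Rightarrow> nat \<Rightarrow> nat \<Rightarrow> nat \<Rightarrow> ('f fsym, 'r rsym) fm" where
  "representF p s W V K = Alls 0 (Suc K) (Imp (Neg (Eq (Var 0) (Var 1)))
     (Disjs [All (Suc K) (Imp (subst_vars [c, d, Suc K] (pointF p W u)) (simF p s 0 K K (Suc K))).
        c \<leftarrow> [0..<K], d \<leftarrow> [0..<K], u \<leftarrow> [0..<p ^ V]]))"

text \<open>That there are fewer than \<open>N\<close> similarity classes is expressed by the
  pigeonhole principle: among any \<open>N\<close> points two are similar.\<close>

definition countF :: "nat \<Rightarrow> nat \<Rightarrow> nat \<Rightarrow> nat \<Rightarrow> ('f fsym, 'r rsym) fm" where
  "countF p s K N = Alls 0 (K + N) (Imp (Neg (Eq (Var 0) (Var 1)))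
     (Disjs [simF p s 0 K (K + i) (K + j). j \<leftarrow> [0..<N], i \<leftarrow> [0..<j]]))"

section \<open>Well-formedness and meaning of the similarity formulas\<close>

lemma tm_in_numT [simp]: "tm_in Lp (numT n)"
  by (induction n) (auto simp: Lp_def)

lemma tm_vars_numT [simp]: "tm_vars (numT n) = {}"
  by (induction n) auto

lemma tm_in_powT [simp]:
  "tm_in (Lp :: ('f fsym, 'r rsym) language) t \<Longrightarrow> tm_in (Lp :: ('f fsym, 'r rsym) language) (powT t n)"
  by (induction n) (auto simp: Lp_def)

lemma tm_vars_powT: "tm_vars (powT t n) \<subseteq> tm_vars t"
  by (induction n) auto

lemma tm_in_Lp_simps [simp]:
  fixes K :: "('f fsym, 'r rsym) language"
  defines "K \<equiv> Lp"
  shows "tm_in K zeroT" "tm_in K oneT"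
    "tm_in K (addT s t) \<longleftrightarrow> tm_in K s \<and> tm_in K t"
    "tm_in K (subT s t) \<longleftrightarrow> tm_in K s \<and> tm_in K t"
    "tm_in K (mulT s t) \<longleftrightarrow> tm_in K s \<and> tm_in K t"
  by (auto simp: K_def Lp_def)

declare tm_in.simps(2) [simp del]

lemma subset_formulasD: "\<phi> \<in> formulas L n \<Longrightarrow> free_vars \<phi> \<subseteq> {..<n}"
  by (simp add: formulas_def)

text \<open>Membership of a term in \<open>Lp\<close> does not involve relation symbols, but the
  type of \<open>Lp\<close> contains their type; the argument \<open>R\<close> fixes it.\<close>

definition termsLp :: "nat \<Rightarrow> 'r itself \<Rightarrow> 'f fsym tm set" where
  "termsLp n R = {t. tm_in (Lp :: ('f fsym, 'r rsym) language) t \<and> tm_vars t \<subseteq> {..<n}}"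

lemma termsLp_intros:
  "i < n \<Longrightarrow> Var i \<in> termsLp n R" "numT m \<in> termsLp n R" "zeroT \<in> termsLp n R"
  "t \<in> termsLp n R \<Longrightarrow> powT t m \<in> termsLp n R"
  "s \<in> termsLp n R \<Longrightarrow> t \<in> termsLp n R \<Longrightarrow> addT s t \<in> termsLp n R"
  "s \<in> termsLp n R \<Longrightarrow> t \<in> termsLp n R \<Longrightarrow> subT s t \<in> termsLp n R"
  "s \<in> termsLp n R \<Longrightarrow> t \<in> termsLp n R \<Longrightarrow> mulT s t \<in> termsLp n R"
  using tm_vars_powT[of t m] by (auto simp: termsLp_def)

lemma termsLp_mono: "t \<in> termsLp n R \<Longrightarrow> n \<le> m \<Longrightarrow> t \<in> termsLp m R"
  by (auto simp: termsLp_def)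

lemma Eq_formula:
  "s \<in> termsLp n TYPE('r) \<Longrightarrow> t \<in> termsLp n TYPE('r) \<Longrightarrow> (Eq s t :: ('f fsym, 'r rsym) fm) \<in> formulas Lp n"
  by (auto simp: termsLp_def formulas_def)

lemma leF_formula:
  assumes "s \<in> termsLp n TYPE('r)" "t \<in> termsLp n TYPE('r)"
  shows "(leF p n s t :: ('f fsym, 'r rsym) fm) \<in> formulas Lp n"
  unfolding leF_def
  by (intro formulas_Ex Eq_formula termsLp_intros) (auto intro: termsLp_mono assms)

lemma pclF_formula:
  assumes "s \<in> termsLp k TYPE('r)" "t \<in> termsLp k TYPE('r)"
  shows "(pclF k n s t :: ('f fsym, 'r rsym) fm) \<in> formulas Lp k"
  unfolding pclF_def
  by (intro formulas_Ex, simp only: formulas_connectives, intro conjI Eq_formula termsLp_intros)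
     (auto intro: termsLp_mono assms)

lemma sim1F_formula: "sim1F p s \<in> formulas Lp 4"
  unfolding sim1F_def Let_def formulas_Conjs
  by (auto simp: formulas_connectives intro!: leF_formula pclF_formula termsLp_intros simp del: upt_Suc)

lemma holds_sim1F:
  defines "y \<equiv> subT (Var 0) (Var 2)" and "y' \<equiv> subT (Var 1) (Var 2)" and "d \<equiv> subT (Var 3) (Var 2)"
  shows "holds M (sim1F p s) a \<longleftrightarrow> (\<forall>n\<in>{1..s}. holds M (pclF 4 n y y') a) \<and>
    (\<forall>j\<in>{..s}. (holds M (leF p 4 y (mulT (powT (numT p) j) d)) a \<longleftrightarrow>
              holds M (leF p 4 y' (mulT (powT (numT p) j) d)) a) \<and>
            (holds M (leF p 4 (mulT (powT (numT p) j) y) d) a \<longleftrightarrow>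
              holds M (leF p 4 (mulT (powT (numT p) j) y') d) a))"
  unfolding sim1F_def y_def y'_def d_def Let_def
  by (simp only: holds_connectives set_append set_map set_upt atLeastLessThanSuc_atLeastAtMost
      ball_Un ball_simps atLeast0AtMost)

lemma bex_concat_upt: "(\<exists>x\<in>set (concat (map f [0..<n])). P x) \<longleftrightarrow> (\<exists>i<n. \<exists>x\<in>set (f i). P x)"
  by auto

lemma bex_map_upt: "(\<exists>x\<in>set (map f [0..<n]). P x) \<longleftrightarrow> (\<exists>i<n. P (f i))"
  by auto

lemma simF_formula:
  assumes "i < n" "j < n" "k + K \<le> n"
  shows "simF p s k K i j \<in> formulas Lp n"
  using assms unfolding simF_def formulas_Conjs
  by (auto intro!: subst_vars_formulas[OF sim1F_formula])

lemma holds_simF: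
  fixes M :: "('f fsym, 'r rsym, 'u) struct"
  assumes "i < length a" "j < length a" "k + K \<le> length a"
  shows "holds M (simF p s k K i j) a \<longleftrightarrow> simM M p s (set (take K (drop k a))) (a ! i) (a ! j)"
proof -
  have "free_vars (sim1F p s :: ('f fsym, 'r rsym) fm) \<subseteq> {..<4}"
    by (rule subset_formulasD[OF sim1F_formula])
  then have "holds M (subst_vars [i, j, c, d] (sim1F p s)) a \<longleftrightarrow> holds M (sim1F p s) [a ! i, a ! j, a ! c, a ! d]"
    if "c \<in> {k..<k + K}" "d \<in> {k..<k + K}" for c d
    using that assms by (subst holds_subst_vars) (simp_all add: numeral_eq_Suc)
  moreover have "set (take K (drop k a)) = (\<lambda>c. a ! c) ` {k..<k + K}"
  proof -
    have "take K (drop k a) = map (\<lambda>c. a ! c) [k..<k + K]"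
      using assms by (intro nth_equalityI) auto
    then show ?thesis by simp
  qed
  ultimately show ?thesis by (simp add: simF_def simM_def)
qed

lemma centresF_formula:
  assumes "\<phi> \<in> formulas L (Suc n)" "sublanguage Lp L" "K \<ge> 2"
  shows "centresF p \<phi> n K \<in> formulas L (n + K)"
proof -
  have "simF p K n K (n + K) (Suc (n + K)) \<in> formulas L (n + K + 2)"
    by (rule subsetD[OF formulas_sublanguage[OF assms(2)] simF_formula]) auto
  moreover have "subst_vars ((n + K) # [0..<n]) \<phi> \<in> formulas L (n + K + 2)"
    "subst_vars (Suc (n + K) # [0..<n]) \<phi> \<in> formulas L (n + K + 2)"
    using assms by (auto intro!: subst_vars_formulas)
  moreover have "Eq (Var n) (Var (Suc n)) \<in> formulas L (n + K)" using assms by (simp add: formulas_def)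
  ultimately show ?thesis unfolding centresF_def
    by (auto intro!: formulas_All simp: formulas_connectives)
qed

lemma goodF_formula:
  "\<phi> \<in> formulas L (Suc n) \<Longrightarrow> sublanguage Lp L \<Longrightarrow> K \<ge> 2 \<Longrightarrow> goodF p \<phi> n K \<in> formulas L n"
  unfolding goodF_def by (intro formulas_Exs centresF_formula)

text \<open>In \<open>\<phi>(x; y)\<close> the point comes first, whereas in \<open>centresF\<close>
  it comes after the parameters and the centres; the substitution restores the order.\<close>

lemma holds_subst_shift:
  assumes "free_vars \<phi> \<subseteq> {..<Suc n}" "length b = n" "length c = m"
  shows "holds M (subst_vars ((n + m) # [0..<n]) \<phi>) (b @ c @ x # xs) \<longleftrightarrow> holds M \<phi> (x # b)"
    "holds M (subst_vars (Suc (n + m) # [0..<n]) \<phi>) (b @ c @ [y, x]) \<longleftrightarrow> holds M \<phi> (x # b)"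
proof -
  have *: "map ((!) (b @ zs)) [0..<n] = b" for zs
    using assms by (intro nth_equalityI) (auto simp: nth_append)
  show "holds M (subst_vars ((n + m) # [0..<n]) \<phi>) (b @ c @ x # xs) \<longleftrightarrow> holds M \<phi> (x # b)"
    "holds M (subst_vars (Suc (n + m) # [0..<n]) \<phi>) (b @ c @ [y, x]) \<longleftrightarrow> holds M \<phi> (x # b)"
    using assms * by (subst holds_subst_vars; auto simp: nth_append)+
qed

lemma holds_centresF:
  assumes "\<phi> \<in> formulas L (Suc n)" "b \<in> tuples M n" "c \<in> tuples M K" "K \<ge> 2"
  shows "holds M (centresF p \<phi> n K) (b @ c) \<longleftrightarrow> c ! 0 \<noteq> c ! 1 \<and>
    (\<forall>x\<in>univ M. \<forall>x'\<in>univ M. simM M p K (set c) x x' \<longrightarrow> (holds M \<phi> (x # b) \<longleftrightarrow> holds M \<phi> (x' # b)))"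
proof -
  have b: "length b = n" and c: "length c = K" using assms by (simp_all add: tuples_length)
  have fv: "free_vars \<phi> \<subseteq> {..<Suc n}" using assms by (simp add: formulas_def)
  have "holds M (simF p K n K (n + K) (Suc (n + K))) (b @ c @ [x, x']) \<longleftrightarrow> simM M p K (set c) x x'" for x x'
    using b c by (subst holds_simF) (auto simp: nth_append)
  then show ?thesis unfolding centresF_def
    using b c assms(4) holds_subst_shift[OF fv b c] by (simp add: holds_All nth_append)
qed

lemma holds_goodF:
  assumes "\<phi> \<in> formulas L (Suc n)" "b \<in> tuples M n" "K \<ge> 2"
  shows "holds M (goodF p \<phi> n K) b \<longleftrightarrow> (\<exists>c\<in>tuples M K. c ! 0 \<noteq> c ! 1 \<and>
    (\<forall>x\<in>univ M. \<forall>x'\<in>univ M. simM M p K (set c) x x' \<longrightarrow> (holds M \<phi> (x # b) \<longleftrightarrow> holds M \<phi> (x' # b))))"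
  unfolding goodF_def using holds_centresF[OF assms(1,2) _ assms(3)] assms(2)
  by (simp add: holds_Exs tuples_length)

lemma pointF_formula: "pointF p W u \<in> formulas Lp 3"
  unfolding pointF_def by (intro Eq_formula termsLp_intros) auto

lemma representF_sentence:
  assumes "K \<ge> 2"
  shows "representF p s W V K \<in> sentences Lp"
proof -
  have 1: "All (Suc K) (Imp (subst_vars [c, d, Suc K] (pointF p W u)) (simF p s 0 K K (Suc K))) \<in> formulas Lp (Suc K)"
    if "c < K" "d < K" for c d u
    using that by (auto intro!: formulas_All simF_formula subst_vars_formulas[OF pointF_formula]
        simp: formulas_connectives)
  have "Eq (Var 0) (Var 1) \<in> formulas Lp (Suc K)" using assms by (auto simp: formulas_def)
  then have "Imp (Neg (Eq (Var 0) (Var 1)))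
     (Disjs [All (Suc K) (Imp (subst_vars [c, d, Suc K] (pointF p W u)) (simF p s 0 K K (Suc K))).
        c \<leftarrow> [0..<K], d \<leftarrow> [0..<K], u \<leftarrow> [0..<p ^ V]]) \<in> formulas Lp (Suc K)"
    using 1 by (auto simp: formulas_connectives formulas_Disjs)
  then show ?thesis unfolding representF_def sentences_def by (intro formulas_Alls) simp
qed

lemma countF_sentence:
  assumes "K \<ge> 2"
  shows "countF p s K N \<in> sentences Lp"
proof -
  have "Eq (Var 0) (Var 1) \<in> formulas Lp (K + N)" using assms by (auto simp: formulas_def)
  then have "Imp (Neg (Eq (Var 0) (Var 1)))
     (Disjs [simF p s 0 K (K + i) (K + j). j \<leftarrow> [0..<N], i \<leftarrow> [0..<j]]) \<in> formulas Lp (K + N)"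
    by (auto simp: formulas_connectives formulas_Disjs intro!: simF_formula)
  then show ?thesis unfolding countF_def sentences_def by (intro formulas_Alls) simp
qed

lemma holds_representF:
  fixes M :: "('f fsym, 'r rsym, 'u) struct"
  assumes "K \<ge> 2"
  shows "holds M (representF p s W V K) [] \<longleftrightarrow> (\<forall>c\<in>tuples M K. \<forall>x\<in>univ M. c ! 0 \<noteq> c ! 1 \<longrightarrow>
    (\<exists>a\<in>set c. \<exists>d\<in>set c. \<exists>u<p ^ V. \<forall>x'\<in>univ M. holds M (pointF p W u) [a, d, x'] \<longrightarrow> simM M p s (set c) x x'))"
proof -
  have fv: "free_vars (pointF p W u :: ('f fsym, 'r rsym) fm) \<subseteq> {..<3}" for u
    by (rule subset_formulasD[OF pointF_formula])
  have "holds M (Imp (Neg (Eq (Var 0) (Var 1)))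
     (Disjs [All (Suc K) (Imp (subst_vars [c, d, Suc K] (pointF p W u)) (simF p s 0 K K (Suc K))).
        c \<leftarrow> [0..<K], d \<leftarrow> [0..<K], u \<leftarrow> [0..<p ^ V]])) (c @ [x]) \<longleftrightarrow> (c ! 0 \<noteq> c ! 1 \<longrightarrow>
    (\<exists>a\<in>set c. \<exists>d\<in>set c. \<exists>u<p ^ V. \<forall>x'\<in>univ M. holds M (pointF p W u) [a, d, x'] \<longrightarrow> simM M p s (set c) x x'))"
    if c: "c \<in> tuples M K" for c x
  proof -
    have lc: "length c = K" using c by (simp add: tuples_length)
    have 1: "holds M (simF p s 0 K K (Suc K)) (c @ [x, x']) \<longleftrightarrow> simM M p s (set c) x x'" for x'
      using lc by (subst holds_simF) (auto simp: nth_append)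
    have 2: "holds M (subst_vars [i, j, Suc K] (pointF p W u)) (c @ [x, x']) \<longleftrightarrow> holds M (pointF p W u) [c ! i, c ! j, x']"
      if "i < K" "j < K" for i j u x'
      using lc that fv by (subst holds_subst_vars) (simp_all add: nth_append numeral_eq_Suc)
    have 3: "(\<exists>a\<in>set c. Q a) \<longleftrightarrow> (\<exists>i<K. Q (c ! i))" for Q
      using lc by (force simp: in_set_conv_nth)
    have "holds M (Disjs [All (Suc K) (Imp (subst_vars [c, d, Suc K] (pointF p W u)) (simF p s 0 K K (Suc K))).
        c \<leftarrow> [0..<K], d \<leftarrow> [0..<K], u \<leftarrow> [0..<p ^ V]]) (c @ [x]) \<longleftrightarrow>
        (\<exists>i<K. \<exists>j<K. \<exists>u<p ^ V. holds M (All (Suc K)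
          (Imp (subst_vars [i, j, Suc K] (pointF p W u)) (simF p s 0 K K (Suc K)))) (c @ [x]))"
      by (simp only: holds_connectives bex_concat_upt bex_map_upt)
    also have "\<dots> \<longleftrightarrow> (\<exists>i<K. \<exists>j<K. \<exists>u<p ^ V.
        \<forall>x'\<in>univ M. holds M (pointF p W u) [c ! i, c ! j, x'] \<longrightarrow> simM M p s (set c) x x')"
      by (intro iff_exI conj_cong refl) (simp add: holds_All lc 1 2)
    also have "\<dots> \<longleftrightarrow> (\<exists>a\<in>set c. \<exists>d\<in>set c. \<exists>u<p ^ V.
        \<forall>x'\<in>univ M. holds M (pointF p W u) [a, d, x'] \<longrightarrow> simM M p s (set c) x x')"
      by (simp only: 3)
    finally show ?thesis using lc assms by (simp add: nth_append)
  qed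
  moreover have "(\<forall>a\<in>tuples M (Suc K). Q a) \<longleftrightarrow> (\<forall>c\<in>tuples M K. \<forall>x\<in>univ M. Q (c @ [x]))" for Q
    by (auto simp: tuples_snoc_iff)
  ultimately show ?thesis unfolding representF_def by (simp add: holds_Alls)
qed

lemma holds_countF:
  assumes "K \<ge> 2"
  shows "holds M (countF p s K N) [] \<longleftrightarrow> (\<forall>c\<in>tuples M K. \<forall>xs\<in>tuples M N. c ! 0 \<noteq> c ! 1 \<longrightarrow>
    (\<exists>j<N. \<exists>i<j. simM M p s (set c) (xs ! i) (xs ! j)))"
proof -
  have "holds M (Imp (Neg (Eq (Var 0) (Var 1)))
     (Disjs [simF p s 0 K (K + i) (K + j). j \<leftarrow> [0..<N], i \<leftarrow> [0..<j]])) (c @ xs) \<longleftrightarrow> (c ! 0 \<noteq> c ! 1 \<longrightarrow>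
    (\<exists>j<N. \<exists>i<j. simM M p s (set c) (xs ! i) (xs ! j)))"
    if c: "c \<in> tuples M K" and xs: "xs \<in> tuples M N" for c xs
  proof -
    have l: "length c = K" "length xs = N" using c xs by (auto simp: tuples_length)
    have 1: "holds M (simF p s 0 K (K + i) (K + j)) (c @ xs) \<longleftrightarrow> simM M p s (set c) (xs ! i) (xs ! j)"
      if "j < N" "i < j" for i j
      using l that by (subst holds_simF) (auto simp: nth_append)
    have "holds M (Disjs [simF p s 0 K (K + i) (K + j). j \<leftarrow> [0..<N], i \<leftarrow> [0..<j]]) (c @ xs) \<longleftrightarrow>
        (\<exists>j<N. \<exists>i<j. holds M (simF p s 0 K (K + i) (K + j)) (c @ xs))"
      by (simp only: holds_connectives bex_concat_upt bex_map_upt)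
    also have "\<dots> \<longleftrightarrow> (\<exists>j<N. \<exists>i<j. simM M p s (set c) (xs ! i) (xs ! j))"
      by (intro iff_exI conj_cong refl) (simp add: 1)
    finally show ?thesis using l assms by (simp add: nth_append)
  qed
  moreover have "(\<forall>a\<in>tuples M (K + N). Q a) \<longleftrightarrow> (\<forall>c\<in>tuples M K. \<forall>xs\<in>tuples M N. Q (c @ xs))" for Q
    by (metis tuples_append tuples_split)
  ultimately show ?thesis unfolding countF_def by (simp add: holds_Alls)
qed

lemma simM_mono: "simM M p s' C' x x' \<Longrightarrow> s \<le> s' \<Longrightarrow> C \<subseteq> C' \<Longrightarrow> simM M p s C x x'"
proof -
  assume sim: "simM M p s' C' x x'" and le: "s \<le> s'" and sub: "C \<subseteq> C'"
  have "holds M (sim1F p s) a" if "holds M (sim1F p s') a" for a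
    using that le by (simp add: holds_sim1F)
  then show "simM M p s C x x'" using sim sub unfolding simM_def by blast
qed

lemma poly_eq_sum:
  fixes f :: "'a::comm_semiring_1 poly"
  assumes "degree f \<le> n"
  shows "poly f x = (\<Sum>i\<le>n. coeff f i * x ^ i)"
  unfolding poly_altdef using assms
  by (intro sum.mono_neutral_left) (auto simp: coeff_eq_0)

section \<open>Polynomials over p-adic fields\<close>

text \<open>The properties of the p-adic absolute value from which (1), (2) and (3) are derived:
  values in the powers of \<open>p\<close>, uniformiser \<open>p\<close>, natural numbers as
  representatives modulo \<open>p^s\<close>, completeness.\<close>

locale padic_field =
  fixes p :: nat and nm :: "'a::field_char_0 \<Rightarrow> real"
  assumes prime_p: "prime p"
    and nm_eq_0_iff [simp]: "nm x = 0 \<longleftrightarrow> x = 0"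
    and nm_mult: "nm (x * y) = nm x * nm y"
    and nm_add: "nm (x + y) \<le> max (nm x) (nm y)"
    and nm_powi: "x \<noteq> 0 \<Longrightarrow> \<exists>k::int. nm x = real p powi k"
    and nm_p: "nm (of_nat p) = 1 / real p"
    and nm_approx: "nm x \<le> 1 \<Longrightarrow> \<exists>u<p ^ s. nm (x - of_nat u) \<le> 1 / real p ^ s"
    and complete: "(\<And>e. e > 0 \<Longrightarrow> \<exists>N::nat. \<forall>m\<ge>N. \<forall>n\<ge>N. nm (u m - u n) < e) \<Longrightarrow>
                     \<exists>l. \<forall>e>0. \<exists>N. \<forall>n\<ge>N. nm (u n - l) < e"
begin

section \<open>Ultrametric norms with values in the powers of p\<close>

lemma p_gt_1: "real p > 1"
  using prime_gt_1_nat[OF prime_p] by simp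

lemma p_pos [simp]: "real p > 0" "real p \<noteq> 0" "0 < p" "p \<noteq> 0"
  using prime_gt_1_nat[OF prime_p] by auto

lemma nm_0 [simp]: "nm 0 = 0"
  by simp

lemma nm_nonneg [simp]: "nm x \<ge> 0"
  using nm_powi[of x] p_gt_1 by (cases "x = 0") (auto simp: zero_le_power_int)

lemma nm_pos_iff [simp]: "nm x > 0 \<longleftrightarrow> x \<noteq> 0"
  using nm_nonneg[of x] nm_eq_0_iff[of x] by linarith

lemma nm_le_0_iff [simp]: "nm x \<le> 0 \<longleftrightarrow> x = 0"
  using nm_pos_iff[of x] by linarith

lemma power_p_not_le_0 [simp]: "\<not> real p ^ k \<le> 0"
  using zero_less_power[OF p_pos(1), of k] by linarith

lemma nm_1 [simp]: "nm 1 = 1"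
  using nm_mult[of 1 1] nm_eq_0_iff[of 1] by simp

lemma nm_minus_1 [simp]: "nm (-1) = 1"
proof -
  have "nm (-1) * nm (-1) = 1" using nm_mult[of "-1" "-1"] by simp
  then have "(nm (-1))\<^sup>2 = 1\<^sup>2" by (simp add: power2_eq_square)
  then show ?thesis by (metis nm_nonneg power2_eq_iff_nonneg zero_le_one)
qed

lemma nm_minus [simp]: "nm (- x) = nm x"
  using nm_mult[of "-1" x] by simp

lemma nm_power: "nm (x ^ n) = nm x ^ n"
  by (induction n) (auto simp: nm_mult)

lemma nm_inverse: "nm (inverse x) = inverse (nm x)"
proof (cases "x = 0")
  case False
  then have "nm x * nm (inverse x) = 1" using nm_mult[of x "inverse x"] by simp
  then show ?thesis by (metis inverse_unique)
qed simp

lemma nm_divide: "nm (x / y) = nm x / nm y"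
  by (simp add: divide_inverse nm_mult nm_inverse)

lemma nm_p_power: "nm (of_nat p ^ k) = 1 / real p ^ k"
  by (simp add: nm_power nm_p power_divide)

lemma nm_diff: "nm (x - y) \<le> max (nm x) (nm y)"
  using nm_add[of x "- y"] by simp

lemma nm_minus_commute: "nm (x - y) = nm (y - x)"
  using nm_minus[of "x - y"] by simp

lemma nm_triangle: "nm (x - z) \<le> max (nm (x - y)) (nm (y - z))"
  using nm_add[of "x - y" "y - z"] by simp

lemma nm_add_less: "nm x < nm y \<Longrightarrow> nm (x + y) = nm y"
  using nm_add[of x y] nm_diff[of "x + y" x] by (auto simp: max_def split: if_splits)

lemma nm_add_le: "nm x \<le> r \<Longrightarrow> nm y \<le> r \<Longrightarrow> nm (x + y) \<le> r"
  using nm_add[of x y] by simp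

lemma nm_diff_le: "nm x \<le> r \<Longrightarrow> nm y \<le> r \<Longrightarrow> nm (x - y) \<le> r"
  using nm_diff[of x y] by simp

lemma nm_diff_trans: "nm (x - y) \<le> r \<Longrightarrow> nm (y - z) \<le> r \<Longrightarrow> nm (x - z) \<le> r"
  using nm_triangle[of x z y] by simp

lemma nm_dist_eq: "nm (x - y) < nm (y - z) \<Longrightarrow> nm (x - z) = nm (y - z)"
  using nm_add_less[of "x - y" "y - z"] by simp

lemma nm_sum_le: "(\<And>i. i \<in> A \<Longrightarrow> nm (g i) \<le> r) \<Longrightarrow> 0 \<le> r \<Longrightarrow> nm (\<Sum>i\<in>A. g i) \<le> r"
  by (induction A rule: infinite_finite_induct) (auto intro!: nm_add_le)

text \<open>The value group is discrete: no norm lies strictly between two consecutive powers of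
  \<open>p\<close>.\<close>

lemma nm_less_imp: "nm x < nm y \<Longrightarrow> nm x * real p \<le> nm y"
proof (cases "x = 0")
  case False
  assume less: "nm x < nm y"
  then have "y \<noteq> 0" using nm_nonneg[of x] by fastforce
  then obtain k l :: int where kl: "nm x = real p powi k" "nm y = real p powi l"
    using nm_powi False by metis
  have "k < l"
  proof (rule ccontr)
    assume "\<not> k < l"
    then have "real p powi l \<le> real p powi k"
      using p_gt_1 by (intro power_int_increasing) auto
    with less kl show False by simp
  qed
  then have "real p powi (k + 1) \<le> real p powi l"
    using p_gt_1 by (intro power_int_increasing) auto
  then show ?thesis by (simp add: kl power_int_add)
qed simp

lemma exists_power_less: "e > 0 \<Longrightarrow> \<exists>t. 1 / real p ^ t < e"
  using real_arch_pow_inv[of e "1 / real p"] p_gt_1 by (auto simp: power_divide)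

lemma power_p_ge_1: "real p ^ k \<ge> 1"
  using p_gt_1 by simp


subsection \<open>Hensel's lemma\<close>

lemma nm_poly_le_1:
  assumes "\<And>i. nm (coeff f i) \<le> 1" "nm x \<le> 1"
  shows "nm (poly f x) \<le> 1"
  unfolding poly_altdef using assms
  by (intro nm_sum_le) (auto simp: nm_mult nm_power intro!: mult_le_one power_le_one)

text \<open>Integral polynomials are 1-Lipschitz on the unit ball, by Horner's scheme: one step
  splits the difference into \<open>x (f(x) - f(y))\<close> and \<open>(x - y) f(y)\<close>.\<close>

lemma nm_poly_diff_le:
  assumes "\<And>i. nm (coeff f i) \<le> 1" "nm x \<le> 1" "nm y \<le> 1"
  shows "nm (poly f x - poly f y) \<le> nm (x - y)"
  using assms(1)
proof (induction f)
  case (pCons a f)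
  have f: "nm (coeff f i) \<le> 1" for i using pCons.prems[of "Suc i"] by simp
  have "nm (x * (poly f x - poly f y)) \<le> nm (x - y)"
    using mult_mono[OF assms(2) pCons.IH[OF f]] by (simp add: nm_mult)
  moreover have "nm ((x - y) * poly f y) \<le> nm (x - y)"
    using nm_poly_le_1[OF f assms(3)] by (simp add: nm_mult mult_left_le)
  moreover have "poly (pCons a f) x - poly (pCons a f) y = x * (poly f x - poly f y) + (x - y) * poly f y"
    by (simp add: algebra_simps)
  ultimately show ?case by (simp only: nm_add_le)
qed simp

text \<open>Newton's method with the derivative frozen at 0: \<open>g\<close> contracts the ball of
  radius \<open>r\<close> by the factor \<open>k = r / |\<alpha>|\<close>, and \<open>k < 1\<close>
  is the assumption on the derivative. The limit is a root because the value of \<open>f\<close> at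
  \<open>u n\<close> is \<open>- \<alpha>\<close> times the step from \<open>u n\<close> to
  \<open>u (Suc n)\<close>.\<close>

lemma hensel:
  assumes f: "\<And>i. nm (coeff f i) \<le> 1" and less: "nm (poly f 0) < (nm (poly (pderiv f) 0))\<^sup>2"
  shows "\<exists>u. poly f u = 0 \<and> nm u < 1"
proof -
  define \<alpha> where "\<alpha> = coeff f 1"
  define h where "h = poly_shift 2 f"
  have f_eq: "poly f x = coeff f 0 + x * (\<alpha> + x * poly h x)" for x
  proof -
    have "f = pCons (coeff f 0) (pCons (coeff f 1) h)"
      by (rule poly_eqI) (auto simp: coeff_pCons h_def coeff_poly_shift numeral_2_eq_2 split: nat.splits)
    then show ?thesis unfolding \<alpha>_def by (metis poly_pCons)
  qed
  have "poly (pderiv f) 0 = \<alpha>" by (simp add: \<alpha>_def poly_0_coeff_0 coeff_pderiv)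
  with less have less: "nm (coeff f 0) < nm \<alpha> * nm \<alpha>" by (simp add: power2_eq_square poly_0_coeff_0)
  then have \<alpha>: "\<alpha> \<noteq> 0" using nm_nonneg[of "coeff f 0"] by (intro notI) (simp add: not_less)
  then have \<alpha>_pos: "nm \<alpha> > 0" by simp
  have h: "nm (coeff h i) \<le> 1" for i by (simp add: h_def coeff_poly_shift f)
  define g where "g u = u - poly f u / \<alpha>" for u
  define r where "r = nm (coeff f 0) / nm \<alpha>"
  define k where "k = r / nm \<alpha>"
  have "nm \<alpha> \<le> 1" using f by (simp add: \<alpha>_def)
  moreover have r\<alpha>: "r < nm \<alpha>" using less \<alpha>_pos by (simp add: r_def pos_divide_less_eq)
  ultimately have r1: "r < 1" by simp
  have r0: "r \<ge> 0" by (simp add: r_def)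
  have k: "0 \<le> k" "k < 1" using r0 r\<alpha> \<alpha>_pos by (simp_all add: k_def)
  have contr: "nm (g u - g w) \<le> k * nm (u - w)" if uw: "nm u \<le> r" "nm w \<le> r" for u w
  proof -
    have 1: "nm u \<le> 1" "nm w \<le> 1" using uw r1 by auto
    have "nm (u * (poly (pCons 0 h) u - poly (pCons 0 h) w)) \<le> r * nm (u - w)"
      unfolding nm_mult using uw r0 1 h
      by (intro mult_mono nm_poly_diff_le) (auto simp: coeff_pCons split: nat.splits)
    moreover have "nm (w * poly h w) \<le> r"
      using mult_mono[OF uw(2) nm_poly_le_1[OF h 1(2)]] r0 by (simp add: nm_mult)
    then have "nm ((u - w) * (w * poly h w)) \<le> r * nm (u - w)"
      unfolding nm_mult[of "u - w"] by (subst mult.commute) (rule mult_right_mono, simp_all)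
    \<comment> \<open>The linear term of \<open>f\<close> is cancelled by the division by
      \<open>\<alpha>\<close>. Each remaining term has a factor \<open>u\<close> or
      \<open>w\<close>, which is the source of the factor \<open>r\<close>.\<close>
    moreover have "g u - g w = - (u * (poly (pCons 0 h) u - poly (pCons 0 h) w) + (u - w) * (w * poly h w)) / \<alpha>"
      using \<alpha> by (simp add: g_def f_eq field_simps)
    ultimately have "nm (g u - g w) \<le> r * nm (u - w) / nm \<alpha>"
      by (simp only: nm_divide nm_minus) (intro divide_right_mono nm_add_le, simp_all)
    then show ?thesis by (simp add: k_def)
  qed
  define u where "u n = (g ^^ n) 0" for n
  have u0: "u 0 = 0" and uS: "u (Suc n) = g (u n)" for n by (simp_all add: u_def)
  have g0: "nm (g 0) = r" by (simp add: g_def r_def nm_divide poly_0_coeff_0)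
  have u_le: "nm (u n) \<le> r" for n
  proof (induction n)
    case (Suc n)
    have "nm (g (u n) - g 0) \<le> k * nm (u n)" using contr[OF Suc, of 0] r0 by simp
    also have "\<dots> \<le> 1 * r" using Suc k by (intro mult_mono) auto
    finally show ?case using nm_add_le[of "g (u n) - g 0" r "g 0"] g0 by (simp add: uS)
  qed (use r0 in \<open>simp add: u0\<close>)
  have step: "nm (u (Suc n) - u n) \<le> k ^ n" for n
  proof (induction n)
    case 0
    then show ?case using g0 r1 by (simp add: uS u0)
  next
    case (Suc n)
    have "nm (u (Suc (Suc n)) - u (Suc n)) \<le> k * nm (u (Suc n) - u n)"
      unfolding uS[of "Suc n"] uS[of n] by (rule contr) (use u_le[of "Suc n"] u_le[of n] uS in auto)
    also have "\<dots> \<le> k * k ^ n" using Suc k by (intro mult_left_mono) auto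
    finally show ?case by simp
  qed
  have dist: "nm (u (n + m) - u n) \<le> k ^ n" for m n
  proof (induction m)
    case (Suc m)
    have "k ^ (n + m) \<le> k ^ n" using k by (intro power_decreasing) auto
    with step[of "n + m"] have "nm (u (n + Suc m) - u (n + m)) \<le> k ^ n" by simp
    from nm_diff_trans[OF this Suc] show ?case .
  qed (use k in simp)
  have small: "\<exists>N. \<forall>n\<ge>N. k ^ n < e" if e: "e > 0" for e
  proof -
    obtain N where N: "k ^ N < e" using real_arch_pow_inv[OF e k(2)] by blast
    have "k ^ n \<le> k ^ N" if "n \<ge> N" for n using that k by (intro power_decreasing) auto
    then show ?thesis using N by (meson order_le_less_trans)
  qed
  have "\<exists>l. \<forall>e>0. \<exists>N. \<forall>n\<ge>N. nm (u n - l) < e"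
  proof (rule complete)
    fix e :: real assume "e > 0"
    then obtain N where N: "\<And>n. n \<ge> N \<Longrightarrow> k ^ n < e" using small by blast
    have "nm (u m - u n) < e" if "m \<ge> N" "n \<ge> N" for m n
    proof -
      have "nm (u m - u N) \<le> k ^ N" "nm (u N - u n) \<le> k ^ N"
        using dist[of N "m - N"] dist[of N "n - N"] that nm_minus_commute[of "u N" "u n"] by simp_all
      from nm_diff_trans[OF this] N[of N] show ?thesis by simp
    qed
    then show "\<exists>N. \<forall>m\<ge>N. \<forall>n\<ge>N. nm (u m - u n) < e" by blast
  qed
  then obtain l where l: "\<And>e. e > 0 \<Longrightarrow> \<exists>N. \<forall>n\<ge>N. nm (u n - l) < e" by blast
  have l1: "nm l < 1"
  proof -
    obtain N where "nm (u N - l) < 1" using l[of 1] by auto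
    moreover have "nm (u N) < 1" using u_le[of N] r1 by simp
    ultimately show ?thesis using nm_diff[of "u N" "u N - l"] by simp
  qed
  have "poly f l = 0"
  proof (rule ccontr)
    assume "poly f l \<noteq> 0"
    then have pos: "nm (poly f l) > 0" by simp
    obtain N1 where N1: "\<And>n. n \<ge> N1 \<Longrightarrow> nm (u n - l) < nm (poly f l)" using l[OF pos] by blast
    obtain N2 where N2: "\<And>n. n \<ge> N2 \<Longrightarrow> k ^ n < nm (poly f l)" using small[OF pos] by blast
    define n where "n = max N1 N2"
    have "nm (poly f (u n) - poly f l) \<le> nm (u n - l)"
      using f u_le[of n] r1 l1 by (intro nm_poly_diff_le) auto
    then have 1: "nm (poly f l - poly f (u n)) < nm (poly f l)"
      using N1[of n] nm_minus_commute[of "poly f l"] by (simp add: n_def)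
    have "poly f (u n) = - (u (Suc n) - u n) * \<alpha>" using \<alpha> by (simp add: uS g_def)
    then have "nm (poly f (u n)) = nm (u (Suc n) - u n) * nm \<alpha>" by (simp add: nm_mult nm_minus_commute)
    also have "\<dots> \<le> k ^ n * 1" using step[of n] \<open>nm \<alpha> \<le> 1\<close> k by (intro mult_mono) auto
    finally have "nm (poly f (u n)) < nm (poly f l)" using N2[of n] by (simp add: n_def)
    with 1 show False using nm_add[of "poly f l - poly f (u n)" "poly f (u n)"] by simp
  qed
  with l1 show ?thesis by blast
qed


subsection \<open>Cosets of powers\<close>

text \<open>Equality of cosets modulo nonzero nth powers, with 0 in a class of its own. In
  particular, \<open>pcl 1\<close> relates any two nonzero elements and only records
  vanishing.\<close>

definition pcl :: "nat \<Rightarrow> 'a \<Rightarrow> 'a \<Rightarrow> bool" where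
  "pcl n a b \<longleftrightarrow> (\<exists>w. w \<noteq> 0 \<and> b = w ^ n * a)"

lemma pcl_refl: "pcl n a a"
  unfolding pcl_def by (rule exI[of _ 1]) simp

lemma pcl_sym: "pcl n a b \<Longrightarrow> pcl n b a"
  unfolding pcl_def by (elim exE, rule_tac x = "inverse w" in exI) (simp add: power_inverse)

lemma pcl_trans: "pcl n a b \<Longrightarrow> pcl n b c \<Longrightarrow> pcl n a c"
  unfolding pcl_def
  by (elim exE conjE, rule_tac x = "wa * w" in exI) (simp add: power_mult_distrib mult.assoc)

lemma pcl_mult_left: "pcl n a b \<Longrightarrow> pcl n (c * a) (c * b)"
  unfolding pcl_def by (metis mult.left_commute)

lemma pcl_power: "pcl n a b \<Longrightarrow> pcl n (a ^ k) (b ^ k)"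
  unfolding pcl_def
  by (elim exE conjE, rule_tac x = "w ^ k" in exI)
     (simp add: power_mult_distrib flip: power_mult, simp add: mult.commute)

lemma pcl_dvd: "pcl m a b \<Longrightarrow> n dvd m \<Longrightarrow> pcl n a b"
  unfolding pcl_def dvd_def
  by (elim exE conjE, rule_tac x = "w ^ k" in exI) (simp add: power_mult mult.commute flip: power_mult)

lemma nm_coeff_pcompose_shift:
  assumes "\<And>i. nm (coeff f i) \<le> 1" "nm c \<le> 1"
  shows "nm (coeff (pcompose f [:c, 1:]) i) \<le> 1"
  using assms(1)
proof (induction f arbitrary: i)
  case (pCons a f)
  have f: "nm (coeff (pcompose f [:c, 1:]) i) \<le> 1" for i
    by (rule pCons.IH) (use pCons.prems[of "Suc j" for j] in simp)
  have cf: "nm (c * coeff (pcompose f [:c, 1:]) i) \<le> 1" for i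
    using f assms(2) by (simp add: nm_mult mult_le_one)
  have a: "nm a \<le> 1" using pCons.prems[of 0] by simp
  show ?case
  proof (cases i)
    case 0
    have "coeff (pcompose (pCons a f) [:c, 1:]) 0 = a + c * coeff (pcompose f [:c, 1:]) 0"
      by (simp add: pcompose_pCons coeff_0_power mult_ac del: coeff_0 flip: coeff_0)
    then show ?thesis using a cf[of 0] 0 by (simp only: nm_add_le)
  next
    case (Suc k)
    have "coeff (pcompose (pCons a f) [:c, 1:]) (Suc k) =
        c * coeff (pcompose f [:c, 1:]) (Suc k) + coeff (pcompose f [:c, 1:]) k"
      by (simp add: pcompose_pCons)
    then show ?thesis using f cf Suc by (simp only: nm_add_le)
  qed
qed simp

text \<open>For \<open>z = b / a\<close>, which is close to 1, Hensel's lemma solves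
  \<open>(1 + u)^n = z\<close>: the derivative at 0 is \<open>n\<close>, and
  \<open>1 / p^t < |n|^2\<close> is what the lemma demands.\<close>

lemma close_imp_pcl1:
  assumes "n \<ge> 1" and t: "1 / real p ^ t < (nm (of_nat n))\<^sup>2" and ab: "nm (b - a) * real p ^ t \<le> nm a"
  shows "pcl n a b"
proof (cases "a = 0")
  case True
  then have "b = 0" using ab by (auto simp: mult_le_0_iff)
  with True show ?thesis by (simp add: pcl_refl)
next
  case False
  define z where "z = b / a"
  have z: "nm (1 - z) \<le> 1 / real p ^ t"
  proof -
    have "nm (1 - z) = nm (b - a) / nm a"
      using False by (simp add: z_def nm_minus_commute[of b a] diff_divide_distrib flip: nm_divide)
    also have "\<dots> \<le> 1 / real p ^ t"
      using ab False by (simp add: field_simps)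
    finally show ?thesis .
  qed
  also have "1 / real p ^ t \<le> 1" using power_p_ge_1[of t] by simp
  finally have z1: "nm z \<le> 1" using nm_diff_le[of 1 1 "1 - z"] by simp
  define f where "f = pcompose (monom 1 n) [:1, 1:] - [:z:]"
  have "nm (coeff (pcompose (monom 1 n) [:1, 1:]) i) \<le> 1" for i
    by (rule nm_coeff_pcompose_shift) auto
  moreover have "nm (coeff [:z:] i) \<le> 1" for i
    using z1 by (cases i) auto
  ultimately have f1: "nm (coeff f i) \<le> 1" for i
    unfolding f_def by (simp only: coeff_diff nm_diff_le)
  have f0: "poly f x = (1 + x) ^ n - z" for x
    by (simp add: f_def poly_pcompose poly_monom)
  have "poly (pderiv f) 0 = of_nat n"
    by (simp add: f_def pderiv_diff pderiv_pcompose pderiv_monom poly_pcompose poly_monom pderiv_pCons)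
  then have "\<exists>u. poly f u = 0 \<and> nm u < 1"
    using z t f1 by (intro hensel) (simp_all add: f0)
  then obtain u where u: "(1 + u) ^ n = z" "nm u < 1" using f0 by auto
  \<comment> \<open>The root has norm below 1 and so cannot be -1; hence \<open>1 + u\<close> is a
    permitted factor in \<open>pcl\<close>.\<close>
  have "1 + u \<noteq> 0"
  proof
    assume "1 + u = 0"
    then have "u = -1" by (simp add: add_eq_0_iff)
    with u show False by simp
  qed
  then show ?thesis using u False unfolding pcl_def z_def
    by (intro exI[of _ "1 + u"]) (auto simp: field_simps)
qed

lemma close_imp_pcl:
  "\<exists>t. \<forall>n\<in>{1..N}. \<forall>a b. nm (b - a) * real p ^ t \<le> nm a \<longrightarrow> pcl n a b"
proof (induction N)
  case (Suc N)
  then obtain t where t: "\<And>n a b. n \<in> {1..N} \<Longrightarrow> nm (b - a) * real p ^ t \<le> nm a \<Longrightarrow> pcl n a b"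
    by blast
  obtain t' where t': "1 / real p ^ t' < (nm (of_nat (Suc N)))\<^sup>2"
    using exists_power_less[of "(nm (of_nat (Suc N)))\<^sup>2"] of_nat_neq_0[of N] by (auto simp del: of_nat_Suc)
  show ?case
  proof (intro exI ballI allI impI)
    fix n a b assume n: "n \<in> {1..Suc N}" and ab: "nm (b - a) * real p ^ (t + t') \<le> nm a"
    have le: "nm (b - a) * real p ^ k \<le> nm (b - a) * real p ^ (t + t')" if "k \<le> t + t'" for k
      using p_gt_1 that by (intro mult_left_mono power_increasing) auto
    show "pcl n a b"
    proof (cases "n = Suc N")
      case True
      show ?thesis
        by (rule close_imp_pcl1[of _ t']) (use True t' ab le[of t'] in auto)
    next
      case False
      then show ?thesis using t[of n b a] n ab le[of t] by auto
    qed
  qed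
qed simp

lemma nm_power_diff_le:
  assumes "nm x \<le> 1" "nm y \<le> 1"
  shows "nm (x ^ k - y ^ k) \<le> nm (x - y)"
proof (induction k)
  case (Suc k)
  have "x ^ Suc k - y ^ Suc k = x * (x ^ k - y ^ k) + (x - y) * y ^ k"
    by (simp add: algebra_simps)
  moreover have "nm (x * (x ^ k - y ^ k)) \<le> nm (x - y)"
    using mult_mono[OF assms(1) Suc] by (simp add: nm_mult)
  moreover have "nm ((x - y) * y ^ k) \<le> nm (x - y)"
    using assms(2) by (simp add: nm_mult nm_power mult_left_le power_le_one)
  ultimately show ?case by (simp only: nm_add_le)
qed simp

text \<open>Two of the powers \<open>w^0, ..., w^(p^t)\<close> agree modulo \<open>p^t\<close>, so
  some \<open>w^k\<close> with \<open>1 \<le> k \<le> p^t\<close> is congruent to 1. All these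
  \<open>k\<close> divide the factorial of \<open>p^t\<close>, which makes the exponent independent
  of \<open>w\<close>.\<close>

lemma unit_power_close:
  "\<exists>N\<ge>1. \<forall>w. nm w = 1 \<longrightarrow> nm (w ^ N - 1) * real p ^ t \<le> 1"
proof (intro exI[of _ "fact (p ^ t)"] conjI allI impI)
  fix w assume w: "nm w = 1"
  have "\<forall>k. \<exists>u<p ^ t. nm (w ^ k - of_nat u) \<le> 1 / real p ^ t"
    using w by (intro allI nm_approx) (simp add: nm_power)
  then obtain u where u: "\<And>k. u k < p ^ t" "\<And>k. nm (w ^ k - of_nat (u k)) \<le> 1 / real p ^ t" by metis
  have "\<not> inj_on u {..p ^ t}"
  proof
    assume "inj_on u {..p ^ t}"
    then have "card {..p ^ t} \<le> card {..<p ^ t}" using u by (intro card_inj_on_le) auto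
    then show False by simp
  qed
  then obtain i j where ij: "i < j" "j \<le> p ^ t" "u i = u j"
    unfolding inj_on_def by (metis atMost_iff linorder_neqE_nat)
  have "nm (w ^ j - w ^ i) \<le> 1 / real p ^ t"
    using nm_diff_trans[of "w ^ j" "of_nat (u i)" _ "w ^ i"] u(2)[of i] u(2)[of j] ij nm_minus_commute
    by metis
  moreover have "w ^ j - w ^ i = w ^ i * (w ^ (j - i) - 1)"
    using ij by (simp add: algebra_simps flip: power_add)
  ultimately have 1: "nm (w ^ (j - i) - 1) \<le> 1 / real p ^ t"
    using w by (simp add: nm_mult nm_power)
  have "j - i dvd fact (p ^ t)" using ij by (intro dvd_fact) auto
  then obtain e where e: "fact (p ^ t) = (j - i) * e" ..
  have "nm (w ^ fact (p ^ t) - 1) \<le> nm (w ^ (j - i) - 1)"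
    using nm_power_diff_le[of "w ^ (j - i)" 1 e] w by (simp add: e nm_power power_mult)
  with 1 have "nm (w ^ fact (p ^ t) - 1) \<le> 1 / real p ^ t" by simp
  then show "nm (w ^ fact (p ^ t) - 1) * real p ^ t \<le> 1" by (simp add: field_simps)
qed simp

lemma closeD:
  assumes "nm (b - a) * real p ^ t \<le> nm a" "t \<ge> 1"
  shows "nm b = nm a"
proof (cases "a = 0")
  case False
  have "real p ^ 1 \<le> real p ^ t" using assms p_gt_1 by (intro power_increasing) auto
  then have "nm (b - a) * real p \<le> nm (b - a) * real p ^ t" by (intro mult_left_mono) auto
  with assms have le: "nm (b - a) * real p \<le> nm a" by simp
  have "nm (b - a) < nm a"
  proof (cases "b = a")
    case False
    then have "nm (b - a) * 1 < nm (b - a) * real p" using p_gt_1 by (intro mult_strict_left_mono) auto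
    with le show ?thesis by simp
  qed (use False in simp)
  from nm_add_less[OF this] show ?thesis by simp
qed (use assms in \<open>auto simp: mult_le_0_iff\<close>)


subsection \<open>Cancellation at points close to a root\<close>

text \<open>As \<open>C\<close> contains the roots of all nonzero derivatives, the induction
  hypothesis applies to the derivative of \<open>f\<close> with the same \<open>C\<close> and the
  same nearest point \<open>c\<close>. The constant does not depend on \<open>f\<close>; this is the
  source of all later uniformity.\<close>

lemma coeff_bound_by_value:
  "\<exists>A\<ge>1. \<forall>f C c x. degree f \<le> D \<longrightarrow> (\<forall>i y. (pderiv ^^ i) f \<noteq> 0 \<longrightarrow> poly ((pderiv ^^ i) f) y = 0 \<longrightarrow> y \<in> C) \<longrightarrow>
     c \<in> C \<longrightarrow> (\<forall>c'\<in>C. nm (x - c) \<le> nm (x - c')) \<longrightarrow>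
     (\<forall>i. nm (coeff (pcompose f [:c, 1:]) i) * nm (x - c) ^ i \<le> A * nm (poly f x))"
proof (induction D)
  case 0
  show ?case
  proof (rule exI[of _ 1], intro conjI allI impI)
    fix f :: "'a poly" and c x i assume "degree f \<le> 0"
    then obtain a where "f = [:a:]" using degree_eq_zeroE by blast
    then show "nm (coeff (pcompose f [:c, 1:]) i) * nm (x - c) ^ i \<le> 1 * nm (poly f x)"
      by (cases i) (auto simp: pcompose_const)
  qed simp
next
  case (Suc D)
  then obtain A where A: "A \<ge> 1" and IH: "\<And>f C c x i. degree f \<le> D \<Longrightarrow>
      (\<And>i y. (pderiv ^^ i) f \<noteq> 0 \<Longrightarrow> poly ((pderiv ^^ i) f) y = 0 \<Longrightarrow> y \<in> C) \<Longrightarrow>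
      c \<in> C \<Longrightarrow> (\<And>c'. c' \<in> C \<Longrightarrow> nm (x - c) \<le> nm (x - c')) \<Longrightarrow>
      nm (coeff (pcompose f [:c, 1:]) i) * nm (x - c) ^ i \<le> A * nm (poly f x)"
    by metis
  \<comment> \<open>Coefficient \<open>j - 1\<close> of the derivative is \<open>j\<close> times
    coefficient \<open>j\<close>; the sum dominates every factor \<open>1 / |j|\<close> that this
    costs. Its term at 0 is \<open>1 / 0 = 0\<close>.\<close>
  define A1 where "A1 = A * (1 + (\<Sum>i\<le>Suc D. 1 / nm (of_nat i)))"
  have sum_nonneg: "(\<Sum>i\<le>Suc D. 1 / nm (of_nat i)) \<ge> 0" by (intro sum_nonneg) simp
  have A1: "A1 \<ge> 1"
    unfolding A1_def using A sum_nonneg mult_mono[of 1 A 1 "1 + (\<Sum>i\<le>Suc D. 1 / nm (of_nat i))"] by simp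
  have inv_le: "A / nm (of_nat i) \<le> A1" if "i \<le> Suc D" for i
  proof -
    have "1 / nm (of_nat i) \<le> (\<Sum>i\<le>Suc D. 1 / nm (of_nat i))"
      using that by (intro member_le_sum) auto
    then have "A * (1 / nm (of_nat i)) \<le> A1" unfolding A1_def using A by (intro mult_left_mono) auto
    then show ?thesis by simp
  qed
  show ?case
  \<comment> \<open>Hensel's lemma compares with the square of the derivative, so the loss
    \<open>A1\<close> in the bound for the derivative enters squared.\<close>
  proof (rule exI[of _ "A1\<^sup>2"], intro conjI allI impI)
    show "A1\<^sup>2 \<ge> 1" using A1 by simp
    fix f C c x i0
    assume f: "degree f \<le> Suc D" and C: "\<forall>i y. (pderiv ^^ i) f \<noteq> 0 \<longrightarrow> poly ((pderiv ^^ i) f) y = 0 \<longrightarrow> y \<in> C"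
      and c: "c \<in> C" and near: "\<forall>c'\<in>C. nm (x - c) \<le> nm (x - c')"
    define g where "g = pcompose f [:c, 1:]"
    define y where "y = x - c"
    define r where "r = nm y"
    have gy: "poly g y = poly f x" by (simp add: g_def y_def poly_pcompose)
    have deg_g: "degree g \<le> Suc D" using f by (simp add: g_def degree_pcompose)
    show "nm (coeff (pcompose f [:c, 1:]) i0) * nm (x - c) ^ i0 \<le> A1\<^sup>2 * nm (poly f x)"
    proof (rule ccontr)
      assume contr: "\<not> ?thesis"
      define T where "T i = nm (coeff g i) * r ^ i" for i
      obtain i where i: "i \<le> Suc D" and max: "\<And>j. j \<le> Suc D \<Longrightarrow> T j \<le> T i"
      proof -
        have "Max (T ` {..Suc D}) \<in> T ` {..Suc D}" by (intro Max_in) auto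
        then obtain i where "i \<le> Suc D" "T i = Max (T ` {..Suc D})" by (metis atMost_iff imageE)
        then show ?thesis by (intro that[of i]) auto
      qed
      have max': "T j \<le> T i" for j
      proof (cases "j \<le> Suc D")
        case False
        then have "coeff g j = 0" using deg_g by (intro coeff_eq_0) auto
        then show ?thesis by (simp add: T_def r_def)
      qed (rule max)
      have gt: "T i > A1\<^sup>2 * nm (poly f x)"
        using contr max'[of i0] unfolding T_def r_def y_def g_def by simp
      then have Ti_pos: "T i > 0"
        by (rule le_less_trans[rotated]) simp
      have fx_less: "nm (poly f x) < T i"
        using gt A1 mult_right_mono[of 1 "A1\<^sup>2" "nm (poly f x)"] by simp
      \<comment> \<open>If the constant term alone were maximal, it would strictly dominate the sum,
        and \<open>|f(x)|\<close> would be equal to it. A maximal term of positive degree, on the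
        other hand, is visible in the derivative.\<close>
      have "\<exists>j. 1 \<le> j \<and> T j = T i"
      proof (rule ccontr)
        assume no: "\<nexists>j. 1 \<le> j \<and> T j = T i"
        then have "i = 0" by (metis less_one not_le)
        have less: "T j < T 0" if "1 \<le> j" for j
          using max'[of j] no that \<open>i = 0\<close> by (metis order_le_imp_less_or_eq)
        have "poly g y = coeff g 0 + (\<Sum>j\<in>{1..Suc D}. coeff g j * y ^ j)"
          by (simp add: poly_eq_sum[OF deg_g] sum.atMost_shift sum.atLeast1_atMost_eq)
        moreover have "nm (\<Sum>j\<in>{1..Suc D}. coeff g j * y ^ j) < nm (coeff g 0)"
        proof -
          have "nm (\<Sum>j\<in>{1..Suc D}. coeff g j * y ^ j) \<le> Max (T ` {1..Suc D})"
          proof (rule nm_sum_le)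
            show "nm (coeff g j * y ^ j) \<le> Max (T ` {1..Suc D})" if "j \<in> {1..Suc D}" for j
            proof -
              have "nm (coeff g j * y ^ j) = T j" by (simp add: nm_mult nm_power T_def r_def)
              then show ?thesis using that by simp
            qed
            have "0 \<le> T 1" by (simp add: T_def r_def)
            also have "T 1 \<le> Max (T ` {1..Suc D})" by (intro Max_ge) auto
            finally show "0 \<le> Max (T ` {1..Suc D})" .
          qed
          also have "\<dots> < T 0" using less by (subst Max_less_iff) auto
          finally show ?thesis by (simp add: T_def)
        qed
        ultimately have "nm (poly g y) = nm (coeff g 0)"
          by (metis nm_add_less add.commute)
        then have "nm (poly g y) = T 0" by (simp add: T_def)
        with fx_less \<open>i = 0\<close> gy show False by simp
      qed
      then obtain j where j: "1 \<le> j" "T j = T i" by blast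
      have jD: "j \<le> Suc D"
      proof (rule ccontr)
        assume "\<not> j \<le> Suc D"
        then have "coeff g j = 0" using deg_g by (intro coeff_eq_0) auto
        then have "T j = 0" by (simp add: T_def)
        with j Ti_pos show False by simp
      qed
      have r: "r > 0"
      proof (rule ccontr)
        assume "\<not> r > 0"
        then have "r = 0" by (simp add: r_def)
        then have "T j = 0" using j(1) by (simp add: T_def)
        with j Ti_pos show False by simp
      qed
      then have y0: "y \<noteq> 0" by (simp add: r_def)
      have dfx: "T i \<le> A1 * (r * nm (poly (pderiv f) x))"
      proof -
        have "nm (coeff (pcompose (pderiv f) [:c, 1:]) (j - 1)) * nm (x - c) ^ (j - 1) \<le> A * nm (poly (pderiv f) x)"
        proof (rule IH)
          show "degree (pderiv f) \<le> D" using f by (simp add: degree_pderiv)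
          show "z \<in> C" if "(pderiv ^^ k) (pderiv f) \<noteq> 0" "poly ((pderiv ^^ k) (pderiv f)) z = 0" for k z
            using that C[rule_format, of "Suc k" z] by (simp add: funpow_Suc_right del: funpow.simps)
        qed (use c near in auto)
        moreover have "pcompose (pderiv f) [:c, 1:] = pderiv g"
          by (simp add: g_def pderiv_pcompose pderiv_pCons)
        ultimately have "nm (coeff (pderiv g) (j - 1)) * r ^ (j - 1) \<le> A * nm (poly (pderiv f) x)"
          by (simp add: r_def y_def)
        moreover have "coeff (pderiv g) (j - 1) = of_nat j * coeff g j"
          using j by (simp add: coeff_pderiv)
        ultimately have "nm (of_nat j) * nm (coeff g j) * r ^ (j - 1) \<le> A * nm (poly (pderiv f) x)"
          by (simp add: nm_mult)
        then have "r * (nm (of_nat j) * nm (coeff g j) * r ^ (j - 1)) \<le> r * (A * nm (poly (pderiv f) x))"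
          using r by (intro mult_left_mono) auto
        moreover have "r * (nm (of_nat j) * nm (coeff g j) * r ^ (j - 1)) = nm (of_nat j) * T j"
          using j(1) by (cases j) (auto simp: T_def)
        ultimately have "nm (of_nat j) * T j \<le> r * (A * nm (poly (pderiv f) x))" by (simp only:)
        moreover have nj: "nm (of_nat j) > 0" using j by simp
        ultimately have "T j \<le> A / nm (of_nat j) * (r * nm (poly (pderiv f) x))"
          by (simp add: field_simps)
        also have "\<dots> \<le> A1 * (r * nm (poly (pderiv f) x))"
          using inv_le[OF jD] r by (intro mult_right_mono) auto
        finally show ?thesis using j by simp
      qed
      define l where "l = coeff g i * y ^ i"
      have l: "nm l = T i" by (simp add: l_def nm_mult nm_power T_def r_def)
      then have l0: "l \<noteq> 0" using Ti_pos by auto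
      \<comment> \<open>In the coordinate v of the point \<open>c + y * v\<close>, coefficient
        \<open>k\<close> is multiplied by \<open>y ^ k\<close>, and x is the point v = 1.
        \<open>h\<close> moves this point to 0 and divides by the largest term, which makes the
        coefficients integral.\<close>
      define q where "q = pcompose g [:0, y:]"
      define h where "h = pcompose (smult (1 / l) q) [:1, 1:]"
      have coeff_q: "coeff q k = coeff g k * y ^ k" for k
        unfolding q_def using coeff_pcompose_linear[of g y k] by (simp add: mult.commute)
      have "nm (coeff h k) \<le> 1" for k unfolding h_def
      proof (rule nm_coeff_pcompose_shift)
        fix k
        have "nm (coeff (smult (1 / l) q) k) = T k / T i"
          by (simp add: coeff_q nm_mult nm_divide nm_power l T_def r_def)
        then show "nm (coeff (smult (1 / l) q) k) \<le> 1" using max'[of k] Ti_pos by simp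
      qed simp
      moreover have hu: "poly h u = poly f (x + y * u) / l" for u
        by (simp add: h_def q_def g_def poly_pcompose y_def algebra_simps)
      moreover have "poly (pderiv h) 0 = y * poly (pderiv f) x / l"
        by (simp add: h_def q_def g_def pderiv_pcompose poly_pcompose pderiv_pCons pderiv_smult y_def)
      moreover have "nm (poly f x / l) < (nm (y * poly (pderiv f) x / l))\<^sup>2"
      proof -
        have "nm (poly f x) * A1\<^sup>2 * T i < T i * T i"
          using gt Ti_pos by (simp add: mult.commute)
        also have "T i * T i \<le> (A1 * (r * nm (poly (pderiv f) x))) * (A1 * (r * nm (poly (pderiv f) x)))"
          using dfx Ti_pos by (intro mult_mono) auto
        finally have "A1\<^sup>2 * (nm (poly f x) * T i) < A1\<^sup>2 * (r * nm (poly (pderiv f) x))\<^sup>2"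
          by (simp add: power2_eq_square mult_ac)
        then have "nm (poly f x) * T i < (r * nm (poly (pderiv f) x))\<^sup>2"
          using A1 by (simp add: mult_less_cancel_left)
        then show ?thesis using Ti_pos
          by (simp add: nm_divide nm_mult l r_def power_divide power2_eq_square field_simps)
      qed
      ultimately obtain u where u: "poly h u = 0" "nm u < 1" using hensel[of h] by auto
      then have "poly f (x + y * u) = 0" using hu l0 by simp
      moreover have "f \<noteq> 0" using Ti_pos by (auto simp: T_def g_def)
      ultimately have "x + y * u \<in> C" using C[rule_format, of 0 "x + y * u"] by simp
      then have "r \<le> nm (x - (x + y * u))" unfolding r_def y_def using near by blast
      then have "r \<le> r * nm u" by (simp add: nm_mult r_def)
      with u r show False by (simp add: mult_le_cancel_left1)
    qed
  qed
qed

subsection \<open>Similarity of points with respect to a set of centres\<close>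

definition sim1 :: "nat \<Rightarrow> 'a \<Rightarrow> 'a \<Rightarrow> 'a \<Rightarrow> 'a \<Rightarrow> bool" where
  "sim1 s x x' c d \<longleftrightarrow>
     (\<forall>n\<in>{1..s}. pcl n (x - c) (x' - c)) \<and>
     (\<forall>j\<le>s. (nm (x - c) * real p ^ j \<le> nm (d - c) \<longleftrightarrow> nm (x' - c) * real p ^ j \<le> nm (d - c)) \<and>
            (nm (x - c) \<le> nm (d - c) * real p ^ j \<longleftrightarrow> nm (x' - c) \<le> nm (d - c) * real p ^ j))"

definition sim :: "nat \<Rightarrow> 'a set \<Rightarrow> 'a \<Rightarrow> 'a \<Rightarrow> bool" where
  "sim s C x x' \<longleftrightarrow> (\<forall>c\<in>C. \<forall>d\<in>C. sim1 s x x' c d)"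

lemma sim1_sym: "sim1 s x x' c d \<Longrightarrow> sim1 s x' x c d"
  unfolding sim1_def by (auto intro: pcl_sym)

lemma sim1_trans: "sim1 s x y c d \<Longrightarrow> sim1 s y z c d \<Longrightarrow> sim1 s x z c d"
  unfolding sim1_def by (auto intro: pcl_trans)

lemma sim_sym: "sim s C x x' \<Longrightarrow> sim s C x' x"
  unfolding sim_def by (auto intro: sim1_sym)

lemma sim_trans: "sim s C x y \<Longrightarrow> sim s C y z \<Longrightarrow> sim s C x z"
  unfolding sim_def by (meson sim1_trans)

lemma sim_refl: "sim s C x x"
  unfolding sim_def sim1_def by (auto intro: pcl_refl)

lemma sim_mono: "sim s' C' x x' \<Longrightarrow> s \<le> s' \<Longrightarrow> C \<subseteq> C' \<Longrightarrow> sim s C x x'"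
proof -
  assume sim: "sim s' C' x x'" and le: "s \<le> s'" and sub: "C \<subseteq> C'"
  have "sim1 s x x' c d" if "sim1 s' x x' c d" for c d
    using that le by (auto simp: sim1_def)
  then show "sim s C x x'" using sim sub unfolding sim_def by blast
qed

lemma sim1_same_norm:
  assumes "\<And>n. n \<in> {1..s} \<Longrightarrow> pcl n (x - c) (x' - c)" "nm (x - c) = nm (x' - c)"
  shows "sim1 s x x' c d"
  using assms by (simp add: sim1_def)

text \<open>Norms are powers of \<open>p\<close>, so inside the window given by \<open>lo\<close>
  and \<open>hi\<close> the thresholds \<open>p^j |d - c|\<close> with \<open>|j| \<le> s\<close>
  separate all possible values. Distances up to \<open>|d - c|\<close> and larger ones are treated
  separately, as they are governed by different thresholds.\<close>

lemma sim1_window: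
  assumes sim: "sim1 s x x' c d" and lo: "nm (d - c) < nm (x - c) * real p ^ s"
    and hi: "nm (x - c) \<le> nm (d - c) * real p ^ s"
  shows "nm (x' - c) = nm (x - c)"
proof -
  have d: "d \<noteq> c"
  proof
    assume "d = c"
    with hi have "x = c" by simp
    with lo show False using \<open>d = c\<close> by simp
  qed
  have x: "x \<noteq> c"
    using lo nm_nonneg[of "d - c"] by (auto simp: not_less[symmetric])
  have down: "nm (x' - c) \<le> nm (x - c)"
  proof (rule ccontr)
    assume "\<not> ?thesis"
    then have gt: "nm (x - c) * real p \<le> nm (x' - c)" using nm_less_imp by simp
    show False
    proof (cases "nm (x - c) \<le> nm (d - c)")
      case True
      \<comment> \<open>At the largest such \<open>j\<close> the next threshold fails for x. But x'
        also satisfies threshold \<open>j\<close>, and a larger \<open>|x' - c|\<close> is larger by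
        a factor of at least \<open>p\<close>, so x would satisfy the next one.\<close>
      define J where "J = {j. nm (x - c) * real p ^ j \<le> nm (d - c)}"
      have "j < s" if "j \<in> J" for j
      proof (rule ccontr)
        assume "\<not> j < s"
        then have "nm (x - c) * real p ^ s \<le> nm (x - c) * real p ^ j"
          using p_gt_1 by (intro mult_left_mono power_increasing) auto
        with that lo show False by (simp add: J_def)
      qed
      then have fin: "finite J" using finite_subset[of J "{..<s}"] by auto
      have "0 \<in> J" using True by (simp add: J_def)
      then have "Max J \<in> J" using Max_in[OF fin] by auto
      define j where "j = Max J"
      have j: "nm (x - c) * real p ^ j \<le> nm (d - c)" "j < s"
        using \<open>Max J \<in> J\<close> \<open>\<And>j. j \<in> J \<Longrightarrow> j < s\<close> by (auto simp: J_def j_def)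
      then have "nm (x' - c) * real p ^ j \<le> nm (d - c)" using sim by (auto simp: sim1_def)
      moreover have "nm (x - c) * real p ^ Suc j \<le> nm (x' - c) * real p ^ j"
        using gt mult_right_mono[OF gt, of "real p ^ j"] by (simp add: mult_ac)
      ultimately have "nm (x - c) * real p ^ Suc j \<le> nm (d - c)" by linarith
      then have "Suc j \<in> J" by (simp add: J_def)
      then have "Suc j \<le> j" unfolding j_def using fin by (intro Max_ge) auto
      then show False by simp
    next
      case False
      define j where "j = (LEAST j. nm (x - c) \<le> nm (d - c) * real p ^ j)"
      have j: "nm (x - c) \<le> nm (d - c) * real p ^ j" unfolding j_def by (rule LeastI[of _ s]) (rule hi)
      have "j \<le> s" unfolding j_def by (rule Least_le) (rule hi)
      then have "nm (x' - c) \<le> nm (d - c) * real p ^ j" using sim j by (auto simp: sim1_def)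
      with gt have le: "nm (x - c) * real p \<le> nm (d - c) * real p ^ j" by simp
      have "j \<noteq> 0" using False j by (intro notI) simp
      then obtain i where i: "j = Suc i" by (cases j) auto
      have "nm (x - c) * real p \<le> nm (d - c) * real p ^ i * real p" using le i by (simp only: power_Suc2 mult.assoc)
      then have "nm (x - c) \<le> nm (d - c) * real p ^ i" by (rule mult_right_le_imp_le) simp
      then have "j \<le> i" unfolding j_def by (rule Least_le)
      with i show False by simp
    qed
  qed
  have up: "nm (x - c) \<le> nm (x' - c)"
  proof (rule ccontr)
    assume "\<not> ?thesis"
    then have lt: "nm (x' - c) * real p \<le> nm (x - c)" using nm_less_imp by simp
    show False
    proof (cases "nm (x - c) \<le> nm (d - c)")
      case True
      define j where "j = (LEAST j. nm (d - c) < nm (x - c) * real p ^ j)"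
      have j: "nm (d - c) < nm (x - c) * real p ^ j" unfolding j_def by (rule LeastI[of _ s]) (rule lo)
      have "j \<le> s" unfolding j_def by (rule Least_le) (rule lo)
      then have "nm (d - c) < nm (x' - c) * real p ^ j" using sim j by (auto simp: sim1_def not_le[symmetric])
      moreover have "j \<noteq> 0" using True j by (intro notI) simp
      then obtain i where i: "j = Suc i" by (cases j) auto
      ultimately have "nm (d - c) < nm (x' - c) * real p * real p ^ i" by (simp add: mult_ac)
      also have "\<dots> \<le> nm (x - c) * real p ^ i" using lt by (intro mult_right_mono) auto
      finally have "j \<le> i" unfolding j_def by (rule Least_le)
      with i show False by simp
    next
      case False
      define J where "J = {j. nm (d - c) * real p ^ j < nm (x - c)}"
      have less: "j < s" if "j \<in> J" for j
      proof (rule ccontr)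
        assume "\<not> j < s"
        then have "nm (d - c) * real p ^ s \<le> nm (d - c) * real p ^ j"
          using p_gt_1 by (intro mult_left_mono power_increasing) auto
        with that hi show False by (simp add: J_def)
      qed
      then have fin: "finite J" using finite_subset[of J "{..<s}"] by auto
      have "0 \<in> J" using False by (simp add: J_def)
      then have "Max J \<in> J" using Max_in[OF fin] by auto
      define j where "j = Max J"
      have j: "nm (d - c) * real p ^ j < nm (x - c)" "j < s"
        using \<open>Max J \<in> J\<close> less by (auto simp: J_def j_def)
      then have "nm (d - c) * real p ^ j < nm (x' - c)" using sim by (auto simp: sim1_def not_le[symmetric])
      then have "nm (d - c) * real p ^ Suc j < nm (x' - c) * real p" by (simp add: mult.commute)
      also have "\<dots> \<le> nm (x - c)" by (rule lt)
      finally have "Suc j \<in> J" by (simp add: J_def)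
      then have "Suc j \<le> j" unfolding j_def using fin by (intro Max_ge) auto
      then show False by simp
    qed
  qed
  from up down show ?thesis by simp
qed

text \<open>A root of order \<open>m\<close>, rounded down to a power of \<open>p\<close>: the
  slopes of a Newton polygon need not be integers, while the norms of the field are integral powers
  of \<open>p\<close>.\<close>

lemma powi_root:
  assumes "q > 0" "m \<ge> (1::nat)"
  shows "\<exists>l::int. (real p powi l) ^ m \<le> q \<and> q < (real p powi (l + 1)) ^ m"
proof -
  define l where "l = \<lfloor>log (real p) q / real m\<rfloor>"
  have "real_of_int l \<le> log (real p) q / real m" "log (real p) q / real m < real_of_int (l + 1)"
    unfolding l_def by linarith+
  then have l: "real_of_int l * real m \<le> log (real p) q" "log (real p) q < real_of_int (l + 1) * real m"
    using assms by (simp_all add: field_simps)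
  have powi: "(real p powi k) ^ m = real p powr (real_of_int k * real m)" for k :: int
    using p_gt_1 by (simp add: powr_powr[symmetric] powr_realpow flip: powr_real_of_int')
  have q: "q = real p powr log (real p) q" using assms p_gt_1 by simp
  show ?thesis
    unfolding powi by (rule exI[of _ l], subst (1 2) q) (use l p_gt_1 in simp)
qed

lemma sum_dominant:
  assumes "finite I" "i0 \<in> I" "\<And>i. i \<in> I \<Longrightarrow> i \<noteq> i0 \<Longrightarrow> nm (T i) * real p ^ t \<le> nm (T i0)"
  shows "nm ((\<Sum>i\<in>I. T i) - T i0) * real p ^ t \<le> nm (T i0)"
proof -
  have "(\<Sum>i\<in>I. T i) - T i0 = (\<Sum>i\<in>I - {i0}. T i)"
    using assms by (simp add: sum.remove[of I i0])
  moreover have "nm (\<Sum>i\<in>I - {i0}. T i) \<le> nm (T i0) / real p ^ t"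
    by (rule nm_sum_le) (use assms in \<open>auto simp: field_simps\<close>)
  ultimately show ?thesis by (simp add: field_simps)
qed


subsection \<open>Centres for a polynomial\<close>

text \<open>Let c be the point of \<open>C0\<close> nearest to x. If
  \<open>|x' - c| = |x - c|\<close>, then \<open>x' - c\<close> arises from \<open>x - c\<close> by
  the \<open>N\<close>th power of a unit, which is close to 1; by
  \<open>coeff_bound_by_value\<close> the resulting change of \<open>f\<close> is small compared
  with \<open>f(x)\<close>. If the distances differ, then by \<open>sim1_window\<close> x is far
  from every slope. Hence one Taylor term dominates all others by a factor \<open>p^e\<close>, it is
  the same at x and x', and the cosets of \<open>f(x)\<close> and \<open>f(x')\<close> are those of
  a monomial in \<open>x - c\<close> and \<open>x' - c\<close>.\<close>

lemma exists_centres: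
  fixes D n :: nat
  assumes n: "n \<ge> 1"
  shows "\<exists>s k. \<forall>f. degree f \<le> D \<longrightarrow>
           (\<exists>C. finite C \<and> card C \<le> k \<and> (\<forall>x x'. sim s C x x' \<longrightarrow> pcl n (poly f x) (poly f x')))"
proof -
  obtain A where A: "A \<ge> 1" and bound: "\<And>f C c x i. degree f \<le> D \<Longrightarrow>
      (\<And>i y. (pderiv ^^ i) f \<noteq> 0 \<Longrightarrow> poly ((pderiv ^^ i) f) y = 0 \<Longrightarrow> y \<in> C) \<Longrightarrow>
      c \<in> C \<Longrightarrow> (\<And>c'. c' \<in> C \<Longrightarrow> nm (x - c) \<le> nm (x - c')) \<Longrightarrow>
      nm (coeff (pcompose f [:c, 1:]) i) * nm (x - c) ^ i \<le> A * nm (poly f x)"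
    using coeff_bound_by_value[of D] by metis
  obtain e' where e': "\<And>a b. nm (b - a) * real p ^ e' \<le> nm a \<Longrightarrow> pcl n a b"
    using close_imp_pcl[of n] n by (metis atLeastAtMost_iff order_refl)
  define e where "e = Suc e'"
  have e: "pcl n a b" if "nm (b - a) * real p ^ e \<le> nm a" for a b
  proof (rule e')
    have "nm (b - a) * real p ^ e' \<le> nm (b - a) * real p ^ e"
      using p_gt_1 unfolding e_def by (intro mult_left_mono power_increasing) auto
    with that show "nm (b - a) * real p ^ e' \<le> nm a" by simp
  qed
  have e_gt: "real p ^ e > 1" using p_gt_1 unfolding e_def by (intro one_less_power) auto
  obtain a where a: "A \<le> real p ^ a"
    using real_arch_pow[OF p_gt_1, of A] by (meson less_imp_le)
  \<comment> \<open>\<open>a\<close> absorbs the constant \<open>A\<close>, and \<open>e\<close> is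
    the relative precision that preserves cosets.\<close>
  define t where "t = Suc (a + e)"
  obtain N where N: "N \<ge> 1" "\<And>w. nm w = 1 \<Longrightarrow> nm (w ^ N - 1) * real p ^ t \<le> 1"
    using unit_power_close[of t] by metis
  \<comment> \<open>Cosets are needed for the exponents \<open>n\<close> and \<open>N\<close>,
    comparisons up to the factor \<open>p^(e + 1)\<close>.\<close>
  define s where "s = Suc t + n + N"
  \<comment> \<open>The derivatives of order 0 to \<open>D\<close> have at most \<open>D\<close>
    roots each; one more centre is the 0 that keeps \<open>C0\<close> nonempty. In \<open>k\<close>,
    every pair of degrees adds one slope to each of these centres.\<close>
  define k0 where "k0 = Suc (Suc D * D)"
  define k where "k = k0 + k0 * (Suc D * Suc D)"
  show ?thesis
  proof (rule exI[of _ s], rule exI[of _ k], intro allI impI)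
    fix f :: "'a poly" assume deg: "degree f \<le> D"
    define R where "R i = {y. (pderiv ^^ i) f \<noteq> 0 \<and> poly ((pderiv ^^ i) f) y = 0}" for i
    have R_deg: "finite (R i) \<and> card (R i) \<le> D" for i
    proof (cases "(pderiv ^^ i) f = 0")
      case False
      have "degree ((pderiv ^^ i) f) \<le> degree f" by (simp add: degree_higher_pderiv)
      then show ?thesis
        using False poly_roots_finite[OF False] card_poly_roots_bound[OF False] deg by (simp add: R_def)
    qed (simp add: R_def)
    have R_empty: "R i = {}" if "i > D" for i
    proof -
      have "(pderiv ^^ i) f = 0"
        using that deg by (intro poly_eqI) (simp add: coeff_higher_pderiv coeff_eq_0)
      then show ?thesis by (simp add: R_def)
    qed
    define C0 where "C0 = insert 0 (\<Union>i\<le>D. R i)"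
    have fin0: "finite C0" using R_deg by (auto simp: C0_def)
    have card0: "card C0 \<le> k0"
    proof -
      have "card C0 \<le> Suc (card (\<Union>i\<le>D. R i))" unfolding C0_def by (rule card_insert_le_m1) auto
      also have "card (\<Union>i\<le>D. R i) \<le> (\<Sum>i\<le>D. card (R i))" by (rule card_UN_le) simp
      also have "\<dots> \<le> (\<Sum>i\<le>D. D)" using R_deg by (intro sum_mono) auto
      finally show ?thesis by (simp add: k0_def)
    qed
    have roots: "y \<in> C0" if "(pderiv ^^ i) f \<noteq> 0" "poly ((pderiv ^^ i) f) y = 0" for i y
    proof -
      have "y \<in> R i" using that by (simp add: R_def)
      moreover from this have "i \<le> D" using R_empty[of i] by (cases "i \<le> D") auto
      ultimately show ?thesis by (auto simp: C0_def)
    qed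
    define g where "g c = pcompose f [:c, 1:]" for c
    have deg_g: "degree (g c) \<le> D" for c using deg by (simp add: g_def degree_pcompose)
    have g_sum: "poly f x = (\<Sum>i\<le>D. coeff (g c) i * (x - c) ^ i)" for x c
      unfolding poly_eq_sum[OF deg_g, of c, symmetric] by (simp add: g_def poly_pcompose)
    \<comment> \<open>The terms of degree \<open>i < j\<close> of the expansion around \<open>c\<close> have the same norm at distance about
      \<open>\<bar>d\<bar>\<close> from \<open>c\<close>, i.e. \<open>d\<close> corresponds to a slope of the Newton polygon.\<close>
    have "\<exists>d. coeff (g c) i \<noteq> 0 \<longrightarrow> coeff (g c) j \<noteq> 0 \<longrightarrow> i < j \<longrightarrow> d \<noteq> 0 \<and>
        nm d ^ (j - i) * nm (coeff (g c) j) \<le> nm (coeff (g c) i) \<and>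
        nm (coeff (g c) i) < (real p * nm d) ^ (j - i) * nm (coeff (g c) j)" for c i j
    proof (cases "coeff (g c) i \<noteq> 0 \<and> coeff (g c) j \<noteq> 0 \<and> i < j")
      case True
      obtain l :: int where l: "(real p powi l) ^ (j - i) \<le> nm (coeff (g c) i) / nm (coeff (g c) j)"
        "nm (coeff (g c) i) / nm (coeff (g c) j) < (real p powi (l + 1)) ^ (j - i)"
      proof -
        have "1 \<le> j - i" "nm (coeff (g c) i) / nm (coeff (g c) j) > 0" using True by auto
        from powi_root[OF this(2,1)] that show ?thesis by blast
      qed
      define d :: 'a where "d = of_nat p powi (- l)"
      have p0: "(of_nat p :: 'a) \<noteq> 0" by simp
      have "nm d = real p powi l"
        unfolding d_def power_int_def by (auto simp: nm_inverse nm_divide nm_power nm_p power_divide field_simps)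
      moreover have "real p powi (l + 1) = real p * real p powi l"
        using p_gt_1 by (simp add: power_int_add)
      ultimately show ?thesis using l True
        by (intro exI[of _ d]) (auto simp: field_simps d_def)
    qed auto
    then obtain d where d: "\<And>c i j. coeff (g c) i \<noteq> 0 \<Longrightarrow> coeff (g c) j \<noteq> 0 \<Longrightarrow> i < j \<Longrightarrow> d c i j \<noteq> 0 \<and>
        nm (d c i j) ^ (j - i) * nm (coeff (g c) j) \<le> nm (coeff (g c) i) \<and>
        nm (coeff (g c) i) < (real p * nm (d c i j)) ^ (j - i) * nm (coeff (g c) j)"
      by metis
    define C where "C = C0 \<union> (\<lambda>(c, i, j). c + d c i j) ` (C0 \<times> {..D} \<times> {..D})"
    have C0_C: "C0 \<subseteq> C" by (simp add: C_def)
    have C_d: "c + d c i j \<in> C" if "c \<in> C0" "i \<le> D" "j \<le> D" for c i j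
      using that by (force simp: C_def)
    show "\<exists>C. finite C \<and> card C \<le> k \<and> (\<forall>x x'. sim s C x x' \<longrightarrow> pcl n (poly f x) (poly f x'))"
    proof (intro exI conjI allI impI)
      show "finite C" using fin0 by (simp add: C_def)
      have "card C \<le> card C0 + card (C0 \<times> {..D} \<times> {..D})"
        unfolding C_def using fin0 by (intro order.trans[OF card_Un_le] add_left_mono card_image_le) auto
      also have "\<dots> \<le> k" using card0 by (simp add: card_cartesian_product k_def add_mono mult_le_mono1)
      finally show "card C \<le> k" .
      fix x x' assume sim: "sim s C x x'"
      have pcl: "pcl m (x - c) (x' - c)" if "c \<in> C" "1 \<le> m" "m \<le> s" for c m
        using sim that by (auto simp: sim_def sim1_def)
      have "C0 \<noteq> {}" by (simp add: C0_def)
      then obtain c where c: "c \<in> C0" "\<And>c'. c' \<in> C0 \<Longrightarrow> nm (x - c) \<le> nm (x - c')"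
        using arg_min_if_finite[OF fin0, of "\<lambda>c. nm (x - c)"] by (metis not_le)
      define y where "y = x - c"
      define y' where "y' = x' - c"
      define T where "T i = coeff (g c) i * y ^ i" for i
      define T' where "T' i = coeff (g c) i * y' ^ i" for i
      have fx: "poly f x = (\<Sum>i\<le>D. T i)" "poly f x' = (\<Sum>i\<le>D. T' i)"
        unfolding T_def T'_def y_def y'_def by (rule g_sum)+
      have bnd: "nm (T i) \<le> A * nm (poly f x)" for i
      proof -
        have "nm (coeff (pcompose f [:c, 1:]) i) * nm (x - c) ^ i \<le> A * nm (poly f x)"
          by (rule bound[OF deg roots c])
        then show ?thesis by (simp add: T_def nm_mult nm_power y_def g_def)
      qed
      have y: "pcl m y y'" if "1 \<le> m" "m \<le> s" for m
        using pcl[of c m] c C0_C that by (auto simp: y_def y'_def)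
      show "pcl n (poly f x) (poly f x')"
      proof (cases "nm y = nm y'")
        case True
        \<comment> \<open>\<open>N\<close> is one of the exponents of the similarity. If
          \<open>y\<close> is not 0, the equality of the norms forces
          \<open>|w| = 1\<close>.\<close>
        obtain w where w: "w \<noteq> 0" "y' = w ^ N * y"
          using y[of N] N(1) by (auto simp: s_def pcl_def)
        have "nm (y' ^ i - y ^ i) \<le> nm y ^ i / real p ^ t" for i
        proof (cases "y = 0")
          case False
          with True w have "nm w ^ N = 1" by (simp add: nm_mult nm_power)
          then have w1: "nm w = 1" using N(1) power_eq_iff_eq_base[of N "nm w" 1] by simp
          have "y' ^ i - y ^ i = y ^ i * ((w ^ N) ^ i - 1 ^ i)"
            by (simp add: w power_mult_distrib algebra_simps)
          moreover have "nm ((w ^ N) ^ i - 1 ^ i) \<le> nm (w ^ N - 1)"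
            using w1 by (intro nm_power_diff_le) (simp_all add: nm_power)
          moreover have "nm (w ^ N - 1) \<le> 1 / real p ^ t" using N(2)[OF w1] by (simp add: field_simps)
          ultimately show ?thesis
            using mult_left_mono[of "nm ((w ^ N) ^ i - 1 ^ i)" "1 / real p ^ t" "nm y ^ i"]
            by (simp add: nm_mult nm_power)
        qed (use w in simp)
        then have "nm (T' i - T i) \<le> nm (T i) / real p ^ t" for i
          using mult_left_mono[of "nm (y' ^ i - y ^ i)" "nm y ^ i / real p ^ t" "nm (coeff (g c) i)"]
          by (simp add: T_def T'_def nm_mult nm_power flip: right_diff_distrib)
        moreover have "nm (T i) / real p ^ t \<le> nm (poly f x) / real p ^ e" for i
        proof -
          have "nm (T i) \<le> real p ^ a * nm (poly f x)"
            using bnd[of i] mult_right_mono[OF a, of "nm (poly f x)"] by simp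
          also have "\<dots> \<le> real p ^ Suc a * nm (poly f x)"
            using p_gt_1 by (intro mult_right_mono power_increasing) auto
          finally have "nm (T i) / real p ^ t \<le> real p ^ Suc a * nm (poly f x) / real p ^ t"
            by (intro divide_right_mono) auto
          also have "\<dots> = nm (poly f x) / real p ^ e"
            by (simp add: t_def power_add field_simps)
          finally show ?thesis .
        qed
        ultimately have "nm (\<Sum>i\<le>D. T' i - T i) \<le> nm (poly f x) / real p ^ e"
          by (intro nm_sum_le) (auto intro: order_trans)
        then have "nm (poly f x' - poly f x) * real p ^ e \<le> nm (poly f x)"
          by (simp add: fx sum_subtractf field_simps)
        then show ?thesis by (rule e)
      next
        case False
        moreover have "y = 0 \<longleftrightarrow> y' = 0" using y[of 1] by (auto simp: s_def pcl_def)
        ultimately have y0: "y \<noteq> 0" "y' \<noteq> 0" by auto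
        define I where "I = {i. i \<le> D \<and> coeff (g c) i \<noteq> 0}"
        \<comment> \<open>Of any two nonzero Taylor terms, the same one is larger by the factor
          \<open>p^e\<close> at x and at x'.\<close>
        have sep: "(nm (T i) * real p ^ e \<le> nm (T j) \<and> nm (T' i) * real p ^ e \<le> nm (T' j)) \<or>
                   (nm (T j) * real p ^ e \<le> nm (T i) \<and> nm (T' j) * real p ^ e \<le> nm (T' i))"
          if ij: "i \<in> I" "j \<in> I" "i < j" for i j
        proof -
          define \<delta> where "\<delta> = nm (d c i j)"
          have cij: "coeff (g c) i \<noteq> 0" "coeff (g c) j \<noteq> 0" "i \<le> D" "j \<le> D" using ij by (auto simp: I_def)
          have \<delta>: "\<delta> > 0" "\<delta> ^ (j - i) * nm (coeff (g c) j) \<le> nm (coeff (g c) i)"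
             "nm (coeff (g c) i) < (real p * \<delta>) ^ (j - i) * nm (coeff (g c) j)"
            using d[OF cij(1,2) ij(3)] by (auto simp: \<delta>_def)
          have split: "r ^ j = r ^ (j - i) * r ^ i" for r :: real
            using ij by (simp flip: power_add)
          have small: "nm (coeff (g c) j) * r ^ j * real p ^ e \<le> nm (coeff (g c) i) * r ^ i"
            if r: "r * real p ^ s \<le> \<delta>" "r > 0" for r
          proof -
            have "real p ^ e \<le> real p ^ s" using p_gt_1 by (intro power_increasing) (auto simp: s_def t_def)
            with r have "r * real p ^ e \<le> \<delta>"
              using mult_left_mono[of "real p ^ e" "real p ^ s" r] by linarith
            then have 1: "(r * real p ^ e) ^ (j - i) \<le> \<delta> ^ (j - i)" using r by (intro power_mono) auto
            have "real p ^ e \<le> (real p ^ e) ^ (j - i)"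
              using ij power_p_ge_1[of e] by (intro self_le_power) auto
            then have "r ^ (j - i) * real p ^ e \<le> (r * real p ^ e) ^ (j - i)"
              using r by (simp add: power_mult_distrib)
            with 1 have "r ^ (j - i) * real p ^ e * nm (coeff (g c) j) \<le> \<delta> ^ (j - i) * nm (coeff (g c) j)"
              by (intro mult_right_mono) auto
            with \<delta> have "r ^ (j - i) * real p ^ e * nm (coeff (g c) j) \<le> nm (coeff (g c) i)" by linarith
            then have "r ^ (j - i) * real p ^ e * nm (coeff (g c) j) * r ^ i \<le> nm (coeff (g c) i) * r ^ i"
              using r by (intro mult_right_mono) auto
            then show ?thesis by (simp add: split mult_ac)
          qed
          \<comment> \<open>\<open>\<delta>\<close> locates the slope only up to a factor
            \<open>p\<close>, hence the exponent \<open>Suc e\<close> in this direction.\<close>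
          have large: "nm (coeff (g c) i) * r ^ i * real p ^ e \<le> nm (coeff (g c) j) * r ^ j"
            if r: "\<delta> * real p ^ s \<le> r" for r
          proof -
            have r0: "r > 0" by (rule less_le_trans[OF _ r]) (use \<delta> in simp)
            have "real p ^ Suc e \<le> real p ^ s" using p_gt_1 by (intro power_increasing) (auto simp: s_def t_def)
            then have "\<delta> * real p ^ Suc e \<le> r" using r \<delta> mult_left_mono[of "real p ^ Suc e" "real p ^ s" \<delta>] by linarith
            then have 1: "(real p * \<delta> * real p ^ e) ^ (j - i) \<le> r ^ (j - i)" using \<delta>
              by (intro power_mono) (auto simp: mult_ac)
            have "real p ^ e \<le> (real p ^ e) ^ (j - i)"
              using ij power_p_ge_1[of e] by (intro self_le_power) auto
            then have "(real p * \<delta>) ^ (j - i) * real p ^ e \<le> (real p * \<delta> * real p ^ e) ^ (j - i)"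
              unfolding power_mult_distrib[of _ "real p ^ e"] using \<delta> by (intro mult_left_mono) auto
            with 1 have le: "(real p * \<delta>) ^ (j - i) * real p ^ e \<le> r ^ (j - i)" by simp
            have "nm (coeff (g c) i) * real p ^ e \<le> (real p * \<delta>) ^ (j - i) * nm (coeff (g c) j) * real p ^ e"
              using \<delta> by (intro mult_right_mono) auto
            also have "\<dots> = (real p * \<delta>) ^ (j - i) * real p ^ e * nm (coeff (g c) j)" by (simp add: mult_ac)
            also have "\<dots> \<le> r ^ (j - i) * nm (coeff (g c) j)" using le by (rule mult_right_mono) simp
            finally have "nm (coeff (g c) i) * real p ^ e * r ^ i \<le> r ^ (j - i) * nm (coeff (g c) j) * r ^ i"
              using r0 by (intro mult_right_mono) auto
            then show ?thesis by (simp add: split mult_ac)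
          qed
          have sim1: "sim1 s x x' c (c + d c i j)"
            using sim C_d[OF c(1) cij(3,4)] c(1) C0_C by (auto simp: sim_def)
          have nd: "nm (c + d c i j - c) = \<delta>" by (simp add: \<delta>_def)
          show ?thesis
          proof (cases "nm y * real p ^ s \<le> \<delta>")
            case True
            then have "nm y' * real p ^ s \<le> \<delta>" using sim1 nd by (auto simp: sim1_def y_def y'_def)
            then show ?thesis using small[of "nm y"] small[of "nm y'"] True y0
              by (auto simp: T_def T'_def nm_mult nm_power)
          next
            case not_small: False
            \<comment> \<open>Otherwise \<open>|x - c|\<close> would lie in the window around
              \<open>\<delta>\<close>, and then x' would have the same distance from c.\<close>
            have big: "\<delta> * real p ^ s < nm y"
              using sim1_window[OF sim1] not_small False nd by (force simp: y_def y'_def)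
            then have "\<delta> * real p ^ s < nm y'" using sim1 nd by (auto simp: sim1_def y_def y'_def not_le[symmetric])
            then show ?thesis using large[of "nm y"] large[of "nm y'"] big
              by (auto simp: T_def T'_def nm_mult nm_power)
          qed
        qed
        show ?thesis
        proof (cases "I = {}")
          case True
          then have "T i = 0" "T' i = 0" if "i \<le> D" for i using that by (auto simp: I_def T_def T'_def)
          then show ?thesis by (simp add: fx pcl_refl)
        next
          case I: False
          have "finite I" by (simp add: I_def)
          then obtain i0 where i0: "i0 \<in> I" "\<And>i. i \<in> I \<Longrightarrow> nm (T i) \<le> nm (T i0)"
            using I arg_min_if_finite[of I "\<lambda>i. - nm (T i)"] by (metis neg_less_iff_less not_le)
          have dom: "nm (T i) * real p ^ e \<le> nm (T i0) \<and> nm (T' i) * real p ^ e \<le> nm (T' i0)"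
            if i: "i \<le> D" "i \<noteq> i0" for i
          proof (cases "i \<in> I")
            case False
            then show ?thesis using i by (simp add: I_def T_def T'_def)
          next
            case True
            show ?thesis
            proof (rule ccontr)
              assume contr: "\<not> ?thesis"
              then have swap: "nm (T i0) * real p ^ e \<le> nm (T i)" "nm (T' i0) * real p ^ e \<le> nm (T' i)"
                using sep[of i i0] sep[of i0 i] i True i0(1) by (metis linorder_neqE_nat)+
              from swap(1) i0(2)[OF True] have "nm (T i0) * real p ^ e \<le> nm (T i0) * 1" by simp
              then have "nm (T i0) \<le> 0" using e_gt mult_le_cancel_left_pos[of "nm (T i0)" "real p ^ e" 1]
                by fastforce
              then show False using i0(1) y0 by (simp add: I_def T_def)
            qed
          qed
          have i0D: "i0 \<le> D" using i0 by (simp add: I_def)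
          have "pcl n (T i0) (poly f x)" "pcl n (T' i0) (poly f x')"
            unfolding fx by (rule e, rule sum_dominant; use dom i0D in auto)+
          moreover have "pcl n (T i0) (T' i0)"
            unfolding T_def T'_def using y[of n] n by (intro pcl_mult_left pcl_power) (auto simp: s_def)
          ultimately show ?thesis by (meson pcl_sym pcl_trans)
        qed
      qed
    qed
  qed
qed

subsection \<open>Representatives of similarity classes\<close>

lemma le_mult_ge_1: "0 \<le> r \<Longrightarrow> 1 \<le> q \<Longrightarrow> r \<le> r * q" for q r :: real
  using mult_left_mono[of 1 q r] by simp

lemma nm_scaled_le_1:
  assumes "nm a \<le> nm b * real p ^ W" "b \<noteq> 0"
  shows "nm (a / b * of_nat p ^ W) \<le> 1"
proof -
  have "nm (a / b * of_nat p ^ W) = nm a / (nm b * real p ^ W)"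
    by (simp add: nm_mult nm_divide nm_p_power)
  also have "\<dots> \<le> 1" using assms by (subst pos_divide_le_eq) auto
  finally show ?thesis .
qed

text \<open>If \<open>x' - x\<close> is small compared with \<open>x - c\<close>, then
  \<open>x' - c\<close> has the same norm as \<open>x - c\<close> and lies in the same cosets, so
  the thresholds cannot tell them apart.\<close>

lemma sim_close:
  "\<exists>T. \<forall>C x x'. (\<forall>c\<in>C. nm (x' - x) * real p ^ T \<le> nm (x - c)) \<longrightarrow> sim s C x x'"
proof -
  obtain t where t: "\<And>n a b. n \<in> {1..s} \<Longrightarrow> nm (b - a) * real p ^ t \<le> nm a \<Longrightarrow> pcl n a b"
    using close_imp_pcl[of s] by metis
  show ?thesis
  proof (rule exI[of _ "Suc t"], intro allI impI)
    fix C x x' assume close: "\<forall>c\<in>C. nm (x' - x) * real p ^ Suc t \<le> nm (x - c)"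
    show "sim s C x x'" unfolding sim_def
    proof (intro ballI)
      fix c d assume c: "c \<in> C"
      have 1: "nm ((x' - c) - (x - c)) * real p ^ Suc t \<le> nm (x - c)" using close c by simp
      have "nm (x' - x) * real p ^ t \<le> nm (x' - x) * real p ^ Suc t"
        using p_gt_1 by (intro mult_left_mono power_increasing) auto
      with 1 have 2: "nm ((x' - c) - (x - c)) * real p ^ t \<le> nm (x - c)" by simp
      show "sim1 s x x' c d"
        using closeD[OF 1] t[OF _ 2] by (intro sim1_same_norm) auto
    qed
  qed
qed

text \<open>A point may move within its cosets relative to c as long as every other centre stays
  clearly outside or clearly inside both distances. Seen from a centre far outside, both points look
  like c; seen from one far inside, they look as they do from c. In either case all thresholds keep
  their truth value.\<close>

lemma sim_shift:
  "\<exists>a. a \<ge> 1 \<and> (\<forall>C c x x'. c \<in> C \<longrightarrow> x \<noteq> c \<longrightarrow> x' \<noteq> c \<longrightarrow> (\<forall>n\<in>{1..s}. pcl n (x - c) (x' - c)) \<longrightarrow>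
     (\<forall>d\<in>C. d \<noteq> c \<longrightarrow>
        nm (x - c) * real p ^ a \<le> nm (d - c) \<and> nm (x' - c) * real p ^ a \<le> nm (d - c) \<or>
        nm (d - c) * real p ^ a \<le> nm (x - c) \<and> nm (d - c) * real p ^ a \<le> nm (x' - c)) \<longrightarrow> sim s C x x')"
proof -
  obtain t where t: "\<And>n a b. n \<in> {1..s} \<Longrightarrow> nm (b - a) * real p ^ t \<le> nm a \<Longrightarrow> pcl n a b"
    using close_imp_pcl[of s] by metis
  \<comment> \<open>\<open>t\<close> preserves the cosets, \<open>s\<close> clears all thresholds,
    and the extra 1 makes the inequalities strict.\<close>
  define a where "a = Suc (t + s)"
  have pow: "real p ^ k \<le> real p ^ a" if "k \<le> a" for k
    using that p_gt_1 by (intro power_increasing) auto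
  have close: "pcl n u v" if "nm (v - u) * real p ^ a \<le> nm u" "n \<in> {1..s}" for n u v
  proof -
    have "nm (v - u) * real p ^ t \<le> nm (v - u) * real p ^ a"
      by (intro mult_left_mono pow) (auto simp: a_def)
    with that t show ?thesis by force
  qed
  have norm: "nm v = nm u" if "nm (v - u) * real p ^ a \<le> nm u" for u v
    using closeD[OF that] by (simp add: a_def)
  have pa: "real p ^ a > 1" unfolding a_def using p_gt_1 by (intro one_less_power) auto
  show ?thesis
  proof (rule exI[of _ a], intro conjI allI impI)
    show "a \<ge> 1" by (simp add: a_def)
    fix C c x x' assume c: "c \<in> C" and ne: "x \<noteq> c" "x' \<noteq> c"
      and pcl: "\<forall>n\<in>{1..s}. pcl n (x - c) (x' - c)"
      and "\<forall>d\<in>C. d \<noteq> c \<longrightarrow>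
        nm (x - c) * real p ^ a \<le> nm (d - c) \<and> nm (x' - c) * real p ^ a \<le> nm (d - c) \<or>
        nm (d - c) * real p ^ a \<le> nm (x - c) \<and> nm (d - c) * real p ^ a \<le> nm (x' - c)"
    then have alt: "nm (x - c) * real p ^ a \<le> nm (d - c) \<and> nm (x' - c) * real p ^ a \<le> nm (d - c) \<or>
        nm (d - c) * real p ^ a \<le> nm (x - c) \<and> nm (d - c) * real p ^ a \<le> nm (x' - c)" if "d \<in> C" for d
      using that by (cases "d = c") auto
    have sub: "r * real p ^ j \<le> q" if "r * real p ^ a \<le> q" "j \<le> a" "r \<ge> 0" for r q j
      using that mult_left_mono[OF pow, of j r] by linarith
    have less: "r < q" if "r * real p ^ a \<le> q" "q > 0" for r q
    proof (rule ccontr)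
      assume "\<not> r < q"
      with that have "q * real p ^ a \<le> r * real p ^ a" by (intro mult_right_mono) auto
      with that(1) have "q * real p ^ a \<le> q * 1" by linarith
      with pa that show False using mult_le_cancel_left_pos[of q "real p ^ a" 1] by auto
    qed
    show "sim s C x x'" unfolding sim_def
    proof (intro ballI)
      fix e d assume e: "e \<in> C" and d: "d \<in> C"
      consider (far) "nm (x - c) * real p ^ a \<le> nm (e - c)" "nm (x' - c) * real p ^ a \<le> nm (e - c)"
        | (near) "nm (e - c) * real p ^ a \<le> nm (x - c)" "nm (e - c) * real p ^ a \<le> nm (x' - c)"
        using alt[OF e] by blast
      then show "sim1 s x x' e d"
      proof cases
        case far
        have 1: "nm ((x - e) - (c - e)) * real p ^ a \<le> nm (c - e)"
                "nm ((x' - e) - (c - e)) * real p ^ a \<le> nm (c - e)"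
          using far by (simp_all add: nm_minus_commute[of e c])
        show ?thesis
        proof (rule sim1_same_norm)
          show "pcl n (x - e) (x' - e)" if "n \<in> {1..s}" for n
            using close[OF 1(1) that] close[OF 1(2) that] by (meson pcl_sym pcl_trans)
        qed (simp add: norm[OF 1(1)] norm[OF 1(2)])
      next
        case near
        have 1: "nm ((x - e) - (x - c)) * real p ^ a \<le> nm (x - c)"
                "nm ((x' - e) - (x' - c)) * real p ^ a \<le> nm (x' - c)"
          using near by (simp_all add: nm_minus_commute[of e c])
        have pcl_e: "pcl n (x - e) (x' - e)" if "n \<in> {1..s}" for n
          using close[OF 1(1) that] close[OF 1(2) that] pcl that by (meson pcl_sym pcl_trans)
        note ne1 = norm[OF 1(1)] norm[OF 1(2)]
        have xc: "nm (x - c) > 0" "nm (x' - c) > 0" using ne by auto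
        consider (dfar) "nm (x - c) * real p ^ a \<le> nm (d - c)" "nm (x' - c) * real p ^ a \<le> nm (d - c)"
          | (dnear) "nm (d - c) * real p ^ a \<le> nm (x - c)" "nm (d - c) * real p ^ a \<le> nm (x' - c)"
          using alt[OF d] by blast
        then show ?thesis
        proof cases
          case dfar
          have "nm (e - c) < nm (x - c)" using less[OF near(1)] xc by simp
          also have "nm (x - c) \<le> nm (d - c)" using sub[OF dfar(1), of 0] by simp
          finally have "nm (d - e) = nm (d - c)"
            using nm_dist_eq[of e c d] nm_minus_commute by metis
          moreover have "nm (x - c) * real p ^ j \<le> nm (d - c)" "nm (x' - c) * real p ^ j \<le> nm (d - c)"
            if "j \<le> s" for j
            using sub[OF dfar(1), of j] sub[OF dfar(2), of j] that by (simp_all add: a_def)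
          moreover have "nm (x - c) \<le> nm (d - c) * real p ^ j" "nm (x' - c) \<le> nm (d - c) * real p ^ j" for j
            using sub[OF dfar(1), of 0, simplified] sub[OF dfar(2), of 0, simplified]
              le_mult_ge_1[OF nm_nonneg[of "d - c"] power_p_ge_1[of j]] by linarith+
          ultimately show ?thesis by (simp add: sim1_def pcl_e ne1)
        next
          case dnear
          have "nm (d - e) \<le> max (nm (d - c)) (nm (e - c))"
            using nm_triangle[of d e c] nm_minus_commute[of c e] by simp
          then consider "nm (d - e) \<le> nm (d - c)" | "nm (d - e) \<le> nm (e - c)" by linarith
          then have de: "nm (d - e) * real p ^ a \<le> nm (x - c) \<and> nm (d - e) * real p ^ a \<le> nm (x' - c)"
          proof cases
            case 1
            then have "nm (d - e) * real p ^ a \<le> nm (d - c) * real p ^ a" by (rule mult_right_mono) simp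
            with dnear show ?thesis by linarith
          next
            case 2
            then have "nm (d - e) * real p ^ a \<le> nm (e - c) * real p ^ a" by (rule mult_right_mono) simp
            with near show ?thesis by linarith
          qed
          note de = conjunct1[OF de] conjunct2[OF de]
          have no1: "\<not> q * real p ^ j \<le> nm (d - e)" if "nm (d - e) * real p ^ a \<le> q" "q > 0" for q j
          proof
            assume "q * real p ^ j \<le> nm (d - e)"
            moreover have "q * 1 \<le> q * real p ^ j" using that power_p_ge_1[of j] by (intro mult_left_mono) auto
            ultimately show False using less[OF that] by simp
          qed
          have no2: "\<not> q \<le> nm (d - e) * real p ^ j" if "nm (d - e) * real p ^ a \<le> q" "q > 0" "j \<le> s" for q j
          proof
            assume q: "q \<le> nm (d - e) * real p ^ j"
            then have pos: "nm (d - e) > 0" using that by (cases "d = e") auto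
            have "real p ^ j < real p ^ a" using that p_gt_1 by (intro power_strict_increasing) (auto simp: a_def)
            then have "nm (d - e) * real p ^ j < nm (d - e) * real p ^ a"
              using pos by (intro mult_strict_left_mono) auto
            with q that show False by simp
          qed
          show ?thesis using no1[OF de(1)] no1[OF de(2)] no2[OF de(1)] no2[OF de(2)] xc
            by (simp add: sim1_def pcl_e ne1)
        qed
      qed
    qed
  qed
qed

lemma exists_scale:
  fixes a b q :: real
  assumes "0 < b" "b \<le> a" "q > 1"
  shows "\<exists>l. b * q ^ l \<le> a \<and> a < b * q ^ Suc l"
proof -
  define l where "l = (LEAST l. a < b * q ^ Suc l)"
  obtain m where "a / b < q ^ m" using real_arch_pow[OF assms(3)] by blast
  also have "q ^ m \<le> q ^ Suc m" using assms by (intro power_increasing) auto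
  finally have "a < b * q ^ Suc m" using assms by (simp add: field_simps)
  then have 1: "a < b * q ^ Suc l" unfolding l_def by (rule LeastI)
  have "b * q ^ l \<le> a"
  proof (cases l)
    case (Suc k)
    then have "\<not> a < b * q ^ Suc k" using not_less_Least[of k "\<lambda>l. a < b * q ^ Suc l"] by (simp add: l_def)
    then show ?thesis using Suc by simp
  qed (use assms in simp)
  with 1 show ?thesis by blast
qed

text \<open>Multiplying \<open>x - c\<close> by powers of \<open>p^N\<close> with N = s! preserves
  its cosets for all exponents up to \<open>s\<close>. Unless \<open>x - c\<close> is already
  comparable to some \<open>d - c\<close>, such steps move it towards the next centre until it is.
  \<open>W\<close> accommodates the safety distance \<open>a\<close> of \<open>sim_shift\<close> and
  one step.\<close>

lemma exists_window:
  "\<exists>W. \<forall>C x c0 d0. finite C \<longrightarrow> x \<notin> C \<longrightarrow> c0 \<in> C \<longrightarrow> d0 \<in> C \<longrightarrow> c0 \<noteq> d0 \<longrightarrow>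
     (\<exists>z c d. c \<in> C \<and> d \<in> C \<and> c \<noteq> d \<and> sim s C x z \<and> (\<forall>e\<in>C. nm (z - c) \<le> nm (z - e)) \<and>
        nm (d - c) \<le> nm (z - c) * real p ^ W \<and> nm (z - c) \<le> nm (d - c) * real p ^ W)"
proof -
  obtain a where a: "a \<ge> 1" and shift: "\<And>C c x x'. c \<in> C \<Longrightarrow> x \<noteq> c \<Longrightarrow> x' \<noteq> c \<Longrightarrow>
     (\<And>n. n \<in> {1..s} \<Longrightarrow> pcl n (x - c) (x' - c)) \<Longrightarrow>
     (\<And>d. d \<in> C \<Longrightarrow> d \<noteq> c \<Longrightarrow>
        nm (x - c) * real p ^ a \<le> nm (d - c) \<and> nm (x' - c) * real p ^ a \<le> nm (d - c) \<or>
        nm (d - c) * real p ^ a \<le> nm (x - c) \<and> nm (d - c) * real p ^ a \<le> nm (x' - c)) \<Longrightarrow> sim s C x x'"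
    using sim_shift[of s] by metis
  define N :: nat where "N = fact s"
  have N: "N \<ge> 1" by (simp add: N_def)
  have Ndvd: "n dvd N" if "n \<in> {1..s}" for n using that by (simp add: N_def dvd_fact)
  have q: "real p ^ N > 1" using N p_gt_1 by (intro one_less_power) auto
  define W where "W = a + N"
  have pow: "real p ^ k \<le> real p ^ W" if "k \<le> W" for k
    using that p_gt_1 by (intro power_increasing) auto
  have pa: "real p ^ a > 1" using a p_gt_1 by (intro one_less_power) auto
  show ?thesis
  proof (rule exI[of _ W], intro allI impI)
    fix C x c0 d0 assume C: "finite C" "x \<notin> C" "c0 \<in> C" "d0 \<in> C" "c0 \<noteq> (d0 :: 'a)"
    obtain c where c: "c \<in> C" "\<And>e. e \<in> C \<Longrightarrow> nm (x - c) \<le> nm (x - e)"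
      using arg_min_if_finite[OF C(1), of "\<lambda>c. nm (x - c)"] C(3) by (metis not_le empty_iff)
    have xc: "x \<noteq> c" using C c by auto
    then have xc_pos: "nm (x - c) > 0" by simp
    show "\<exists>z c d. c \<in> C \<and> d \<in> C \<and> c \<noteq> d \<and> sim s C x z \<and> (\<forall>e\<in>C. nm (z - c) \<le> nm (z - e)) \<and>
        nm (d - c) \<le> nm (z - c) * real p ^ W \<and> nm (z - c) \<le> nm (d - c) * real p ^ W"
    proof (cases "\<exists>d\<in>C. d \<noteq> c \<and> nm (d - c) \<le> nm (x - c) * real p ^ W \<and> nm (x - c) \<le> nm (d - c) * real p ^ W")
      case True
      then show ?thesis using c sim_refl by metis
    next
      case no_window: False
      have alt: "nm (x - c) * real p ^ W \<le> nm (d - c) \<or> nm (d - c) * real p ^ W \<le> nm (x - c)"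
        if "d \<in> C" "d \<noteq> c" for d using no_window that by fastforce
      have sub: "u * real p ^ j \<le> v" if "u * real p ^ W \<le> v" "j \<le> W" "u \<ge> 0" for u v j
        using that mult_left_mono[OF pow, of j u] by linarith
      \<comment> \<open>It remains to scale \<open>x - c\<close> by an \<open>N\<close>th power so that it comes close to some \<open>d - c\<close>.\<close>
      have *: ?thesis
        if w: "w \<noteq> 0" and d: "d \<in> C" "d \<noteq> c" and nz: "nm z = nm w ^ N * nm (x - c)" "z = w ^ N * (x - c)"
          and win: "nm (d - c) \<le> nm z * real p ^ W" "nm z \<le> nm (d - c) * real p ^ W"
          and alt': "\<And>e. e \<in> C \<Longrightarrow> e \<noteq> c \<Longrightarrow>
             nm (x - c) * real p ^ a \<le> nm (e - c) \<and> nm z * real p ^ a \<le> nm (e - c) \<or>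
             nm (e - c) * real p ^ a \<le> nm (x - c) \<and> nm (e - c) * real p ^ a \<le> nm z" for w d z
      proof (rule exI[of _ "c + z"], rule exI[of _ c], rule exI[of _ d], intro conjI ballI)
        have z0: "z \<noteq> 0" using nz w xc by simp
        show "sim s C x (c + z)"
        proof (rule shift[OF c(1) xc])
          show "c + z \<noteq> c" using z0 by simp
          show "pcl n (x - c) (c + z - c)" if "n \<in> {1..s}" for n
            by (rule pcl_dvd[OF _ Ndvd[OF that]]) (use nz w in \<open>auto simp: pcl_def\<close>)
        qed (use alt' in simp)
        fix e assume e: "e \<in> C"
        show "nm (c + z - c) \<le> nm (c + z - e)"
        proof (cases "e = c")
          case False
          \<comment> \<open>No other centre lies on the sphere of radius \<open>|z|\<close> around
            c, so the ultrametric law keeps c nearest to \<open>c + z\<close>.\<close>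
          have "nm (e - c) \<noteq> nm z"
          proof
            assume eq: "nm (e - c) = nm z"
            have "nm z * real p ^ a \<le> nm z * 1" using alt'[OF e False] eq by auto
            with z0 pa show False using mult_le_cancel_left_pos[of "nm z" "real p ^ a" 1] by auto
          qed
          then consider "nm (e - c) < nm z" | "nm z < nm (e - c)" by linarith
          then show ?thesis
          proof cases
            case 1
            then show ?thesis using nm_add_less[of "c - e" z] nm_minus_commute[of e c]
              by (simp add: algebra_simps)
          next
            case 2
            then show ?thesis using nm_add_less[of z "c - e"] nm_minus_commute[of e c]
              by (simp add: algebra_simps)
          qed
        qed simp
      qed (use c d win in \<open>auto simp: add_diff_eq\<close>)
      have near_le: "u \<le> v * real p ^ W" if "u * real p ^ a \<le> v" "v \<ge> 0" "u \<ge> 0" for u v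
        using that mult_left_mono[OF power_p_ge_1[of W] that(2)] mult_left_mono[OF power_p_ge_1[of a] that(3)]
        by linarith
      define near where "near = {d \<in> C. d \<noteq> c \<and> nm (d - c) * real p ^ W \<le> nm (x - c)}"
      show ?thesis
      proof (cases "near = {}")
        case False
        have fin: "finite near" using C by (simp add: near_def)
        \<comment> \<open>\<open>x - c\<close> is shrunk towards the outermost of the near centres;
          the others stay near, and the far ones stay far.\<close>
        obtain d where d: "d \<in> near" "\<And>e. e \<in> near \<Longrightarrow> nm (e - c) \<le> nm (d - c)"
          using arg_min_if_finite[OF fin False, of "\<lambda>d. - nm (d - c)"] by (metis neg_less_iff_less not_le)
        have dC: "d \<in> C" "d \<noteq> c" "nm (d - c) * real p ^ W \<le> nm (x - c)" using d by (auto simp: near_def)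
        have "nm (d - c) * real p ^ a \<le> nm (x - c)" using dC(3) by (rule sub) (auto simp: W_def)
        then obtain l where l: "nm (d - c) * real p ^ a * (real p ^ N) ^ l \<le> nm (x - c)"
           "nm (x - c) < nm (d - c) * real p ^ a * (real p ^ N) ^ Suc l"
          using exists_scale[OF _ _ q, of "nm (d - c) * real p ^ a" "nm (x - c)"] dC by auto
        define w :: 'a where "w = of_nat p ^ l"
        define z where "z = w ^ N * (x - c)"
        have nw: "nm w ^ N = 1 / (real p ^ N) ^ l"
          by (simp add: w_def nm_p_power power_one_over mult.commute flip: power_mult)
        have nz: "nm z = nm (x - c) / (real p ^ N) ^ l" by (simp add: z_def nm_mult nm_power nw)
        have 1: "nm (d - c) * real p ^ a \<le> nm z" using l(1) by (simp add: nz pos_le_divide_eq)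
        have 2: "nm z \<le> nm (d - c) * real p ^ W"
        proof -
          have "nm (x - c) / (real p ^ N) ^ l \<le> nm (d - c) * real p ^ a * (real p ^ N)"
            using l(2) by (simp add: pos_divide_le_eq mult_ac)
          then show ?thesis by (simp add: nz W_def power_add mult.assoc)
        qed
        have zx: "nm z \<le> nm (x - c)"
        proof -
          have "(real p ^ N) ^ l \<ge> 1" using q by (simp add: one_le_power)
          then show ?thesis using le_mult_ge_1[of "nm (x - c)" "(real p ^ N) ^ l"]
            by (simp add: nz pos_divide_le_eq)
        qed
        show ?thesis
        proof (rule *[of w d z])
          fix e assume e: "e \<in> C" "e \<noteq> c"
          show "nm (x - c) * real p ^ a \<le> nm (e - c) \<and> nm z * real p ^ a \<le> nm (e - c) \<or>
             nm (e - c) * real p ^ a \<le> nm (x - c) \<and> nm (e - c) * real p ^ a \<le> nm z"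
          proof (cases "e \<in> near")
            case True
            have le: "nm (e - c) * real p ^ a \<le> nm (d - c) * real p ^ a"
              using d(2)[OF True] by (intro mult_right_mono) auto
            with 1 zx show ?thesis by linarith
          next
            case False
            then have "nm (x - c) * real p ^ W \<le> nm (e - c)" using alt[OF e] e by (auto simp: near_def)
            then have xa: "nm (x - c) * real p ^ a \<le> nm (e - c)" by (rule sub) (auto simp: W_def)
            moreover have "nm z * real p ^ a \<le> nm (x - c) * real p ^ a"
              using zx by (intro mult_right_mono) auto
            ultimately show ?thesis by linarith
          qed
        qed (use dC 1 2 near_le in \<open>auto simp: w_def z_def nm_mult nm_power\<close>)
      next
        case True
        then have far: "nm (x - c) * real p ^ W \<le> nm (e - c)" if "e \<in> C" "e \<noteq> c" for e
          using alt[OF that] that by (auto simp: near_def)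
        have fin: "finite (C - {c})" and ne: "C - {c} \<noteq> {}" using C by auto
        \<comment> \<open>No centre is near, so \<open>x - c\<close> is enlarged towards the
          innermost of the remaining centres.\<close>
        obtain d where d: "d \<in> C - {c}" "\<And>e. e \<in> C - {c} \<Longrightarrow> nm (d - c) \<le> nm (e - c)"
          using arg_min_if_finite[OF fin ne, of "\<lambda>d. nm (d - c)"] by (metis not_le)
        then have dC: "d \<in> C" "d \<noteq> c" by auto
        have "nm (x - c) * real p ^ a \<le> nm (d - c)" using far[OF dC] by (rule sub) (auto simp: W_def)
        then obtain l where l: "nm (x - c) * real p ^ a * (real p ^ N) ^ l \<le> nm (d - c)"
           "nm (d - c) < nm (x - c) * real p ^ a * (real p ^ N) ^ Suc l"
          using exists_scale[OF _ _ q, of "nm (x - c) * real p ^ a" "nm (d - c)"] xc by auto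
        define w :: 'a where "w = inverse (of_nat p ^ l)"
        define z where "z = w ^ N * (x - c)"
        have nw: "nm w ^ N = (real p ^ N) ^ l"
          by (simp add: w_def nm_inverse nm_p_power power_one_over mult.commute power_inverse flip: power_mult)
        have nz: "nm z = nm (x - c) * (real p ^ N) ^ l" by (simp add: z_def nm_mult nm_power nw)
        have 1: "nm z * real p ^ a \<le> nm (d - c)" using l(1) by (simp add: nz mult_ac)
        have 2: "nm (d - c) \<le> nm z * real p ^ W"
          using l(2) by (simp add: nz W_def power_add mult_ac)
        have zx: "nm (x - c) \<le> nm z"
        proof -
          have "(real p ^ N) ^ l \<ge> 1" using q by (simp add: one_le_power)
          then show ?thesis by (simp only: nz) (rule le_mult_ge_1, simp_all)
        qed
        show ?thesis
        proof (rule *[of w d z])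
          fix e assume e: "e \<in> C" "e \<noteq> c"
          have "nm (d - c) \<le> nm (e - c)" using d e by auto
          moreover have "nm (x - c) * real p ^ a \<le> nm z * real p ^ a"
            using zx by (intro mult_right_mono) auto
          ultimately show "nm (x - c) * real p ^ a \<le> nm (e - c) \<and> nm z * real p ^ a \<le> nm (e - c) \<or>
             nm (e - c) * real p ^ a \<le> nm (x - c) \<and> nm (e - c) * real p ^ a \<le> nm z"
            using 1 by linarith
        qed (use dC 1 2 near_le in \<open>auto simp: w_def z_def nm_mult nm_power\<close>)
      qed
    qed
  qed
qed

text \<open>For z in the window, \<open>(z - c) / (d - c)\<close> has norm at most
  \<open>p^W\<close>. Multiplied by \<open>p^W\<close> it becomes integral and can be rounded to a
  natural number below \<open>p^V\<close>.\<close>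

lemma sim_representative:
  "\<exists>W V. \<forall>C x c0 d0. finite C \<longrightarrow> c0 \<in> C \<longrightarrow> d0 \<in> C \<longrightarrow> c0 \<noteq> d0 \<longrightarrow>
     (\<exists>c d u. c \<in> C \<and> d \<in> C \<and> u < p ^ V \<and> sim s C x (c + (d - c) * (of_nat u / of_nat p ^ W)))"
proof -
  obtain T where T: "\<And>C x x'. (\<And>c. c \<in> C \<Longrightarrow> nm (x' - x) * real p ^ T \<le> nm (x - c)) \<Longrightarrow> sim s C x x'"
    using sim_close[of s] by metis
  obtain W where W: "\<And>C x c0 d0. finite C \<Longrightarrow> x \<notin> C \<Longrightarrow> c0 \<in> C \<Longrightarrow> d0 \<in> C \<Longrightarrow> c0 \<noteq> d0 \<Longrightarrow>
     (\<exists>z c d. c \<in> C \<and> d \<in> C \<and> c \<noteq> d \<and> sim s C x z \<and> (\<forall>e\<in>C. nm (z - c) \<le> nm (z - e)) \<and>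
        nm (d - c) \<le> nm (z - c) * real p ^ W \<and> nm (z - c) \<le> nm (d - c) * real p ^ W)"
    using exists_window[of s] by metis
  \<comment> \<open>\<open>T\<close> is the closeness that preserves similarity; one
    \<open>W\<close> pays for the denominator \<open>p^W\<close>, the other for the lower bound of
    \<open>|z - c|\<close> in terms of \<open>|d - c|\<close>.\<close>
  define V where "V = T + W + W"
  show ?thesis
  proof (rule exI[of _ W], rule exI[of _ V], intro allI impI)
    fix C x c0 d0 assume C: "finite C" "c0 \<in> C" "d0 \<in> C" "c0 \<noteq> (d0 :: 'a)"
    show "\<exists>c d u. c \<in> C \<and> d \<in> C \<and> u < p ^ V \<and> sim s C x (c + (d - c) * (of_nat u / of_nat p ^ W))"
    proof (cases "x \<in> C")
      case True
      then show ?thesis by (intro exI[of _ x] exI[of _ 0]) (auto simp: sim_refl)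
    next
      case False
      obtain z c d where z: "c \<in> C" "d \<in> C" "c \<noteq> d" "sim s C x z" "\<And>e. e \<in> C \<Longrightarrow> nm (z - c) \<le> nm (z - e)"
        "nm (d - c) \<le> nm (z - c) * real p ^ W" "nm (z - c) \<le> nm (d - c) * real p ^ W"
        using W[OF C(1) False C(2-4)] by blast
      define \<rho> where "\<rho> = (z - c) / (d - c) * of_nat p ^ W"
      have dc: "nm (d - c) > 0" using z by simp
      have "nm \<rho> \<le> 1" unfolding \<rho>_def using z by (intro nm_scaled_le_1) auto
      then obtain u where u: "u < p ^ V" "nm (\<rho> - of_nat u) \<le> 1 / real p ^ V" using nm_approx by blast
      define x' where "x' = c + (d - c) * (of_nat u / of_nat p ^ W)"
      have "z = c + (d - c) * (\<rho> / of_nat p ^ W)" using z(3) by (simp add: \<rho>_def)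
      then have "x' - z = (d - c) * ((of_nat u - \<rho>) / of_nat p ^ W)"
        by (simp add: x'_def algebra_simps diff_divide_distrib)
      then have "nm (x' - z) = nm (d - c) * (nm (\<rho> - of_nat u) * real p ^ W)"
        by (simp add: nm_mult nm_divide nm_p_power nm_minus_commute[of \<rho>])
      also have "\<dots> \<le> nm (d - c) * (1 / real p ^ V * real p ^ W)"
        using u by (intro mult_left_mono mult_right_mono) auto
      finally have "nm (x' - z) * real p ^ T \<le> nm (d - c) * (1 / real p ^ V * real p ^ W) * real p ^ T"
        by (rule mult_right_mono) simp
      also have "\<dots> = nm (d - c) / real p ^ W" by (simp add: V_def power_add field_simps)
      also have "\<dots> \<le> nm (z - c)" using z(6) by (simp add: field_simps)
      finally have "nm (x' - z) * real p ^ T \<le> nm (z - c)" .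
      then have "sim s C z x'" using z(5) by (intro T) (auto intro: order_trans)
      with z(4) have "sim s C x x'" by (rule sim_trans)
      with z u show ?thesis unfolding x'_def by blast
    qed
  qed
qed

section \<open>Counting similarity classes\<close>

text \<open>A new centre c adds at most one ball, the one whose radius is the distance to the
  nearest old centre c0: a larger ball around c is also the ball around c0 with radius
  \<open>|d - c0|\<close>.\<close>

lemma card_balls:
  "finite C \<Longrightarrow> card {{w. nm (w - c) \<le> nm (d - c)} |c d. c \<in> C \<and> d \<in> C \<and> c \<noteq> d} \<le> card C"
proof (induction rule: finite_induct)
  case (insert c C)
  define B where "B c r = {w. nm (w - c) \<le> r}" for c r
  define Bs where "Bs C = {B c (nm (d - c)) |c d. c \<in> C \<and> d \<in> C \<and> c \<noteq> d}" for C
  have B_eq: "B c r = B c' r" if "nm (c - c') \<le> r" for c c' r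
    using that nm_diff_trans[of _ c r c'] nm_diff_trans[of _ c' r c] nm_minus_commute[of c c']
    by (auto simp: B_def)
  have IH: "card (Bs C) \<le> card C" using insert.IH by (simp add: Bs_def B_def)
  have "card (Bs (insert c C)) \<le> Suc (card C)"
  proof (cases "C = {}")
    case True
    then show ?thesis by (simp add: Bs_def)
  next
    case False
    obtain c0 where c0: "c0 \<in> C" "\<And>d. d \<in> C \<Longrightarrow> nm (c0 - c) \<le> nm (d - c)"
      using arg_min_if_finite[OF insert(1) False, of "\<lambda>d. nm (d - c)"] by (metis not_le)
    have *: "B c (nm (d - c)) \<in> insert (B c (nm (c0 - c))) (Bs C)" if "d \<in> C" for d
    proof (cases "nm (d - c) = nm (c0 - c)")
      case False
      with c0(2)[OF that] have less: "nm (c0 - c) < nm (d - c)" by simp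
      then have "nm (d - c0) = nm (d - c)" using nm_dist_eq[of c0 c d] nm_minus_commute by metis
      moreover have "B c (nm (d - c)) = B c0 (nm (d - c))"
        using less nm_minus_commute[of c c0] by (intro B_eq) simp
      moreover have "d \<noteq> c0" using less by auto
      ultimately have "B c (nm (d - c)) = B c0 (nm (d - c0)) \<and> c0 \<in> C \<and> d \<in> C \<and> c0 \<noteq> d"
        using c0(1) that by simp
      then show ?thesis unfolding Bs_def by blast
    qed simp
    have "Bs (insert c C) \<subseteq> insert (B c (nm (c0 - c))) (Bs C)"
    proof
      fix D assume "D \<in> Bs (insert c C)"
      then obtain e d where ed: "D = B e (nm (d - e))" "e \<in> insert c C" "d \<in> insert c C" "e \<noteq> d"
        by (auto simp: Bs_def)
      consider "e = c" "d \<in> C" | "d = c" "e \<in> C" | "e \<in> C" "d \<in> C" using ed by auto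
      then show "D \<in> insert (B c (nm (c0 - c))) (Bs C)"
      proof cases
        case 1
        then show ?thesis using * ed by simp
      next
        case 2
        then have "D = B c (nm (e - c))" using ed B_eq[of e c "nm (e - c)"] nm_minus_commute[of e c] by simp
        then show ?thesis using * 2 by simp
      next
        case 3
        then show ?thesis using ed by (auto simp: Bs_def)
      qed
    qed
    moreover have "finite (Bs C)"
    proof (rule finite_subset)
      show "Bs C \<subseteq> (\<lambda>(c, d). B c (nm (d - c))) ` (C \<times> C)" by (auto simp: Bs_def)
    qed (use insert(1) in simp)
    ultimately have "card (Bs (insert c C)) \<le> card (insert (B c (nm (c0 - c))) (Bs C))"
      by (intro card_mono) auto
    also have "\<dots> \<le> Suc (card (Bs C))" by (rule card_insert_le_m1) auto
    finally show ?thesis using IH by simp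
  qed
  then show ?case using insert by (simp add: Bs_def B_def)
qed simp

text \<open>A point is encoded by a ball and a residue below \<open>p^V\<close>; an encoding by a
  pair of centres and a residue would only give a quadratic bound. To this end each ball receives
  one fixed pair of centres, \<open>\<gamma> D\<close> and \<open>\<gamma> D + \<delta> D\<close>,
  relative to which points are rounded. Points of \<open>C\<close> are counted separately.\<close>

lemma card_dissimilar:
  "\<exists>K. \<forall>C X c0 d0. finite C \<longrightarrow> c0 \<in> C \<longrightarrow> d0 \<in> C \<longrightarrow> c0 \<noteq> d0 \<longrightarrow>
     (\<forall>x\<in>X. \<forall>x'\<in>X. sim s C x x' \<longrightarrow> x = x') \<longrightarrow> card X \<le> K * card C"
proof -
  obtain T where T: "\<And>C x x'. (\<And>c. c \<in> C \<Longrightarrow> nm (x' - x) * real p ^ T \<le> nm (x - c)) \<Longrightarrow> sim s C x x'"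
    using sim_close[of s] by metis
  obtain W where W: "\<And>C x c0 d0. finite C \<Longrightarrow> x \<notin> C \<Longrightarrow> c0 \<in> C \<Longrightarrow> d0 \<in> C \<Longrightarrow> c0 \<noteq> d0 \<Longrightarrow>
     (\<exists>z c d. c \<in> C \<and> d \<in> C \<and> c \<noteq> d \<and> sim s C x z \<and> (\<forall>e\<in>C. nm (z - c) \<le> nm (z - e)) \<and>
        nm (d - c) \<le> nm (z - c) * real p ^ W \<and> nm (z - c) \<le> nm (d - c) * real p ^ W)"
    using exists_window[of s] by metis
  define V where "V = T + W + W"
  show ?thesis
  proof (rule exI[of _ "1 + p ^ V"], intro allI impI)
    fix C X c0 d0 assume C: "finite C" "c0 \<in> C" "d0 \<in> C" "c0 \<noteq> (d0 :: 'a)"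
      and X: "\<forall>x\<in>X. \<forall>x'\<in>X. sim s C x x' \<longrightarrow> x = x'"
    define B where "B c d = {w. nm (w - c) \<le> nm (d - c)}" for c d
    define Bs where "Bs = {B c d |c d. c \<in> C \<and> d \<in> C \<and> c \<noteq> d}"
    have "\<forall>D. \<exists>cd. D \<in> Bs \<longrightarrow> fst cd \<noteq> snd cd \<and> D = B (fst cd) (snd cd)"
      by (auto simp: Bs_def)
    then obtain cd where cd: "\<And>D. D \<in> Bs \<Longrightarrow> fst (cd D) \<noteq> snd (cd D) \<and> D = B (fst (cd D)) (snd (cd D))"
      by metis
    define \<gamma> where "\<gamma> D = fst (cd D)" for D
    define \<delta> where "\<delta> D = snd (cd D) - fst (cd D)" for D
    \<comment> \<open>A ball determines its radius, as the distance \<open>|d - c|\<close> is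
      attained by two of its points.\<close>
    have radius: "nm (d - c) \<le> nm (d' - c')" if "B c d = B c' d'" for c d c' d'
    proof -
      have "c \<in> B c' d'" "d \<in> B c' d'" unfolding that[symmetric] by (auto simp: B_def)
      then show ?thesis using nm_diff_trans[of d c' _ c] nm_minus_commute[of c c'] by (auto simp: B_def)
    qed
    have "\<forall>x. \<exists>z D u. x \<in> X - C \<longrightarrow> D \<in> Bs \<and> u < p ^ V \<and> sim s C x z \<and>
        (\<forall>e\<in>C. nm (\<delta> D) \<le> nm (z - e) * real p ^ W) \<and>
        nm (z - \<gamma> D - \<delta> D * (of_nat u / of_nat p ^ W)) * real p ^ T \<le> nm (\<delta> D) / real p ^ W"
    proof
      fix x
      show "\<exists>z D u. x \<in> X - C \<longrightarrow> D \<in> Bs \<and> u < p ^ V \<and> sim s C x z \<and>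
        (\<forall>e\<in>C. nm (\<delta> D) \<le> nm (z - e) * real p ^ W) \<and>
        nm (z - \<gamma> D - \<delta> D * (of_nat u / of_nat p ^ W)) * real p ^ T \<le> nm (\<delta> D) / real p ^ W"
      proof (cases "x \<in> X - C")
        case True
        then have "x \<notin> C" by simp
        then obtain z c d where z: "c \<in> C" "d \<in> C" "c \<noteq> d" "sim s C x z" "\<And>e. e \<in> C \<Longrightarrow> nm (z - c) \<le> nm (z - e)"
          "nm (d - c) \<le> nm (z - c) * real p ^ W" "nm (z - c) \<le> nm (d - c) * real p ^ W"
          using W[OF C(1) _ C(2-4)] by blast
        define D where "D = B c d"
        have D: "D \<in> Bs" using z by (auto simp: D_def Bs_def)
        have BD: "B c d = B (fst (cd D)) (snd (cd D))" using cd[OF D] D_def by simp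
        have r: "nm (\<delta> D) = nm (d - c)"
          using radius[OF BD] radius[OF BD[symmetric]] by (simp add: \<delta>_def)
        have "fst (cd D) \<noteq> snd (cd D)" using cd[OF D] by blast
        then have \<delta>0: "nm (\<delta> D) > 0" by (auto simp: \<delta>_def)
        have "c \<in> B (fst (cd D)) (snd (cd D))" unfolding BD[symmetric] by (simp add: B_def)
        then have c\<gamma>: "nm (c - \<gamma> D) \<le> nm (\<delta> D)" by (simp add: B_def \<gamma>_def \<delta>_def)
        also have "\<dots> \<le> nm (\<delta> D) * real p ^ W" by (intro le_mult_ge_1 power_p_ge_1) simp
        finally have "nm (z - \<gamma> D) \<le> nm (\<delta> D) * real p ^ W"
          using z(7) r nm_diff_trans[of z c _ "\<gamma> D"] by simp
        then have "nm ((z - \<gamma> D) / \<delta> D * of_nat p ^ W) \<le> 1"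
          using \<delta>0 by (intro nm_scaled_le_1) auto
        then obtain u where u: "u < p ^ V" "nm ((z - \<gamma> D) / \<delta> D * of_nat p ^ W - of_nat u) \<le> 1 / real p ^ V"
          using nm_approx by blast
        have "z - \<gamma> D - \<delta> D * (of_nat u / of_nat p ^ W) =
            \<delta> D * (((z - \<gamma> D) / \<delta> D * of_nat p ^ W - of_nat u) / of_nat p ^ W)"
          using \<delta>0 by (simp add: field_simps)
        then have "nm (z - \<gamma> D - \<delta> D * (of_nat u / of_nat p ^ W)) =
            nm (\<delta> D) * (nm ((z - \<gamma> D) / \<delta> D * of_nat p ^ W - of_nat u) * real p ^ W)"
          by (simp add: nm_mult nm_divide[of _ "of_nat p ^ W"] nm_p_power)
        also have "\<dots> \<le> nm (\<delta> D) * (1 / real p ^ V * real p ^ W)"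
          using u by (intro mult_left_mono mult_right_mono) auto
        finally have "nm (z - \<gamma> D - \<delta> D * (of_nat u / of_nat p ^ W)) * real p ^ T
            \<le> nm (\<delta> D) * (1 / real p ^ V * real p ^ W) * real p ^ T" by (rule mult_right_mono) simp
        also have "\<dots> = nm (\<delta> D) / real p ^ W" by (simp add: V_def power_add field_simps)
        finally have "nm (z - \<gamma> D - \<delta> D * (of_nat u / of_nat p ^ W)) * real p ^ T \<le> nm (\<delta> D) / real p ^ W" .
        moreover have "nm (\<delta> D) \<le> nm (z - e) * real p ^ W" if "e \<in> C" for e
        proof -
          have "nm (z - c) * real p ^ W \<le> nm (z - e) * real p ^ W"
            by (intro mult_right_mono z that) simp
          with z(6) r show ?thesis by linarith
        qed
        ultimately show ?thesis using D u z(4) by blast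
      next
        case False
        then show ?thesis by blast
      qed
    qed
    then obtain z D u where key: "\<And>x. x \<in> X - C \<Longrightarrow> D x \<in> Bs \<and> u x < p ^ V \<and> sim s C x (z x) \<and>
        (\<forall>e\<in>C. nm (\<delta> (D x)) \<le> nm (z x - e) * real p ^ W) \<and>
        nm (z x - \<gamma> (D x) - \<delta> (D x) * (of_nat (u x) / of_nat p ^ W)) * real p ^ T \<le> nm (\<delta> (D x)) / real p ^ W"
      by metis
    have inj: "inj_on (\<lambda>x. (D x, u x)) (X - C)"
    proof (rule inj_onI)
      fix x x' assume x: "x \<in> X - C" "x' \<in> X - C" and eq: "(D x, u x) = (D x', u x')"
      define r where "r = nm (\<delta> (D x)) / real p ^ W / real p ^ T"
      have "nm (z x - \<gamma> (D x) - \<delta> (D x) * (of_nat (u x) / of_nat p ^ W)) \<le> r"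
        using key[OF x(1)] unfolding r_def by (subst pos_le_divide_eq) auto
      moreover have "nm (z x' - \<gamma> (D x) - \<delta> (D x) * (of_nat (u x) / of_nat p ^ W)) \<le> r"
        using key[OF x(2)] eq unfolding r_def by (subst pos_le_divide_eq) auto
      ultimately have "nm ((z x' - \<gamma> (D x) - \<delta> (D x) * (of_nat (u x) / of_nat p ^ W)) -
          (z x - \<gamma> (D x) - \<delta> (D x) * (of_nat (u x) / of_nat p ^ W))) \<le> r" by (rule nm_diff_le[rotated])
      then have "nm (z x' - z x) \<le> r" by (simp add: algebra_simps)
      then have "nm (z x' - z x) * real p ^ T \<le> nm (\<delta> (D x)) / real p ^ W"
        unfolding r_def by (subst (asm) pos_le_divide_eq) auto
      moreover have "nm (\<delta> (D x)) / real p ^ W \<le> nm (z x - e)" if "e \<in> C" for e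
        using key[OF x(1)] that by (subst pos_divide_le_eq) auto
      ultimately have "sim s C (z x) (z x')" by (intro T) (rule order_trans)
      then have "sim s C x x'" using key[OF x(1)] key[OF x(2)] by (meson sim_sym sim_trans)
      with X x show "x = x'" by auto
    qed
    have fin: "finite Bs"
    proof (rule finite_subset)
      show "Bs \<subseteq> (\<lambda>(c, d). B c d) ` (C \<times> C)" by (auto simp: Bs_def)
    qed (use C in simp)
    have "card (X - C) \<le> card (Bs \<times> {..<p ^ V})"
      using inj fin key by (intro card_inj_on_le[of "\<lambda>x. (D x, u x)"]) auto
    also have "\<dots> = card Bs * p ^ V" by (simp add: card_cartesian_product)
    also have "\<dots> \<le> card C * p ^ V"
      using card_balls[OF C(1)] unfolding Bs_def B_def by (rule mult_le_mono1)
    finally have "card (X - C) \<le> card C * p ^ V" .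
    moreover have "card (X \<inter> C) \<le> card C" using C by (intro card_mono) auto
    moreover have "card X \<le> card (X \<inter> C) + card (X - C)"
      using card_Un_le[of "X \<inter> C" "X - C"] by (simp add: Int_Diff_Un)
    ultimately show "card X \<le> (1 + p ^ V) * card C" by (simp add: algebra_simps)
  qed
qed

end

section \<open>The p-adic absolute value on the rationals\<close>

text \<open>\<open>padic_val\<close> refers to the reduced fraction; cross-multiplication shows that
  every other fraction gives the same value.\<close>

lemma padic_val_Fract:
  assumes p: "prime p" and ab: "a \<noteq> 0" "b \<noteq> (0::int)"
  shows "padic_val p (of_int a / of_int b) = int (multiplicity (int p) a) - int (multiplicity (int p) b)"
proof -
  define q where "q = (of_int a / of_int b :: rat)"
  obtain n d where nd: "quotient_of q = (n, d)" by fastforce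
  have d: "d > 0" using quotient_of_denom_pos[OF nd] .
  have q: "q = of_int n / of_int d" using quotient_of_div[OF nd] .
  have "q \<noteq> 0" using ab by (simp add: q_def)
  then have n: "n \<noteq> 0" using q by auto
  have "(of_int a * of_int d :: rat) = of_int n * of_int b"
    using q ab d unfolding q_def by (simp add: field_simps)
  then have eq: "a * d = n * b" by (simp only: of_int_mult[symmetric] of_int_eq_iff)
  have "prime_elem (int p)" using p by (simp add: prime_int_nat_transfer prime_imp_prime_elem)
  then have "multiplicity (int p) a + multiplicity (int p) d = multiplicity (int p) n + multiplicity (int p) b"
    using arg_cong[OF eq, of "multiplicity (int p)"] ab n d by (simp add: prime_elem_multiplicity_mult_distrib)
  then show ?thesis by (simp add: padic_val_def nd flip: q_def)
qed

context
  fixes p :: nat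
  assumes p: "prime p"
begin

lemma p_gt_1: "real p > 1"
  using prime_gt_1_nat[OF p] by simp

lemma prime_elem_int_p: "prime_elem (int p)"
  using p by (simp add: prime_imp_prime_elem)

lemma padic_abs_0 [simp]: "padic_abs p 0 = 0"
  by (simp add: padic_abs_def)

lemma padic_abs_pos: "q \<noteq> 0 \<Longrightarrow> padic_abs p q > 0"
  using p_gt_1 by (simp add: padic_abs_def)

lemma padic_abs_nonneg [simp]: "padic_abs p q \<ge> 0"
  using padic_abs_pos[of q] by (cases "q = 0") auto

lemma padic_abs_eq_0_iff [simp]: "padic_abs p q = 0 \<longleftrightarrow> q = 0"
  using padic_abs_pos[of q] by (cases "q = 0") auto

lemma rat_cases: obtains a b :: int where "q = of_int a / (of_int b :: rat)" "b \<noteq> 0"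
proof (cases q)
  case (Fract a b)
  then show ?thesis using that[of a b] by (simp add: Fract_of_int_quotient)
qed

lemma padic_abs_mult: "padic_abs p (x * y) = padic_abs p x * padic_abs p y"
proof (cases "x = 0 \<or> y = 0")
  case False
  obtain a b c d :: int where abcd: "x = of_int a / of_int b" "b \<noteq> 0" "y = of_int c / of_int d" "d \<noteq> 0"
    using rat_cases by metis
  with False have "a \<noteq> 0" "c \<noteq> 0" by auto
  have "x * y = of_int (a * c) / of_int (b * d)" using abcd by simp
  then have "padic_val p (x * y) = padic_val p x + padic_val p y"
    using abcd \<open>a \<noteq> 0\<close> \<open>c \<noteq> 0\<close> padic_val_Fract[OF p, of "a * c" "b * d"]
    by (simp add: padic_val_Fract[OF p] prime_elem_multiplicity_mult_distrib[OF prime_elem_int_p] del: of_int_mult)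
  then show ?thesis using False p_gt_1 by (simp add: padic_abs_def flip: power_int_add)
qed auto

lemma padic_abs_of_int_div:
  assumes "b \<noteq> 0"
  shows "padic_abs p (of_int a / of_int b) = padic_abs p (of_int a) / padic_abs p (of_int b)"
proof -
  have "padic_abs p (of_int a / of_int b) * padic_abs p (of_int b) = padic_abs p (of_int a)"
    using assms by (simp flip: padic_abs_mult)
  then show ?thesis using assms by (simp add: field_simps)
qed

lemma padic_abs_of_int_le_iff: "padic_abs p (of_int a) \<le> 1 / real p ^ k \<longleftrightarrow> int p ^ k dvd a"
proof (cases "a = 0")
  case False
  have "padic_abs p (of_int a) = real p powi (- int (multiplicity (int p) a))"
    using False padic_val_Fract[OF p False, of 1] by (simp add: padic_abs_def)
  also have "\<dots> = 1 / real p ^ multiplicity (int p) a"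
    by (simp add: power_int_minus field_simps)
  also have "\<dots> \<le> 1 / real p ^ k \<longleftrightarrow> real p ^ k \<le> real p ^ multiplicity (int p) a"
    using p_gt_1 by (simp add: field_simps)
  also have "\<dots> \<longleftrightarrow> k \<le> multiplicity (int p) a" using p_gt_1 by simp
  also have "\<dots> \<longleftrightarrow> int p ^ k dvd a"
    using False prime_elem_int_p by (subst power_dvd_iff_le_multiplicity) auto
  finally show ?thesis .
qed auto

lemma padic_abs_of_int: "a \<noteq> 0 \<Longrightarrow> \<exists>k. padic_abs p (of_int a) = 1 / real p ^ k"
  using padic_val_Fract[OF p, of a 1]
  by (intro exI[of _ "multiplicity (int p) a"]) (simp add: padic_abs_def power_int_minus field_simps)

lemma padic_abs_add_of_int:
  "padic_abs p (of_int a + of_int b) \<le> max (padic_abs p (of_int a)) (padic_abs p (of_int b))"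
proof (cases "a = 0 \<or> b = 0")
  case False
  then obtain k l where kl: "padic_abs p (of_int a) = 1 / real p ^ k" "padic_abs p (of_int b) = 1 / real p ^ l"
    using padic_abs_of_int by metis
  have "int p ^ min k l dvd int p ^ k" "int p ^ min k l dvd int p ^ l" by (auto intro: le_imp_power_dvd)
  moreover have "int p ^ k dvd a" "int p ^ l dvd b"
    using kl padic_abs_of_int_le_iff[of a k] padic_abs_of_int_le_iff[of b l] by simp_all
  ultimately have "int p ^ min k l dvd a + b" by (meson dvd_add dvd_trans)
  then have "padic_abs p (of_int (a + b)) \<le> 1 / real p ^ min k l" by (simp only: padic_abs_of_int_le_iff)
  also have "\<dots> = max (1 / real p ^ k) (1 / real p ^ l)"
    using p_gt_1 by (auto simp: min_def max_def field_simps)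
  finally show ?thesis by (simp add: kl)
qed auto

lemma padic_abs_add: "padic_abs p (x + y) \<le> max (padic_abs p x) (padic_abs p y)"
proof -
  obtain a b c d :: int where abcd: "x = of_int a / of_int b" "b \<noteq> 0" "y = of_int c / of_int d" "d \<noteq> 0"
    using rat_cases by metis
  define e where "e = b * d"
  have e: "e \<noteq> 0" "x = of_int (a * d) / of_int e" "y = of_int (c * b) / of_int e"
    "x + y = of_int (a * d + c * b) / of_int e"
    using abcd by (auto simp: e_def field_simps)
  have pos: "padic_abs p (of_int e) > 0" using e by (intro padic_abs_pos) simp
  have eqs: "padic_abs p x = padic_abs p (of_int (a * d)) / padic_abs p (of_int e)"
    "padic_abs p y = padic_abs p (of_int (c * b)) / padic_abs p (of_int e)"
    "padic_abs p (x + y) = padic_abs p (of_int (a * d + c * b)) / padic_abs p (of_int e)"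
    by (simp_all only: e(4)) (simp_all only: e(2,3) padic_abs_of_int_div[OF e(1)])
  have "padic_abs p (of_int (a * d + c * b)) \<le> max (padic_abs p (of_int (a * d))) (padic_abs p (of_int (c * b)))"
    using padic_abs_add_of_int[of "a * d" "c * b"] by (simp only: of_int_add)
  then show ?thesis
    unfolding eqs using pos by (auto simp: max_def divide_le_cancel simp del: of_int_mult of_int_add split: if_splits)
qed

lemma padic_abs_1 [simp]: "padic_abs p 1 = 1"
  using padic_abs_mult[of 1 1] padic_abs_eq_0_iff[of 1] by simp

lemma padic_abs_minus [simp]: "padic_abs p (- x) = padic_abs p x"
proof -
  have "(padic_abs p (-1))\<^sup>2 = 1\<^sup>2" using padic_abs_mult[of "-1" "-1"] by (simp add: power2_eq_square)
  then have "padic_abs p (-1) = 1" by (metis padic_abs_nonneg power2_eq_iff_nonneg zero_le_one)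
  then show ?thesis using padic_abs_mult[of "-1" x] by simp
qed

lemma padic_abs_minus_commute: "padic_abs p (x - y) = padic_abs p (y - x)"
  using padic_abs_minus[of "x - y"] by simp

lemma padic_abs_add_less: "padic_abs p x < padic_abs p y \<Longrightarrow> padic_abs p (x + y) = padic_abs p y"
  using padic_abs_add[of x y] padic_abs_add[of "x + y" "- x"] by (auto simp: max_def split: if_splits)

lemma padic_abs_powi: "x \<noteq> 0 \<Longrightarrow> \<exists>k::int. padic_abs p x = real p powi k"
  by (auto simp: padic_abs_def)

lemma padic_abs_inverse: "padic_abs p (inverse x) = inverse (padic_abs p x)"
proof (cases "x = 0")
  case False
  then have "padic_abs p x * padic_abs p (inverse x) = 1" by (simp flip: padic_abs_mult)
  then show ?thesis by (metis inverse_unique)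
qed simp

text \<open>The reduced denominator is prime to \<open>p\<close>, so \<open>u\<close> can be taken
  as the numerator times an inverse of the denominator modulo \<open>p^s\<close>.\<close>

lemma padic_abs_approx:
  assumes "padic_abs p x \<le> 1"
  shows "\<exists>u<p ^ s. padic_abs p (x - of_nat u) \<le> 1 / real p ^ s"
proof -
  obtain a b where ab: "quotient_of x = (a, b)" by fastforce
  have b: "b > 0" and x: "x = of_int a / of_int b" and cop: "coprime a b"
    using quotient_of_denom_pos[OF ab] quotient_of_div[OF ab] quotient_of_coprime[OF ab] by auto
  have nb: "\<not> int p dvd b"
  proof
    assume dvd: "int p dvd b"
    have "\<not> int p dvd a"
    proof
      assume "int p dvd a"
      from coprime_common_divisor[OF cop this dvd] prime_elem_int_p show False by auto
    qed
    then have "padic_abs p (of_int a) > 1 / real p ^ 1" using padic_abs_of_int_le_iff[of a 1] by simp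
    moreover have "padic_abs p (of_int b) \<le> 1 / real p ^ 1" using padic_abs_of_int_le_iff[of b 1] dvd by simp
    moreover have "padic_abs p (of_int a) \<le> padic_abs p (of_int b)"
      using assms b padic_abs_pos[of "of_int b"] unfolding x by (simp add: padic_abs_of_int_div)
    ultimately show False by simp
  qed
  then have "padic_abs p (of_int b) > 1 / real p"
    using padic_abs_of_int_le_iff[of b 1] by simp
  moreover obtain k where k: "padic_abs p (of_int b) = 1 / real p ^ k" using padic_abs_of_int[of b] b by auto
  ultimately have "real p ^ k < real p ^ 1" using p_gt_1 by (simp add: field_simps)
  then have "k = 0" using p_gt_1 by (simp only: power_strict_increasing_iff)
  with k have b1: "padic_abs p (of_int b) = 1" by simp
  have "coprime (int p) b" using nb p by (intro prime_imp_coprime) auto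
  then have "coprime b (int p ^ s)" by (simp add: coprime_commute)
  then obtain c where c: "[b * c = 1] (mod int p ^ s)" using cong_solve_coprime_int by blast
  define u where "u = nat ((a * c) mod int p ^ s)"
  have pos: "int p ^ s > 0" using p prime_gt_0_nat by simp
  have u: "int u = (a * c) mod int p ^ s" using pos by (simp add: u_def)
  then have "int u < int p ^ s" using pos by simp
  then have "u < p ^ s" by (metis of_nat_less_iff of_nat_power)
  have "[int u * b = a * c * b] (mod int p ^ s)" unfolding u by (intro cong_mult) (auto simp: cong_def)
  also have "a * c * b = a * (b * c)" by simp
  also have "[a * (b * c) = a * 1] (mod int p ^ s)" using c by (intro cong_mult cong_refl)
  finally have "int p ^ s dvd a - int u * b" by (simp add: cong_iff_dvd_diff dvd_diff_commute)
  then have "padic_abs p (of_int (a - int u * b)) \<le> 1 / real p ^ s" by (simp only: padic_abs_of_int_le_iff)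
  moreover have "x - of_nat u = of_int (a - int u * b) / of_int b" using b by (simp add: x field_simps)
  ultimately have "padic_abs p (x - of_nat u) \<le> 1 / real p ^ s"
    using b b1 padic_abs_of_int_div[of b "a - int u * b"] by simp
  with \<open>u < p ^ s\<close> show ?thesis by blast
qed

lemma padic_abs_p: "padic_abs p (of_nat p) = 1 / real p"
proof -
  have "multiplicity (int p) (int p) = 1" using prime_elem_int_p by (intro multiplicity_prime) simp
  then have "padic_val p (of_nat p) = 1"
    using padic_val_Fract[OF p, of "int p" 1] p prime_gt_0_nat by simp
  then show ?thesis using p prime_gt_0_nat by (simp add: padic_abs_def power_int_minus field_simps)
qed


section \<open>Cauchy sequences\<close>

lemma padic_Cauchy_const: "(\<lambda>_. q) \<in> padic_Cauchy p"
  by (simp add: padic_Cauchy_def)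

lemma padic_CauchyD: "X \<in> padic_Cauchy p \<Longrightarrow> e > 0 \<Longrightarrow> \<exists>N. \<forall>m\<ge>N. \<forall>n\<ge>N. padic_abs p (X m - X n) < e"
  by (simp add: padic_Cauchy_def)

lemma padic_Cauchy_add:
  assumes "X \<in> padic_Cauchy p" "Y \<in> padic_Cauchy p"
  shows "(\<lambda>n. X n + Y n) \<in> padic_Cauchy p"
  unfolding padic_Cauchy_def
proof (intro CollectI allI impI)
  fix e :: real assume e: "e > 0"
  obtain M N where M: "\<forall>m\<ge>M. \<forall>n\<ge>M. padic_abs p (X m - X n) < e"
    and N: "\<forall>m\<ge>N. \<forall>n\<ge>N. padic_abs p (Y m - Y n) < e"
    using padic_CauchyD[OF assms(1) e] padic_CauchyD[OF assms(2) e] by blast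
  show "\<exists>N. \<forall>m\<ge>N. \<forall>n\<ge>N. padic_abs p (X m + Y m - (X n + Y n)) < e"
  proof (intro exI[of _ "max M N"] allI impI)
    fix m n assume mn: "max M N \<le> m" "max M N \<le> n"
    have "X m + Y m - (X n + Y n) = (X m - X n) + (Y m - Y n)" by simp
    then have "padic_abs p (X m + Y m - (X n + Y n)) \<le> max (padic_abs p (X m - X n)) (padic_abs p (Y m - Y n))"
      by (simp only: padic_abs_add)
    also have "\<dots> < e" using M N mn by simp
    finally show "padic_abs p (X m + Y m - (X n + Y n)) < e" .
  qed
qed

lemma padic_Cauchy_minus: "X \<in> padic_Cauchy p \<Longrightarrow> (\<lambda>n. - X n) \<in> padic_Cauchy p"
proof -
  have "padic_abs p (- X m - - X n) = padic_abs p (X m - X n)" for m n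
    using padic_abs_minus[of "X m - X n"] by (simp add: padic_abs_minus_commute)
  then show "X \<in> padic_Cauchy p \<Longrightarrow> (\<lambda>n. - X n) \<in> padic_Cauchy p" by (simp only: padic_Cauchy_def mem_Collect_eq)
qed

lemma padic_Cauchy_diff: "X \<in> padic_Cauchy p \<Longrightarrow> Y \<in> padic_Cauchy p \<Longrightarrow> (\<lambda>n. X n - Y n) \<in> padic_Cauchy p"
  using padic_Cauchy_add[of X "\<lambda>n. - Y n"] padic_Cauchy_minus[of Y] by simp

lemma padic_Cauchy_bounded:
  assumes "X \<in> padic_Cauchy p"
  obtains b where "b > 0" "\<And>n. padic_abs p (X n) \<le> b"
proof -
  obtain N where N: "\<forall>m\<ge>N. \<forall>n\<ge>N. padic_abs p (X m - X n) < 1"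
    using padic_CauchyD[OF assms, of 1] by auto
  define b where "b = 1 + (\<Sum>n\<le>N. padic_abs p (X n))"
  have le: "padic_abs p (X n) \<le> b" if "n \<le> N" for n
    using member_le_sum[of n "{..N}" "\<lambda>n. padic_abs p (X n)"] that by (simp add: b_def)
  have "b \<ge> 1" by (simp add: b_def sum_nonneg)
  show ?thesis
  proof
    show "b > 0" using \<open>b \<ge> 1\<close> by simp
    show "padic_abs p (X n) \<le> b" for n
    proof (cases "n \<le> N")
      case False
      then have "padic_abs p (X n - X N) < 1" using N by simp
      then show ?thesis using padic_abs_add[of "X n - X N" "X N"] le[of N] \<open>b \<ge> 1\<close> by simp
    qed (rule le)
  qed
qed

lemma padic_Cauchy_mult:
  assumes X: "X \<in> padic_Cauchy p" and Y: "Y \<in> padic_Cauchy p"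
  shows "(\<lambda>n. X n * Y n) \<in> padic_Cauchy p"
  unfolding padic_Cauchy_def
proof (intro CollectI allI impI)
  fix e :: real assume e: "e > 0"
  obtain b where b: "b > 0" "\<And>n. padic_abs p (X n) \<le> b" using padic_Cauchy_bounded[OF X] by blast
  obtain c where c: "c > 0" "\<And>n. padic_abs p (Y n) \<le> c" using padic_Cauchy_bounded[OF Y] by blast
  obtain M N where M: "\<forall>m\<ge>M. \<forall>n\<ge>M. padic_abs p (X m - X n) < e / c"
    and N: "\<forall>m\<ge>N. \<forall>n\<ge>N. padic_abs p (Y m - Y n) < e / b"
    using padic_CauchyD[OF X, of "e / c"] padic_CauchyD[OF Y, of "e / b"] e b c by auto
  show "\<exists>N. \<forall>m\<ge>N. \<forall>n\<ge>N. padic_abs p (X m * Y m - X n * Y n) < e"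
  proof (intro exI[of _ "max M N"] allI impI)
    fix m n assume mn: "max M N \<le> m" "max M N \<le> n"
    have "padic_abs p (X m) * padic_abs p (Y m - Y n) \<le> b * padic_abs p (Y m - Y n)"
      using b by (intro mult_right_mono) auto
    also have "\<dots> < e" using N mn b by (simp add: field_simps)
    finally have 1: "padic_abs p (X m * (Y m - Y n)) < e" by (simp add: padic_abs_mult)
    have "padic_abs p (X m - X n) * padic_abs p (Y n) \<le> padic_abs p (X m - X n) * c"
      using c by (intro mult_left_mono) auto
    also have "\<dots> < e" using M mn c by (simp add: field_simps)
    finally have 2: "padic_abs p ((X m - X n) * Y n) < e" by (simp add: padic_abs_mult)
    have "X m * Y m - X n * Y n = X m * (Y m - Y n) + (X m - X n) * Y n" by (simp add: algebra_simps)
    then show "padic_abs p (X m * Y m - X n * Y n) < e"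
      using padic_abs_add[of "X m * (Y m - Y n)" "(X m - X n) * Y n"] 1 2 by simp
  qed
qed

definition padic_null :: "(nat \<Rightarrow> rat) \<Rightarrow> bool" where
  "padic_null X \<longleftrightarrow> (\<lambda>n. padic_abs p (X n)) \<longlonglongrightarrow> 0"

lemma padic_null_iff: "padic_null X \<longleftrightarrow> (\<forall>e>0. \<exists>N. \<forall>n\<ge>N. padic_abs p (X n) < e)"
  by (simp add: padic_null_def LIMSEQ_iff)

lemma padic_rel_iff: "(X, Y) \<in> padic_rel p \<longleftrightarrow> X \<in> padic_Cauchy p \<and> Y \<in> padic_Cauchy p \<and> padic_null (\<lambda>n. X n - Y n)"
  by (simp add: padic_rel_def padic_null_def)

lemma padic_null_add:
  assumes "padic_null X" "padic_null Y"
  shows "padic_null (\<lambda>n. X n + Y n)"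
  unfolding padic_null_iff
proof (intro allI impI)
  fix e :: real assume "e > 0"
  then obtain M N where "\<forall>n\<ge>M. padic_abs p (X n) < e" "\<forall>n\<ge>N. padic_abs p (Y n) < e"
    using assms unfolding padic_null_iff by metis
  then have "\<forall>n\<ge>max M N. padic_abs p (X n + Y n) < e"
    using padic_abs_add by (metis (no_types) max.bounded_iff max_less_iff_conj order_le_less_trans)
  then show "\<exists>N. \<forall>n\<ge>N. padic_abs p (X n + Y n) < e" ..
qed

lemma padic_null_minus: "padic_null X \<Longrightarrow> padic_null (\<lambda>n. - X n)"
  by (simp add: padic_null_def)

lemma padic_null_mult:
  assumes "padic_null X" "Y \<in> padic_Cauchy p"
  shows "padic_null (\<lambda>n. X n * Y n)"
proof -
  obtain c where c: "c > 0" "\<And>n. padic_abs p (Y n) \<le> c" using padic_Cauchy_bounded[OF assms(2)] by blast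
  have "(\<lambda>n. padic_abs p (X n) * c) \<longlonglongrightarrow> 0 * c"
    using assms(1) unfolding padic_null_def by (intro tendsto_intros)
  then have lim: "(\<lambda>n. padic_abs p (X n) * c) \<longlonglongrightarrow> 0" by simp
  show ?thesis unfolding padic_null_def
    by (rule tendsto_sandwich[OF _ _ tendsto_const lim])
       (auto simp: padic_abs_mult intro!: always_eventually mult_left_mono c)
qed

text \<open>Beyond the index where all differences drop below \<open>e\<close> there is a term of
  absolute value at least \<open>e\<close>; by the ultrametric law all terms there have the same
  absolute value.\<close>

lemma padic_Cauchy_eventually:
  assumes X: "X \<in> padic_Cauchy p" and not_null: "\<not> padic_null X"
  obtains k :: int and N where "\<And>n. n \<ge> N \<Longrightarrow> padic_abs p (X n) = real p powi k"
proof -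
  obtain e where e: "e > 0" "\<And>N. \<exists>n\<ge>N. padic_abs p (X n) \<ge> e"
    using not_null unfolding padic_null_iff by (meson not_le)
  obtain N where N: "\<forall>m\<ge>N. \<forall>n\<ge>N. padic_abs p (X m - X n) < e" using padic_CauchyD[OF X e(1)] by blast
  obtain n where n: "n \<ge> N" "padic_abs p (X n) \<ge> e" using e(2) by blast
  then have "X n \<noteq> 0" using e(1) by auto
  then obtain k :: int where k: "padic_abs p (X n) = real p powi k" using padic_abs_powi by blast
  show ?thesis
  proof
    fix m assume "m \<ge> N"
    then have "padic_abs p (X m - X n) < padic_abs p (X n)" using N n by fastforce
    from padic_abs_add_less[OF this] show "padic_abs p (X m) = real p powi k" using k by simp
  qed
qed

text \<open>The absolute values are eventually constant and positive, so only finitely many terms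
  vanish; these have \<open>inverse 0 = 0\<close> and do not affect the class.\<close>

lemma padic_Cauchy_inverse:
  assumes X: "X \<in> padic_Cauchy p" and not_null: "\<not> padic_null X"
  shows "(\<lambda>n. inverse (X n)) \<in> padic_Cauchy p" "padic_null (\<lambda>n. X n * inverse (X n) - 1)"
proof -
  obtain k :: int and N where kN: "\<And>n. n \<ge> N \<Longrightarrow> padic_abs p (X n) = real p powi k"
    using padic_Cauchy_eventually[OF assms] by blast
  define r where "r = real p powi k"
  have r: "r > 0" using p_gt_1 by (simp add: r_def)
  have nz: "X n \<noteq> 0" if "n \<ge> N" for n using kN[OF that] r padic_abs_eq_0_iff[of "X n"] by (auto simp: r_def)
  show "(\<lambda>n. inverse (X n)) \<in> padic_Cauchy p" unfolding padic_Cauchy_def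
  proof (intro CollectI allI impI)
    fix e :: real assume e: "e > 0"
    obtain M where M: "\<forall>m\<ge>M. \<forall>n\<ge>M. padic_abs p (X m - X n) < e * (r * r)"
      using padic_CauchyD[OF X, of "e * (r * r)"] e r by auto
    show "\<exists>N. \<forall>m\<ge>N. \<forall>n\<ge>N. padic_abs p (inverse (X m) - inverse (X n)) < e"
    proof (intro exI[of _ "max M N"] allI impI)
      fix m n assume mn: "max M N \<le> m" "max M N \<le> n"
      have "inverse (X m) - inverse (X n) = (X n - X m) * (inverse (X m) * inverse (X n))"
        using nz mn by (simp add: field_simps)
      then have "padic_abs p (inverse (X m) - inverse (X n)) = padic_abs p (X n - X m) * (inverse r * inverse r)"
        using kN[of m] kN[of n] mn by (simp add: padic_abs_mult padic_abs_inverse r_def)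
      also have "\<dots> < e" using M mn r by (simp add: field_simps)
      finally show "padic_abs p (inverse (X m) - inverse (X n)) < e" .
    qed
  qed
  have "\<forall>n\<ge>N. X n * inverse (X n) - 1 = 0" using nz by simp
  then show "padic_null (\<lambda>n. X n * inverse (X n) - 1)" unfolding padic_null_iff by (metis padic_abs_0)
qed

lemma equiv_padic_rel: "equiv (padic_Cauchy p) (padic_rel p)"
proof (rule equivI)
  show "padic_rel p \<subseteq> padic_Cauchy p \<times> padic_Cauchy p" by (auto simp: padic_rel_iff)
  show "refl_on (padic_Cauchy p) (padic_rel p)"
    by (auto simp: refl_on_def padic_rel_iff padic_null_def)
  show "sym (padic_rel p)"
    using padic_null_minus by (fastforce intro!: symI simp: padic_rel_iff)
  show "trans (padic_rel p)"
  proof (rule transI)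
    fix X Y Z assume XYZ: "(X, Y) \<in> padic_rel p" "(Y, Z) \<in> padic_rel p"
    then have "padic_null (\<lambda>n. (X n - Y n) + (Y n - Z n))"
      by (intro padic_null_add) (auto simp: padic_rel_iff)
    with XYZ show "(X, Z) \<in> padic_rel p" by (simp add: padic_rel_iff)
  qed
qed

definition padic_class :: "(nat \<Rightarrow> rat) \<Rightarrow> padic" where
  "padic_class X = padic_rel p `` {X}"

lemma padic_class_eq_iff:
  "X \<in> padic_Cauchy p \<Longrightarrow> Y \<in> padic_Cauchy p \<Longrightarrow>
     padic_class X = padic_class Y \<longleftrightarrow> padic_null (\<lambda>n. X n - Y n)"
  unfolding padic_class_def using eq_equiv_class_iff[OF equiv_padic_rel] by (simp add: padic_rel_iff)

lemma padic_class_in_Qp: "X \<in> padic_Cauchy p \<Longrightarrow> padic_class X \<in> Qp p"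
  by (simp add: padic_class_def Qp_def quotientI)

lemma Qp_cases: "a \<in> Qp p \<Longrightarrow> \<exists>X\<in>padic_Cauchy p. a = padic_class X"
  by (auto simp: padic_class_def Qp_def quotient_def)

text \<open>\<open>Qp_lift2\<close> is a union over all representatives; when \<open>g\<close>
  respects the relation, all sets in this union are the same class.\<close>

lemma Qp_lift2_class:
  assumes X: "X \<in> padic_Cauchy p" and Y: "Y \<in> padic_Cauchy p"
    and cong: "\<And>X' Y'. (X, X') \<in> padic_rel p \<Longrightarrow> (Y, Y') \<in> padic_rel p \<Longrightarrow>
      ((\<lambda>n. g (X n) (Y n)), (\<lambda>n. g (X' n) (Y' n))) \<in> padic_rel p"
  shows "Qp_lift2 p g (padic_class X) (padic_class Y) = padic_class (\<lambda>n. g (X n) (Y n))"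
proof -
  have "padic_rel p `` {\<lambda>n. g (X' n) (Y' n)} = padic_class (\<lambda>n. g (X n) (Y n))"
    if "X' \<in> padic_class X" "Y' \<in> padic_class Y" for X' Y'
    using equiv_class_eq[OF equiv_padic_rel cong[of X' Y']] that by (simp add: padic_class_def)
  moreover have "X \<in> padic_class X" "Y \<in> padic_class Y"
    using X Y by (auto simp: padic_class_def padic_rel_iff padic_null_def)
  ultimately show ?thesis unfolding Qp_lift2_def by blast
qed

lemma Qp_add_class:
  assumes "X \<in> padic_Cauchy p" "Y \<in> padic_Cauchy p"
  shows "Qp_lift2 p (+) (padic_class X) (padic_class Y) = padic_class (\<lambda>n. X n + Y n)"
proof (rule Qp_lift2_class[OF assms])
  fix X' Y' assume "(X, X') \<in> padic_rel p" "(Y, Y') \<in> padic_rel p"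
  then show "(\<lambda>n. X n + Y n, \<lambda>n. X' n + Y' n) \<in> padic_rel p"
    using padic_null_add[of "\<lambda>n. X n - X' n" "\<lambda>n. Y n - Y' n"]
    by (auto simp: padic_rel_iff padic_Cauchy_add algebra_simps)
qed

lemma Qp_diff_class:
  assumes "X \<in> padic_Cauchy p" "Y \<in> padic_Cauchy p"
  shows "Qp_lift2 p (-) (padic_class X) (padic_class Y) = padic_class (\<lambda>n. X n - Y n)"
proof (rule Qp_lift2_class[OF assms])
  fix X' Y' assume "(X, X') \<in> padic_rel p" "(Y, Y') \<in> padic_rel p"
  then show "(\<lambda>n. X n - Y n, \<lambda>n. X' n - Y' n) \<in> padic_rel p"
    using padic_null_add[of "\<lambda>n. X n - X' n" "\<lambda>n. - (Y n - Y' n)"] padic_null_minus[of "\<lambda>n. Y n - Y' n"]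
    by (auto simp: padic_rel_iff padic_Cauchy_diff algebra_simps)
qed

lemma Qp_mult_class:
  assumes "X \<in> padic_Cauchy p" "Y \<in> padic_Cauchy p"
  shows "Qp_lift2 p (*) (padic_class X) (padic_class Y) = padic_class (\<lambda>n. X n * Y n)"
proof (rule Qp_lift2_class[OF assms])
  fix X' Y' assume r: "(X, X') \<in> padic_rel p" "(Y, Y') \<in> padic_rel p"
  then have "padic_null (\<lambda>n. (X n - X' n) * Y n + (Y n - Y' n) * X' n)"
    by (intro padic_null_add padic_null_mult) (auto simp: padic_rel_iff)
  moreover have "(X n - X' n) * Y n + (Y n - Y' n) * X' n = X n * Y n - X' n * Y' n" for n
    by (simp add: algebra_simps)
  ultimately show "(\<lambda>n. X n * Y n, \<lambda>n. X' n * Y' n) \<in> padic_rel p"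
    using r by (simp add: padic_rel_iff padic_Cauchy_mult)
qed

lemma Qp_of_rat_class: "Qp_of_rat p q = padic_class (\<lambda>_. q)"
  by (simp add: Qp_of_rat_def padic_class_def)

end

section \<open>Transfer to models of the theory of p-adic fields\<close>

definition field_struct :: "('f fsym, 'r rsym, 'a::field) struct" where
  "field_struct = \<lparr>univ = UNIV,
     fun_int = (\<lambda>f as. case f of
         Zero \<Rightarrow> 0
       | One \<Rightarrow> 1
       | Add \<Rightarrow> as ! 0 + as ! 1
       | Sub \<Rightarrow> as ! 0 - as ! 1
       | Mul \<Rightarrow> as ! 0 * as ! 1
       | OtherF _ \<Rightarrow> 0),
     rel_int = (\<lambda>r as. case r of Pow n \<Rightarrow> (\<exists>b. as ! 0 = b ^ n) | OtherR _ \<Rightarrow> False)\<rparr>"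

lemma univ_field_struct [simp]: "univ field_struct = UNIV"
  by (simp add: field_struct_def)

lemma fun_int_field_struct [simp]:
  "fun_int field_struct Zero as = 0" "fun_int field_struct One as = 1"
  "fun_int field_struct Add as = as ! 0 + as ! 1" "fun_int field_struct Sub as = as ! 0 - as ! 1"
  "fun_int field_struct Mul as = as ! 0 * as ! 1"
  by (simp_all add: field_struct_def)

lemma rel_int_field_struct [simp]: "rel_int field_struct (Pow n) as \<longleftrightarrow> (\<exists>b. as ! 0 = b ^ n)"
  by (simp add: field_struct_def)

lemma tm_val_numT_powT [simp]:
  fixes F :: "('f fsym, 'r rsym, 'a::field) struct"
  defines "F \<equiv> field_struct"
  shows "tm_val F e (numT n) = of_nat n" "tm_val F e (powT t n) = tm_val F e t ^ n"
proof -
  show "tm_val F e (numT n) = of_nat n" by (induction n) (auto simp: F_def)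
  show "tm_val F e (powT t n) = tm_val F e t ^ n" by (induction n) (auto simp: F_def)
qed

lemma tuples_field_struct [simp]: "a \<in> tuples field_struct n \<longleftrightarrow> length a = n"
  by (simp add: tuples_def)

text \<open>The degree bound precedes the environment: the coefficients vary with the parameters,
  but the number of centres must not.\<close>

lemma term_is_poly:
  assumes "tm_in (Lp :: ('f fsym, 'r rsym) language) t"
  shows "\<exists>D. \<forall>e. \<exists>f. degree f \<le> D \<and>
    (\<forall>x. tm_val (field_struct :: ('f fsym, 'r rsym, 'a::field) struct) (e(0 := x)) t = poly f x)"
  using assms
proof (induction t)
  case (Var i)
  have "\<exists>f. degree f \<le> 1 \<and> (\<forall>x. (e(0 := x)) i = poly f x)" for e :: "nat \<Rightarrow> 'a"
    by (cases "i = 0") (auto intro: exI[of _ "[:0, 1:]"] exI[of _ "[:e i:]"])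
  then show ?case by (intro exI[of _ 1]) simp
next
  case (Fn f ts)
  let ?val = "tm_val (field_struct :: ('f fsym, 'r rsym, 'a) struct)"
  have f: "f \<in> {Zero, One, Add, Sub, Mul}" "length ts = (if f \<in> {Zero, One} then 0 else 2)"
    and ts: "\<And>t. t \<in> set ts \<Longrightarrow> tm_in (Lp :: ('f fsym, 'r rsym) language) t"
    using Fn.prems by (auto simp: Lp_def tm_in.simps(2) list_all_iff)
  show ?case
  proof (cases "f \<in> {Zero, One}")
    case True
    then have "?val e (Fn f ts) = poly [:if f = Zero then 0 else 1:] x" for e x by auto
    then show ?thesis by (intro exI[of _ 0]) (metis degree_pCons_0 order_refl)
  next
    case False
    then obtain s t where st: "ts = [s, t]" using f by (auto simp: length_Suc_conv numeral_2_eq_2)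
    have "\<exists>D. \<forall>e. \<exists>g. degree g \<le> D \<and> (\<forall>x. ?val (e(0 := x)) s = poly g x)"
      by (rule Fn.IH) (use ts st in auto)
    then obtain D where D: "\<And>e. \<exists>g. degree g \<le> D \<and> (\<forall>x. ?val (e(0 := x)) s = poly g x)" by blast
    have "\<exists>D. \<forall>e. \<exists>g. degree g \<le> D \<and> (\<forall>x. ?val (e(0 := x)) t = poly g x)"
      by (rule Fn.IH) (use ts st in auto)
    then obtain D' where D': "\<And>e. \<exists>g. degree g \<le> D' \<and> (\<forall>x. ?val (e(0 := x)) t = poly g x)" by blast
    show ?thesis
    proof (intro exI[of _ "D + D'"] allI)
      fix e
      obtain g h where g: "degree g \<le> D" "\<And>x. ?val (e(0 := x)) s = poly g x"
        and h: "degree h \<le> D'" "\<And>x. ?val (e(0 := x)) t = poly h x" using D[of e] D'[of e] by metis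
      define k where "k = (if f = Add then g + h else if f = Sub then g - h else g * h)"
      have "degree k \<le> D + D'"
        using degree_add_le[of g "D + D'" h] degree_diff_le[of g "D + D'" h] degree_mult_le[of g h] g h
        by (auto simp: k_def)
      moreover have "?val (e(0 := x)) (Fn f ts) = poly k x" for x
        using f False by (auto simp: k_def st g h)
      ultimately show "\<exists>f'. degree f' \<le> D + D' \<and> (\<forall>x. ?val (e(0 := x)) (Fn f ts) = poly f' x)" by blast
    qed
  qed
qed

section \<open>Meaning and truth of the similarity formulas in a p-adic field\<close>

context padic_field begin

lemma le_iff_ex: "(\<exists>y. y * y + y * b = of_nat p * (a * a)) \<longleftrightarrow> nm a \<le> nm b"
proof
  assume "\<exists>y. y * y + y * b = of_nat p * (a * a)"
  then obtain y where y: "y * y + y * b = of_nat p * (a * a)" ..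
  show "nm a \<le> nm b"
  proof (rule ccontr)
    assume "\<not> nm a \<le> nm b"
    then have ba: "nm b < nm a" by simp
    then have a: "a \<noteq> 0" using nm_nonneg[of b] by fastforce
    have n: "nm (y * y + y * b) * real p = nm a * nm a"
      by (simp add: y nm_mult nm_p)
    show False
    proof (cases "nm b < nm y")
      case True
      then have "y \<noteq> 0" using nm_nonneg[of b] by fastforce
      with True have "nm (y * b) < nm (y * y)" by (simp add: nm_mult mult_strict_left_mono)
      then have "nm (y * y + y * b) = nm y * nm y" using nm_add_less[of "y * b" "y * y"] by (simp add: add.commute nm_mult)
      with n have eq: "nm y * nm y * real p = nm a * nm a" by simp
      obtain k l :: int where kl: "nm y = real p powi k" "nm a = real p powi l" using nm_powi a \<open>y \<noteq> 0\<close> by metis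
      have add: "real p powi (i + j) = real p powi i * real p powi j" for i j :: int
        by (rule power_int_add) simp
      have "real p powi (k + k + 1) = real p powi (l + l)"
        using eq by (simp only: kl add power_int_1_right)
      then have "k + k + 1 = l + l"
        using power_int_strict_increasing[of _ _ "real p"] p_gt_1 by (metis linorder_less_linear order_less_irrefl)
      then show False by presburger
    next
      case False
      \<comment> \<open>Here \<open>|a|^2 \<le> p |b|^2\<close>, while \<open>|b| < |a|\<close>
        means \<open>p |b| \<le> |a|\<close> by discreteness, whence
        \<open>|a|^2 \<le> |a| |b|\<close>.\<close>
      then have "nm (y * y) \<le> nm b * nm b" "nm (y * b) \<le> nm b * nm b"
        by (simp_all add: nm_mult mult_mono mult_right_mono)
      then have "nm (y * y + y * b) \<le> nm b * nm b" by (rule nm_add_le)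
      then have "nm a * nm a \<le> nm b * nm b * real p" using n[symmetric] by (simp add: mult_right_mono)
      also have "\<dots> = nm b * (nm b * real p)" by simp
      also have "\<dots> \<le> nm b * nm a" using nm_less_imp[OF ba] by (intro mult_left_mono) auto
      also have "\<dots> < nm a * nm a" using ba a by (intro mult_strict_right_mono) auto
      finally show False by simp
    qed
  qed
next
  assume le: "nm a \<le> nm b"
  show "\<exists>y. y * y + y * b = of_nat p * (a * a)"
  proof (cases "b = 0")
    case True
    then show ?thesis using le by auto
  next
    case False
    define t where "t = a / b"
    have t: "nm t \<le> 1" using le False by (simp add: t_def nm_divide)
    define f where "f = [:- (of_nat p * (t * t)), 1, 1:]"
    have pt: "nm (of_nat p * (t * t)) \<le> 1 / real p"
      using mult_mono[OF t t] by (simp add: nm_mult nm_p divide_right_mono)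
    also have "\<dots> < 1" using p_gt_1 by simp
    finally have lt: "nm (of_nat p * (t * t)) < 1" .
    have "nm (coeff f i) \<le> 1" for i
      using lt by (auto simp: f_def coeff_pCons split: nat.splits)
    moreover have "nm (poly f 0) < (nm (poly (pderiv f) 0))\<^sup>2" using lt by (simp add: f_def pderiv_pCons)
    ultimately obtain u where "poly f u = 0" using hensel by blast
    then have u: "u * u + u = of_nat p * (t * t)" by (simp add: f_def algebra_simps)
    have "(u * b) * (u * b) + (u * b) * b = (u * u + u) * (b * b)" by (simp add: algebra_simps)
    also have "\<dots> = of_nat p * (a * a)" using False by (simp add: u t_def)
    finally show ?thesis by blast
  qed
qed

lemma sat_leF:
  assumes "i \<notin> tm_vars s" "i \<notin> tm_vars t"
  shows "sat (field_struct :: ('f fsym, 'r rsym, 'a) struct) e (leF p i s t) \<longleftrightarrow>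
    nm (tm_val (field_struct :: ('f fsym, 'r rsym, 'a) struct) e s) \<le> nm (tm_val (field_struct :: ('f fsym, 'r rsym, 'a) struct) e t)"
proof -
  let ?F = "field_struct :: ('f fsym, 'r rsym, 'a) struct"
  have "tm_val ?F (e(i := u)) s = tm_val ?F e s" "tm_val ?F (e(i := u)) t = tm_val ?F e t" for u
    by (rule tm_val_cong; use assms in auto)+
  then show ?thesis by (simp add: leF_def le_iff_ex)
qed

lemma sat_pclF:
  assumes "i \<notin> tm_vars s" "i \<notin> tm_vars t"
  shows "sat (field_struct :: ('f fsym, 'r rsym, 'a) struct) e (pclF i n s t) \<longleftrightarrow>
    pcl n (tm_val (field_struct :: ('f fsym, 'r rsym, 'a) struct) e s) (tm_val (field_struct :: ('f fsym, 'r rsym, 'a) struct) e t)"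
proof -
  let ?F = "field_struct :: ('f fsym, 'r rsym, 'a) struct"
  have "tm_val ?F (e(i := u)) s = tm_val ?F e s" "tm_val ?F (e(i := u)) t = tm_val ?F e t" for u
    by (rule tm_val_cong; use assms in auto)+
  then show ?thesis by (simp add: pclF_def pcl_def)
qed

lemma tm_vars_powT_notin: "i \<notin> tm_vars t \<Longrightarrow> i \<notin> tm_vars (powT t n)"
  using tm_vars_powT[of t n] by auto

lemma simM_field_struct: "simM (field_struct :: ('f fsym, 'r rsym, 'a) struct) p s C x x' \<longleftrightarrow> sim s C x x'"
proof -
  have "holds (field_struct :: ('f fsym, 'r rsym, 'a) struct) (sim1F p s) [x, x', c, d] \<longleftrightarrow> sim1 s x x' c d" for c d
  proof -
    have *: "nm (of_nat p ^ j * u) = nm u / real p ^ j" for j u by (simp add: nm_mult nm_p_power)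
    show ?thesis
      unfolding holds_sim1F
      by (simp add: holds_list_env sat_leF sat_pclF tm_vars_powT_notin sim1_def * Ball_def
          pos_le_divide_eq pos_divide_le_eq)
  qed
  then show ?thesis by (simp add: simM_def sim_def)
qed

text \<open>An equation says that a polynomial in x vanishes, and \<open>Pow n\<close> that its
  value is an nth power; both are invariant under \<open>pcl\<close>, with exponent 1 for equations.
  A conjunction takes the union of the centres and the maximum of the precisions.\<close>

lemma qf_centres:
  assumes "fm_in (Lp :: ('f fsym, 'r rsym) language) \<psi>" "quantifier_free \<psi>"
  shows "\<exists>s k. \<forall>e. \<exists>C. finite C \<and> card C \<le> k \<and> (\<forall>x x'. sim s C x x' \<longrightarrow>
    (sat (field_struct :: ('f fsym, 'r rsym, 'a) struct) (e(0 := x)) \<psi> \<longleftrightarrow>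
     sat (field_struct :: ('f fsym, 'r rsym, 'a) struct) (e(0 := x')) \<psi>))"
  using assms
proof (induction \<psi>)
  case (Eq t u)
  let ?val = "tm_val (field_struct :: ('f fsym, 'r rsym, 'a) struct)"
  have "tm_in (Lp :: ('f fsym, 'r rsym) language) (subT t u)" using Eq.prems by simp
  then obtain D where D: "\<And>e. \<exists>f. degree f \<le> D \<and> (\<forall>x. ?val (e(0 := x)) (subT t u) = poly f x)"
    using term_is_poly by blast
  obtain s k where sk: "\<And>f. degree f \<le> D \<Longrightarrow>
      \<exists>C. finite C \<and> card C \<le> k \<and> (\<forall>x x'. sim s C x x' \<longrightarrow> pcl 1 (poly f x) (poly f x'))"
    using exists_centres[of 1 D] by auto
  show ?case
  proof (rule exI[of _ s], rule exI[of _ k], intro allI)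
    fix e
    obtain f where f: "degree f \<le> D" "\<And>x. ?val (e(0 := x)) (subT t u) = poly f x" using D by blast
    obtain C where C: "finite C" "card C \<le> k" "\<And>x x'. sim s C x x' \<Longrightarrow> pcl 1 (poly f x) (poly f x')"
      using sk[OF f(1)] by blast
    have "sat (field_struct :: ('f fsym, 'r rsym, 'a) struct) (e(0 := x)) (Eq t u) \<longleftrightarrow> poly f x = 0" for x
      using f(2)[of x] by auto
    moreover have "poly f x = 0 \<longleftrightarrow> poly f x' = 0" if "sim s C x x'" for x x'
      using C(3)[OF that] by (auto simp: pcl_def)
    ultimately show "\<exists>C. finite C \<and> card C \<le> k \<and> (\<forall>x x'. sim s C x x' \<longrightarrow>
      (sat (field_struct :: ('f fsym, 'r rsym, 'a) struct) (e(0 := x)) (Eq t u) \<longleftrightarrow>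
       sat (field_struct :: ('f fsym, 'r rsym, 'a) struct) (e(0 := x')) (Eq t u)))"
      using C(1,2) by (intro exI[of _ C]) auto
  qed
next
  case (Rel r ts)
  let ?val = "tm_val (field_struct :: ('f fsym, 'r rsym, 'a) struct)"
  obtain n t where n: "r = Pow n" "n > 1" "ts = [t]" "tm_in (Lp :: ('f fsym, 'r rsym) language) t"
    using Rel.prems by (auto simp: Lp_def length_Suc_conv)
  obtain D where D: "\<And>e. \<exists>f. degree f \<le> D \<and> (\<forall>x. ?val (e(0 := x)) t = poly f x)"
    using term_is_poly[OF n(4)] by blast
  obtain s k where sk: "\<And>f. degree f \<le> D \<Longrightarrow>
      \<exists>C. finite C \<and> card C \<le> k \<and> (\<forall>x x'. sim s C x x' \<longrightarrow> pcl n (poly f x) (poly f x'))"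
    using exists_centres[of n D] n by auto
  show ?case
  proof (rule exI[of _ s], rule exI[of _ k], intro allI)
    fix e
    obtain f where f: "degree f \<le> D" "\<And>x. ?val (e(0 := x)) t = poly f x" using D by blast
    obtain C where C: "finite C" "card C \<le> k" "\<And>x x'. sim s C x x' \<Longrightarrow> pcl n (poly f x) (poly f x')"
      using sk[OF f(1)] by blast
    have "\<exists>b'. poly f x' = b' ^ n" if "sim s C x x'" "poly f x = b ^ n" for x x' b
      using C(3)[OF that(1)] that(2) by (auto simp: pcl_def simp flip: power_mult_distrib)
    then have "(\<exists>b. poly f x = b ^ n) \<longleftrightarrow> (\<exists>b. poly f x' = b ^ n)" if "sim s C x x'" for x x'
      using that sim_sym[OF that] by blast
    then show "\<exists>C. finite C \<and> card C \<le> k \<and> (\<forall>x x'. sim s C x x' \<longrightarrow>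
      (sat (field_struct :: ('f fsym, 'r rsym, 'a) struct) (e(0 := x)) (Rel r ts) \<longleftrightarrow>
       sat (field_struct :: ('f fsym, 'r rsym, 'a) struct) (e(0 := x')) (Rel r ts)))"
      using C(1,2) by (intro exI[of _ C]) (auto simp: n f)
  qed
next
  case (Neg \<psi>)
  then show ?case by simp
next
  case (Conj \<phi> \<psi>)
  let ?sat = "sat (field_struct :: ('f fsym, 'r rsym, 'a) struct)"
  obtain s k where 1: "\<And>e. \<exists>C. finite C \<and> card C \<le> k \<and> (\<forall>x x'. sim s C x x' \<longrightarrow>
      (?sat (e(0 := x)) \<phi> \<longleftrightarrow> ?sat (e(0 := x')) \<phi>))"
    using Conj.IH(1) Conj.prems unfolding fm_in.simps quantifier_free.simps by blast
  obtain s' k' where 2: "\<And>e. \<exists>C. finite C \<and> card C \<le> k' \<and> (\<forall>x x'. sim s' C x x' \<longrightarrow>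
      (?sat (e(0 := x)) \<psi> \<longleftrightarrow> ?sat (e(0 := x')) \<psi>))"
    using Conj.IH(2) Conj.prems unfolding fm_in.simps quantifier_free.simps by blast
  show ?case
  proof (rule exI[of _ "max s s'"], rule exI[of _ "k + k'"], intro allI)
    fix e
    obtain C where C: "finite C" "card C \<le> k" "\<And>x x'. sim s C x x' \<Longrightarrow> ?sat (e(0 := x)) \<phi> \<longleftrightarrow> ?sat (e(0 := x')) \<phi>"
      using 1[of e] by blast
    obtain C' where C': "finite C'" "card C' \<le> k'" "\<And>x x'. sim s' C' x x' \<Longrightarrow> ?sat (e(0 := x)) \<psi> \<longleftrightarrow> ?sat (e(0 := x')) \<psi>"
      using 2[of e] by blast
    have "sim s C x x'" "sim s' C' x x'" if "sim (max s s') (C \<union> C') x x'" for x x'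
      by (rule sim_mono[OF that]; simp)+
    moreover have "card (C \<union> C') \<le> k + k'" using C C' card_Un_le[of C C'] by linarith
    ultimately show "\<exists>C. finite C \<and> card C \<le> k + k' \<and> (\<forall>x x'. sim (max s s') C x x' \<longrightarrow>
        (?sat (e(0 := x)) (Conj \<phi> \<psi>) \<longleftrightarrow> ?sat (e(0 := x')) (Conj \<phi> \<psi>)))"
      using C C' by (intro exI[of _ "C \<union> C'"]) (simp del: fun_upd_apply, blast)
  qed
next
  case (Ex i \<psi>)
  then show ?case by simp
qed

lemma qf_goodF:
  assumes \<psi>: "\<psi> \<in> formulas (Lp :: ('f fsym, 'r rsym) language) (Suc n)" "quantifier_free \<psi>"
  shows "\<exists>K\<ge>2. holds (field_struct :: ('f fsym, 'r rsym, 'a) struct) (Alls 0 n (goodF p \<psi> n K)) []"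
proof -
  let ?F = "field_struct :: ('f fsym, 'r rsym, 'a) struct"
  obtain s k where sk: "\<And>e. \<exists>C. finite C \<and> card C \<le> k \<and> (\<forall>x x'. sim s C x x' \<longrightarrow>
      (sat ?F (e(0 := x)) \<psi> \<longleftrightarrow> sat ?F (e(0 := x')) \<psi>))"
    using qf_centres[of \<psi>] \<psi> unfolding formulas_def by blast
  define K where "K = s + k + 2"
  have "holds ?F (goodF p \<psi> n K) b" if b: "length b = n" for b
  proof -
    obtain C where C: "finite C" "card C \<le> k" "\<And>x x'. sim s C x x' \<Longrightarrow>
        sat ?F ((list_env (undefined # b))(0 := x)) \<psi> \<longleftrightarrow> sat ?F ((list_env (undefined # b))(0 := x')) \<psi>"
      using sk[of "list_env (undefined # b)"] by blast
    have env: "(list_env (undefined # b))(0 := x) = list_env (x # b)" for x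
      by (auto simp: fun_eq_iff list_env_def nth_Cons split: nat.splits)
    obtain l where l: "set l = C" "length l = card C" using finite_distinct_list[OF C(1)] distinct_card by metis
    \<comment> \<open>0 and 1 come first as two distinct centres, and zeros fill the list up to the
      length \<open>K\<close>, which must not depend on \<open>b\<close>.\<close>
    define c where "c = 0 # 1 # l @ replicate (s + k - card C) 0"
    have c: "length c = K" "C \<subseteq> set c" "c ! 0 \<noteq> c ! 1" using l C by (auto simp: c_def K_def)
    have "holds ?F \<psi> (x # b) \<longleftrightarrow> holds ?F \<psi> (x' # b)" if "simM ?F p K (set c) x x'" for x x'
    proof -
      have "sim s C x x'"
        using that unfolding simM_field_struct by (rule sim_mono) (use c in \<open>auto simp: K_def\<close>)
      then show ?thesis using C(3) by (simp add: env holds_list_env)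
    qed
    then show ?thesis using c b \<psi>
      by (subst holds_goodF[of _ Lp]) (auto simp: K_def intro!: exI[of _ c])
  qed
  then show ?thesis by (intro exI[of _ K]) (simp add: holds_Alls K_def)
qed

lemma holds_representF_field_struct:
  "\<exists>W V. \<forall>K\<ge>2. holds (field_struct :: ('f fsym, 'r rsym, 'a) struct) (representF p s W V K) []"
proof -
  let ?F = "field_struct :: ('f fsym, 'r rsym, 'a) struct"
  obtain W V where WV: "\<And>C x c0 d0. finite C \<Longrightarrow> c0 \<in> C \<Longrightarrow> d0 \<in> C \<Longrightarrow> c0 \<noteq> d0 \<Longrightarrow>
     (\<exists>c d u. c \<in> C \<and> d \<in> C \<and> u < p ^ V \<and> sim s C x (c + (d - c) * (of_nat u / of_nat p ^ W)))"
    using sim_representative[of s] by metis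
  have point: "holds ?F (pointF p W u) [c, d, x'] \<longleftrightarrow> x' = c + (d - c) * (of_nat u / of_nat p ^ W)" for u c d x'
    by (auto simp: pointF_def field_simps)
  show ?thesis
  proof (rule exI[of _ W], rule exI[of _ V], intro allI impI)
    fix K :: nat assume K: "K \<ge> 2"
    show "holds ?F (representF p s W V K) []"
      unfolding holds_representF[OF K]
    proof (intro ballI impI)
      fix c x assume c: "c \<in> tuples ?F K" "c ! 0 \<noteq> c ! 1"
      then have "c ! 0 \<in> set c" "c ! 1 \<in> set c" using K by auto
      then show "\<exists>a\<in>set c. \<exists>d\<in>set c. \<exists>u<p ^ V. \<forall>x'\<in>univ ?F. holds ?F (pointF p W u) [a, d, x'] \<longrightarrow> simM ?F p s (set c) x x'"
        using WV[of "set c" "c ! 0" "c ! 1" x] c(2) unfolding point simM_field_struct by (metis finite_set)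
    qed
  qed
qed

lemma holds_pointF_field_struct:
  "holds (field_struct :: ('f fsym, 'r rsym, 'a) struct) (Alls 0 2 (Ex 2 (pointF p W u))) []"
proof -
  let ?F = "field_struct :: ('f fsym, 'r rsym, 'a) struct"
  have "\<exists>x'. holds ?F (pointF p W u) (a @ [x'])" if a: "length a = 2" for a
  proof -
    obtain c d where "a = [c, d]" using a by (auto simp: length_Suc_conv numeral_2_eq_2)
    then show ?thesis
      by (intro exI[of _ "c + (d - c) * (of_nat u / of_nat p ^ W)"]) (simp add: pointF_def)
  qed
  then show ?thesis by (simp add: holds_Alls holds_Ex)
qed

lemma holds_countF_field_struct:
  "\<exists>k. \<forall>K\<ge>2. holds (field_struct :: ('f fsym, 'r rsym, 'a) struct) (countF p s K (Suc (k * K))) []"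
proof -
  let ?F = "field_struct :: ('f fsym, 'r rsym, 'a) struct"
  obtain k where k: "\<And>C X c0 d0. finite C \<Longrightarrow> c0 \<in> C \<Longrightarrow> d0 \<in> C \<Longrightarrow> c0 \<noteq> d0 \<Longrightarrow>
     (\<And>x x'. x \<in> X \<Longrightarrow> x' \<in> X \<Longrightarrow> sim s C x x' \<Longrightarrow> x = x') \<Longrightarrow> card X \<le> k * card C"
    using card_dissimilar[of s] by metis
  show ?thesis
  proof (rule exI[of _ k], intro allI impI)
    fix K :: nat assume K: "K \<ge> 2"
    show "holds ?F (countF p s K (Suc (k * K))) []"
      unfolding holds_countF[OF K]
    proof (intro ballI impI, rule ccontr)
      fix c xs assume c: "c \<in> tuples ?F K" "c ! 0 \<noteq> c ! 1" and xs: "xs \<in> tuples ?F (Suc (k * K))"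
        and no: "\<not> (\<exists>j<Suc (k * K). \<exists>i<j. simM ?F p s (set c) (xs ! i) (xs ! j))"
      have lxs: "length xs = Suc (k * K)" using xs by simp
      have no': "\<not> sim s (set c) (xs ! i) (xs ! j)" if "i < length xs" "j < length xs" "i \<noteq> j" for i j
        using no that sim_sym[of s "set c" "xs ! i" "xs ! j"] unfolding simM_field_struct lxs
        by (cases i j rule: linorder_cases) auto
      have "distinct xs" unfolding distinct_conv_nth
        using no' sim_refl by metis
      then have "card (set xs) = Suc (k * K)" using lxs by (simp add: distinct_card)
      moreover have "card (set xs) \<le> k * card (set c)"
      proof (rule k[of _ "c ! 0" "c ! 1"])
        show "x = x'" if "x \<in> set xs" "x' \<in> set xs" "sim s (set c) x x'" for x x'
          using that no' by (metis in_set_conv_nth)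
      qed (use c K in auto)
      moreover have "k * card (set c) \<le> k * K" using card_length[of c] c by simp
      ultimately show False by simp
    qed
  qed
qed

end

section \<open>The field of p-adic numbers\<close>

text \<open>All that is taken from the p-adic numbers: centres for quantifier-free formulas, (2)
  together with the existence of the points it mentions, and (3). The constants of (2) and (3) are
  chosen before the number \<open>K\<close> of centres. The first two arguments fix the types of the
  symbols.\<close>

definition padic_facts :: "'f itself \<Rightarrow> 'r itself \<Rightarrow> nat \<Rightarrow> bool" where
  "padic_facts F R p \<longleftrightarrow>
     (\<forall>n \<psi>. \<psi> \<in> formulas (Lp :: ('f fsym, 'r rsym) language) (Suc n) \<and> quantifier_free \<psi> \<longrightarrow>
        (\<exists>K\<ge>2. holds (Qp_struct p) (Alls 0 n (goodF p \<psi> n K)) [])) \<and>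
     (\<forall>s. \<exists>W V. \<forall>K\<ge>2. holds (Qp_struct p :: ('f fsym, 'r rsym, padic) struct) (representF p s W V K) []) \<and>
     (\<forall>W u. holds (Qp_struct p :: ('f fsym, 'r rsym, padic) struct) (Alls 0 2 (Ex 2 (pointF p W u))) []) \<and>
     (\<forall>s. \<exists>k. \<forall>K\<ge>2. holds (Qp_struct p :: ('f fsym, 'r rsym, padic) struct) (countF p s K (Suc (k * K))) [])"

text \<open>
  To prove \<open>padic_facts\<close> for all primes with \<open>\<rat>\<^sub>p\<close> available as a type of class \<open>field\<close>, the type is
  defined for one prime only: a counterexample to \<open>padic_facts\<close>, if there is one.
\<close>

definition the_prime :: "'f itself \<Rightarrow> 'r itself \<Rightarrow> nat" where
  "the_prime F R = (SOME p. prime p \<and> ((\<exists>q. prime q \<and> \<not> padic_facts F R q) \<longrightarrow> \<not> padic_facts F R p))"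

lemma the_prime:
  "prime (the_prime F R)"
  "padic_facts F R (the_prime F R) \<Longrightarrow> prime q \<Longrightarrow> padic_facts F R q"
proof -
  have "\<exists>p. prime p \<and> ((\<exists>q. prime q \<and> \<not> padic_facts F R q) \<longrightarrow> \<not> padic_facts F R p)"
    using two_is_prime_nat by blast
  from someI_ex[OF this]
  show "prime (the_prime F R)" "padic_facts F R (the_prime F R) \<Longrightarrow> prime q \<Longrightarrow> padic_facts F R q"
    unfolding the_prime_def by blast+
qed

section \<open>The p-adic numbers as a type of class \<open>field\<close>\<close>

typedef ('f, 'r) qp = "Qp (the_prime TYPE('f) TYPE('r))"
  using padic_class_in_Qp[OF the_prime(1) padic_Cauchy_const[OF the_prime(1)]] by blast

definition seqs :: "('f, 'r) qp itself \<Rightarrow> (nat \<Rightarrow> rat) set" where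
  "seqs Q = padic_Cauchy (the_prime TYPE('f) TYPE('r))"

definition null :: "('f, 'r) qp itself \<Rightarrow> (nat \<Rightarrow> rat) \<Rightarrow> bool" where
  "null Q = padic_null (the_prime TYPE('f) TYPE('r))"

definition cls :: "(nat \<Rightarrow> rat) \<Rightarrow> ('f, 'r) qp" where
  "cls X = Abs_qp (padic_class (the_prime TYPE('f) TYPE('r)) X)"

lemma Rep_cls:
  "X \<in> seqs TYPE(('f, 'r) qp) \<Longrightarrow> Rep_qp (cls X :: ('f, 'r) qp) = padic_class (the_prime TYPE('f) TYPE('r)) X"
  unfolding cls_def seqs_def by (rule Abs_qp_inverse) (rule padic_class_in_Qp[OF the_prime(1)])

lemma cls_cases:
  obtains X where "X \<in> seqs TYPE(('f, 'r) qp)" "(a :: ('f, 'r) qp) = cls X"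
proof -
  obtain X where "X \<in> seqs TYPE(('f, 'r) qp)" "Rep_qp a = padic_class (the_prime TYPE('f) TYPE('r)) X"
    unfolding seqs_def using Qp_cases[OF the_prime(1) Rep_qp] by blast
  then show ?thesis using that[of X] by (metis Rep_cls Rep_qp_inject)
qed

lemma cls_eq_iff:
  "X \<in> seqs TYPE(('f, 'r) qp) \<Longrightarrow> Y \<in> seqs TYPE(('f, 'r) qp) \<Longrightarrow>
     (cls X :: ('f, 'r) qp) = cls Y \<longleftrightarrow> null TYPE(('f, 'r) qp) (\<lambda>n. X n - Y n)"
proof -
  assume X: "X \<in> seqs TYPE(('f, 'r) qp)" and Y: "Y \<in> seqs TYPE(('f, 'r) qp)"
  have "X \<in> padic_Cauchy (the_prime TYPE('f) TYPE('r))" "Y \<in> padic_Cauchy (the_prime TYPE('f) TYPE('r))"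
    using X Y by (simp_all add: seqs_def)
  from padic_class_eq_iff[OF the_prime(1) this] show ?thesis
    by (simp add: Rep_cls X Y null_def flip: Rep_qp_inject)
qed

lemma seqs_closed:
  fixes Q :: "('f, 'r) qp itself"
  shows "(\<lambda>_. q) \<in> seqs Q"
    "X \<in> seqs Q \<Longrightarrow> (\<lambda>n. - X n) \<in> seqs Q"
    "X \<in> seqs Q \<Longrightarrow> Y \<in> seqs Q \<Longrightarrow> (\<lambda>n. X n + Y n) \<in> seqs Q"
    "X \<in> seqs Q \<Longrightarrow> Y \<in> seqs Q \<Longrightarrow> (\<lambda>n. X n - Y n) \<in> seqs Q"
    "X \<in> seqs Q \<Longrightarrow> Y \<in> seqs Q \<Longrightarrow> (\<lambda>n. X n * Y n) \<in> seqs Q"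
  unfolding seqs_def
  by (intro padic_Cauchy_const padic_Cauchy_minus padic_Cauchy_add padic_Cauchy_diff padic_Cauchy_mult
      the_prime(1); assumption)+

instantiation qp :: (type, type) comm_ring_1
begin

definition "0 = (cls (\<lambda>_. 0) :: ('a, 'b) qp)"
definition "1 = (cls (\<lambda>_. 1) :: ('a, 'b) qp)"
definition "a + b = (Abs_qp (Qp_lift2 (the_prime TYPE('a) TYPE('b)) (+) (Rep_qp a) (Rep_qp b)) :: ('a, 'b) qp)"
definition "a - b = (Abs_qp (Qp_lift2 (the_prime TYPE('a) TYPE('b)) (-) (Rep_qp a) (Rep_qp b)) :: ('a, 'b) qp)"
definition "a * b = (Abs_qp (Qp_lift2 (the_prime TYPE('a) TYPE('b)) (*) (Rep_qp a) (Rep_qp b)) :: ('a, 'b) qp)"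
definition "- a = (0 - a :: ('a, 'b) qp)"

lemma cls_arith:
  assumes "X \<in> seqs TYPE(('a, 'b) qp)" "Y \<in> seqs TYPE(('a, 'b) qp)"
  shows "(cls X + cls Y :: ('a, 'b) qp) = cls (\<lambda>n. X n + Y n)"
    "(cls X - cls Y :: ('a, 'b) qp) = cls (\<lambda>n. X n - Y n)"
    "(cls X * cls Y :: ('a, 'b) qp) = cls (\<lambda>n. X n * Y n)"
proof -
  show "(cls X + cls Y :: ('a, 'b) qp) = cls (\<lambda>n. X n + Y n)"
    using assms unfolding plus_qp_def
    by (simp only: Rep_cls) (simp add: cls_def seqs_def Qp_add_class[OF the_prime(1)])
  have diff: "(cls X - cls Y :: ('a, 'b) qp) = cls (\<lambda>n. X n - Y n)"
    if "X \<in> seqs TYPE(('a, 'b) qp)" "Y \<in> seqs TYPE(('a, 'b) qp)" for X Y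
    using that unfolding minus_qp_def
    by (simp only: Rep_cls) (simp add: cls_def seqs_def Qp_diff_class[OF the_prime(1)])
  show "(cls X - cls Y :: ('a, 'b) qp) = cls (\<lambda>n. X n - Y n)" using assms by (rule diff)
  show "(cls X * cls Y :: ('a, 'b) qp) = cls (\<lambda>n. X n * Y n)"
    using assms unfolding times_qp_def
    by (simp only: Rep_cls) (simp add: cls_def seqs_def Qp_mult_class[OF the_prime(1)])
qed

lemma cls_uminus: "X \<in> seqs TYPE(('a, 'b) qp) \<Longrightarrow> (- cls X :: ('a, 'b) qp) = cls (\<lambda>n. - X n)"
  unfolding uminus_qp_def zero_qp_def by (simp add: cls_arith(2) seqs_closed)

lemma cls_zero_neq_one: "(0 :: ('a, 'b) qp) \<noteq> 1"
  by (simp add: zero_qp_def one_qp_def cls_eq_iff seqs_closed null_def padic_null_def[OF the_prime(1)]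
      LIMSEQ_const_iff padic_abs_eq_0_iff[OF the_prime(1)])

instance
proof
  fix a b c :: "('a, 'b) qp"
  obtain X where X: "X \<in> seqs TYPE(('a, 'b) qp)" "a = cls X" by (rule cls_cases)
  obtain Y where Y: "Y \<in> seqs TYPE(('a, 'b) qp)" "b = cls Y" by (rule cls_cases)
  obtain Z where Z: "Z \<in> seqs TYPE(('a, 'b) qp)" "c = cls Z" by (rule cls_cases)
  note simps = X Y Z cls_arith cls_uminus seqs_closed zero_qp_def one_qp_def
  show "a * b * c = a * (b * c)" by (simp add: simps mult.assoc)
  show "a * b = b * a" by (simp add: simps mult.commute)
  show "1 * a = a" by (simp add: simps)
  show "a + b + c = a + (b + c)" by (simp add: simps add.assoc)
  show "a + b = b + a" by (simp add: simps add.commute)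
  show "0 + a = a" by (simp add: simps)
  show "- a + a = 0" by (simp add: simps)
  show "a - b = a + - b" by (simp add: simps)
  show "(a + b) * c = a * c + b * c" by (simp add: simps distrib_right)
  show "(0 :: ('a, 'b) qp) \<noteq> 1" by (rule cls_zero_neq_one)
qed

end

lemma cls_eq_0_iff:
  "X \<in> seqs TYPE(('f, 'r) qp) \<Longrightarrow> (cls X :: ('f, 'r) qp) = 0 \<longleftrightarrow> null TYPE(('f, 'r) qp) X"
  by (simp add: zero_qp_def cls_eq_iff seqs_closed)

lemma qp_inverse_exists: "(a :: ('f, 'r) qp) \<noteq> 0 \<Longrightarrow> \<exists>b. b * a = 1"
proof -
  assume a: "a \<noteq> 0"
  obtain X where X: "X \<in> seqs TYPE(('f, 'r) qp)" "a = cls X" by (rule cls_cases)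
  have nn: "\<not> padic_null (the_prime TYPE('f) TYPE('r)) X" using a X cls_eq_0_iff[OF X(1)] by (simp add: null_def)
  have inv: "(\<lambda>n. inverse (X n)) \<in> seqs TYPE(('f, 'r) qp)"
    "padic_null (the_prime TYPE('f) TYPE('r)) (\<lambda>n. X n * inverse (X n) - 1)"
    using padic_Cauchy_inverse[OF the_prime(1) X(1)[unfolded seqs_def] nn] by (simp_all add: seqs_def)
  have "cls (\<lambda>n. inverse (X n)) * a = 1"
    using inv(2) by (simp add: X cls_arith inv(1) one_qp_def cls_eq_iff seqs_closed(5) seqs_closed(1) null_def mult.commute)
  then show ?thesis ..
qed

instantiation qp :: (type, type) field
begin

definition "inverse a = (if a = 0 then 0 else SOME b :: ('a, 'b) qp. b * a = 1)"
definition "a div b = (a * inverse b :: ('a, 'b) qp)"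

instance
proof
  fix a b :: "('a, 'b) qp"
  show "a \<noteq> 0 \<Longrightarrow> inverse a * a = 1"
    using someI_ex[OF qp_inverse_exists] by (simp add: inverse_qp_def)
  show "a div b = a * inverse b" by (simp add: divide_qp_def)
  show "inverse (0 :: ('a, 'b) qp) = 0" by (simp add: inverse_qp_def)
qed

end

lemma of_nat_qp: "(of_nat n :: ('f, 'r) qp) = cls (\<lambda>_. of_nat n)"
  by (induction n) (simp_all add: zero_qp_def one_qp_def cls_arith seqs_closed(1))

instance qp :: (type, type) field_char_0
proof
  show "inj (of_nat :: nat \<Rightarrow> ('a, 'b) qp)"
  proof (rule injI)
    fix m n assume "(of_nat m :: ('a, 'b) qp) = of_nat n"
    then show "m = n"
      by (simp add: of_nat_qp cls_eq_iff seqs_closed null_def padic_null_def[OF the_prime(1)]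
          LIMSEQ_const_iff padic_abs_eq_0_iff[OF the_prime(1)])
  qed
qed

section \<open>The norm of the p-adic numbers and its completeness\<close>

definition qabs :: "('f, 'r) qp itself \<Rightarrow> rat \<Rightarrow> real" where
  "qabs Q = padic_abs (the_prime TYPE('f) TYPE('r))"

text \<open>The limit is taken along one chosen representative; \<open>qnm_tendsto\<close> removes
  the choice.\<close>

definition qnm :: "('f, 'r) qp \<Rightarrow> real" where
  "qnm a = lim (\<lambda>n. qabs TYPE(('f, 'r) qp) ((SOME X. X \<in> seqs TYPE(('f, 'r) qp) \<and> a = cls X) n))"

text \<open>Along a Cauchy sequence the absolute values tend to 0 or are eventually constant. For
  two representatives they differ by at most the absolute value of the difference, which tends to
  0.\<close>

lemma qnm_tendsto:
  assumes X: "X \<in> seqs TYPE(('f, 'r) qp)"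
  shows "(\<lambda>n. qabs TYPE(('f, 'r) qp) (X n)) \<longlonglongrightarrow> qnm (cls X :: ('f, 'r) qp)"
proof -
  let ?p = "the_prime TYPE('f) TYPE('r)" and ?A = "qabs TYPE(('f, 'r) qp)"
  define Y where "Y = (SOME Y. Y \<in> seqs TYPE(('f, 'r) qp) \<and> (cls X :: ('f, 'r) qp) = cls Y)"
  have Y: "Y \<in> seqs TYPE(('f, 'r) qp)" "(cls X :: ('f, 'r) qp) = cls Y"
    using someI[of "\<lambda>Y. Y \<in> seqs TYPE(('f, 'r) qp) \<and> (cls X :: ('f, 'r) qp) = cls Y", OF conjI[OF X refl]]
    by (auto simp: Y_def)
  have conv: "convergent (\<lambda>n. ?A (X n))" if X': "X \<in> seqs TYPE(('f, 'r) qp)" for X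
  proof (cases "padic_null ?p X")
    case True
    then show ?thesis unfolding padic_null_def[OF the_prime(1)] qabs_def by (rule convergentI)
  next
    case False
    obtain k :: int and N where "\<And>n. n \<ge> N \<Longrightarrow> padic_abs ?p (X n) = real ?p powi k"
      by (rule padic_Cauchy_eventually[OF the_prime(1) X'[unfolded seqs_def] False]) blast
    then have "eventually (\<lambda>n. ?A (X n) = real ?p powi k) sequentially"
      unfolding qabs_def eventually_sequentially by blast
    then show ?thesis by (rule convergentI[OF tendsto_eventually])
  qed
  have lim: "(\<lambda>n. ?A (Y n)) \<longlonglongrightarrow> qnm (cls X :: ('f, 'r) qp)"
    using conv[OF Y(1)] unfolding qnm_def Y_def by (simp add: convergent_LIMSEQ_iff)
  have "padic_null ?p (\<lambda>n. X n - Y n)" using Y X cls_eq_iff[OF X Y(1)] by (simp add: null_def)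
  then have null: "(\<lambda>n. ?A (X n - Y n)) \<longlonglongrightarrow> 0" by (simp add: padic_null_def[OF the_prime(1)] qabs_def)
  have le: "\<bar>?A (X n) - ?A (Y n)\<bar> \<le> ?A (X n - Y n)" for n
  proof -
    have p: "prime ?p" by (rule the_prime)
    have add: "?A (x + y) \<le> ?A x + ?A y" for x y
    proof -
      have "padic_abs ?p (x + y) \<le> max (padic_abs ?p x) (padic_abs ?p y)" by (rule padic_abs_add[OF p])
      also have "\<dots> \<le> padic_abs ?p x + padic_abs ?p y"
        using padic_abs_nonneg[OF p, of x] padic_abs_nonneg[OF p, of y] by simp
      finally show ?thesis by (simp add: qabs_def)
    qed
    show ?thesis
      using add[of "X n - Y n" "Y n"] add[of "Y n - X n" "X n"]
        padic_abs_minus_commute[OF p, of "X n" "Y n"] by (simp add: qabs_def)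
  qed
  have "(\<lambda>n. ?A (X n) - ?A (Y n)) \<longlonglongrightarrow> 0"
    by (rule tendsto_0_le[OF null, of _ 1]) (use le in \<open>auto intro!: always_eventually intro: order_trans[OF le]\<close>)
  from tendsto_add[OF this lim] show ?thesis by simp
qed

lemma qnm_cls_const: "qnm (cls (\<lambda>_. q) :: ('f, 'r) qp) = qabs TYPE(('f, 'r) qp) q"
proof -
  have "(\<lambda>n. qabs TYPE(('f, 'r) qp) q) \<longlonglongrightarrow> qnm (cls (\<lambda>_. q) :: ('f, 'r) qp)"
    by (rule qnm_tendsto[OF seqs_closed(1)])
  then show ?thesis by (simp add: LIMSEQ_const_iff)
qed

lemma qnm_cls_approx:
  assumes X: "X \<in> seqs TYPE(('f, 'r) qp)" and e: "e > 0"
  shows "\<exists>N. \<forall>n\<ge>N. qnm (cls X - cls (\<lambda>_. X n) :: ('f, 'r) qp) < e"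
proof -
  \<comment> \<open>Half of \<open>e\<close>, because a strict inequality becomes weak in the
    limit.\<close>
  obtain N where N: "\<forall>m\<ge>N. \<forall>n\<ge>N. qabs TYPE(('f, 'r) qp) (X m - X n) < e / 2"
    using padic_CauchyD[OF the_prime(1) X[unfolded seqs_def], of "e / 2"] e by (auto simp: qabs_def)
  have "qnm (cls X - cls (\<lambda>_. X n) :: ('f, 'r) qp) \<le> e / 2" if "n \<ge> N" for n
    unfolding cls_arith[OF X seqs_closed(1)]
    by (rule tendsto_upperbound[OF qnm_tendsto[OF seqs_closed(4)[OF X seqs_closed(1)]]])
       (use N that in \<open>auto simp: eventually_sequentially intro!: exI[of _ N] less_imp_le\<close>)
  then show ?thesis using e by (intro exI[of _ N]) fastforce
qed

interpretation qp: padic_field "the_prime TYPE('f) TYPE('r)" "qnm :: ('f, 'r) qp \<Rightarrow> real"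
proof
  let ?p = "the_prime TYPE('f) TYPE('r)" and ?A = "qabs TYPE(('f, 'r) qp)"
  show p: "prime ?p" by (rule the_prime)
  note abs_facts = padic_abs_mult[OF p] padic_abs_add[OF p] padic_abs_p[OF p]
  show eq0: "qnm a = 0 \<longleftrightarrow> a = 0" for a :: "('f, 'r) qp"
  proof -
    obtain X where X: "X \<in> seqs TYPE(('f, 'r) qp)" "a = cls X" by (rule cls_cases)
    have "a = 0 \<longleftrightarrow> (\<lambda>n. ?A (X n)) \<longlonglongrightarrow> 0"
      unfolding X(2) cls_eq_0_iff[OF X(1)] by (simp add: null_def padic_null_def[OF p] qabs_def)
    also have "\<dots> \<longleftrightarrow> qnm a = 0" using qnm_tendsto[OF X(1)] X(2) by (metis LIMSEQ_unique)
    finally show ?thesis by simp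
  qed
  show "qnm (a * b) = qnm a * qnm b" for a b :: "('f, 'r) qp"
  proof -
    obtain X where X: "X \<in> seqs TYPE(('f, 'r) qp)" "a = cls X" by (rule cls_cases)
    obtain Y where Y: "Y \<in> seqs TYPE(('f, 'r) qp)" "b = cls Y" by (rule cls_cases)
    have "(\<lambda>n. ?A (X n * Y n)) \<longlonglongrightarrow> qnm a * qnm b"
      using tendsto_mult[OF qnm_tendsto[OF X(1)] qnm_tendsto[OF Y(1)]] X Y
      by (simp add: qabs_def abs_facts)
    moreover have "(\<lambda>n. ?A (X n * Y n)) \<longlonglongrightarrow> qnm (a * b)"
      using qnm_tendsto[OF seqs_closed(5)[OF X(1) Y(1)]] by (simp add: X Y cls_arith)
    ultimately show ?thesis by (metis LIMSEQ_unique)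
  qed
  show add: "qnm (a + b) \<le> max (qnm a) (qnm b)" for a b :: "('f, 'r) qp"
  proof -
    obtain X where X: "X \<in> seqs TYPE(('f, 'r) qp)" "a = cls X" by (rule cls_cases)
    obtain Y where Y: "Y \<in> seqs TYPE(('f, 'r) qp)" "b = cls Y" by (rule cls_cases)
    have lim: "(\<lambda>n. max (?A (X n)) (?A (Y n))) \<longlonglongrightarrow> max (qnm a) (qnm b)"
      using tendsto_max[OF qnm_tendsto[OF X(1)] qnm_tendsto[OF Y(1)]] X Y by simp
    have "(\<lambda>n. ?A (X n + Y n)) \<longlonglongrightarrow> qnm (a + b)"
      using qnm_tendsto[OF seqs_closed(3)[OF X(1) Y(1)]] by (simp add: X Y cls_arith)
    from LIMSEQ_le[OF this lim] show ?thesis by (simp add: qabs_def abs_facts)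
  qed
  show "\<exists>k::int. qnm a = real ?p powi k" if "a \<noteq> 0" for a :: "('f, 'r) qp"
  proof -
    obtain X where X: "X \<in> seqs TYPE(('f, 'r) qp)" "a = cls X" by (rule cls_cases)
    have "\<not> padic_null ?p X" using that X cls_eq_0_iff[OF X(1)] by (simp add: null_def)
    then obtain k :: int and N where "\<And>n. n \<ge> N \<Longrightarrow> padic_abs ?p (X n) = real ?p powi k"
      using padic_Cauchy_eventually[OF p X(1)[unfolded seqs_def]] by blast
    then have "(\<lambda>n. ?A (X n)) \<longlonglongrightarrow> real ?p powi k"
      by (intro tendsto_eventually) (auto simp: qabs_def eventually_sequentially)
    then show ?thesis using qnm_tendsto[OF X(1)] X(2) by (metis LIMSEQ_unique)
  qed
  show "qnm (of_nat ?p :: ('f, 'r) qp) = 1 / real ?p"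
    by (simp add: of_nat_qp qnm_cls_const qabs_def abs_facts)
  \<comment> \<open>A rational sufficiently close to \<open>a\<close> again has norm at most 1 and
    can be rounded by \<open>padic_abs_approx\<close>.\<close>
  show "\<exists>u<?p ^ s. qnm (a - of_nat u) \<le> 1 / real ?p ^ s" if a: "qnm a \<le> 1" for a :: "('f, 'r) qp" and s
  proof -
    obtain X where X: "X \<in> seqs TYPE(('f, 'r) qp)" "a = cls X" by (rule cls_cases)
    have ps: "1 / real ?p ^ s > 0" "1 / real ?p ^ s \<le> 1"
      using prime_gt_1_nat[OF p] by (auto simp: field_simps)
    obtain n where n: "qnm (a - cls (\<lambda>_. X n)) < 1 / real ?p ^ s"
      using qnm_cls_approx[OF X(1) ps(1)] X(2) by auto
    have neg: "qnm (- b) = qnm b" for b :: "('f, 'r) qp"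
    proof -
      obtain X where X: "X \<in> seqs TYPE(('f, 'r) qp)" "b = cls X" by (rule cls_cases)
      have "(\<lambda>n. ?A (- X n)) \<longlonglongrightarrow> qnm b" using qnm_tendsto[OF X(1)] X(2) by (simp add: qabs_def padic_abs_minus[OF p])
      moreover have "(\<lambda>n. ?A (- X n)) \<longlonglongrightarrow> qnm (- b)"
        using qnm_tendsto[OF seqs_closed(2)[OF X(1)]] X by (simp add: cls_uminus)
      ultimately show ?thesis by (metis LIMSEQ_unique)
    qed
    have "qnm (a - cls (\<lambda>_. X n)) \<le> 1" using n ps by linarith
    then have "qnm (cls (\<lambda>_. X n) :: ('f, 'r) qp) \<le> 1"
      using add[of a "- (a - cls (\<lambda>_. X n))"] neg[of "a - cls (\<lambda>_. X n)"] a by simp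
    then have "padic_abs ?p (X n) \<le> 1" by (simp add: qnm_cls_const qabs_def)
    then obtain u where u: "u < ?p ^ s" "padic_abs ?p (X n - of_nat u) \<le> 1 / real ?p ^ s"
      using padic_abs_approx[OF p] by blast
    then have "qnm (cls (\<lambda>_. X n) - of_nat u :: ('f, 'r) qp) \<le> 1 / real ?p ^ s"
      by (simp add: of_nat_qp cls_arith seqs_closed(1) qnm_cls_const qabs_def)
    then have "qnm (a - of_nat u) \<le> 1 / real ?p ^ s"
      using add[of "a - cls (\<lambda>_. X n)" "cls (\<lambda>_. X n) - of_nat u"] n by simp
    then show ?thesis using u by blast
  qed
  show "\<exists>l. \<forall>e>0. \<exists>N. \<forall>n\<ge>N. qnm (u n - l) < e"
    if u: "\<And>e. e > 0 \<Longrightarrow> \<exists>N::nat. \<forall>m\<ge>N. \<forall>n\<ge>N. qnm (u m - u n) < e" for u :: "nat \<Rightarrow> ('f, 'r) qp"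
  proof -
    \<comment> \<open>Each \<open>u n\<close> is replaced by a rational within
      \<open>1 / (n + 1)\<close>; the class of the resulting sequence of rationals is the
      limit.\<close>
    have "\<exists>q. qnm (u n - cls (\<lambda>_. q)) < 1 / real (Suc n)" for n
    proof -
      obtain X where X: "X \<in> seqs TYPE(('f, 'r) qp)" "u n = cls X" by (rule cls_cases)
      show ?thesis using qnm_cls_approx[OF X(1), of "1 / real (Suc n)"] X(2) by auto
    qed
    then obtain Q where Q: "\<And>n. qnm (u n - cls (\<lambda>_. Q n)) < 1 / real (Suc n)" by metis
    have neg: "qnm (a - b) = qnm (b - a)" for a b :: "('f, 'r) qp"
    proof -
      obtain X where X: "X \<in> seqs TYPE(('f, 'r) qp)" "a - b = cls X" by (rule cls_cases)
      have "(\<lambda>n. ?A (- X n)) \<longlonglongrightarrow> qnm (a - b)" using qnm_tendsto[OF X(1)] X(2) by (simp add: qabs_def padic_abs_minus[OF p])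
      moreover have "b - a = cls (\<lambda>n. - X n)" using X cls_uminus[OF X(1)] by (metis minus_diff_eq)
      ultimately show ?thesis using qnm_tendsto[OF seqs_closed(2)[OF X(1)]] by (metis LIMSEQ_unique)
    qed
    have small: "\<exists>N. \<forall>n\<ge>N. 1 / real (Suc n) < e" if e: "e > 0" for e :: real
    proof -
      obtain N where N: "1 / real (Suc N) < e" using nat_approx_posE[OF e] by blast
      then have "1 / real (Suc n) < e" if "n \<ge> N" for n
        using that frac_le[of 1 1 "real (Suc N)" "real (Suc n)"] by simp
      then show ?thesis by blast
    qed
    have tri: "qnm (a - c) < e" if "qnm (a - b) < e" "qnm (b - c) < e" for a b c :: "('f, 'r) qp" and e
      using add[of "a - b" "b - c"] that by simp
    have Qs: "Q \<in> seqs TYPE(('f, 'r) qp)"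
      unfolding seqs_def padic_Cauchy_def
    proof (intro CollectI allI impI)
      fix e :: real assume e: "e > 0"
      obtain N1 where N1: "\<forall>m\<ge>N1. \<forall>n\<ge>N1. qnm (u m - u n) < e" using u[OF e] by blast
      obtain N2 where N2: "\<forall>n\<ge>N2. 1 / real (Suc n) < e" using small[OF e] by blast
      show "\<exists>N. \<forall>m\<ge>N. \<forall>n\<ge>N. padic_abs ?p (Q m - Q n) < e"
      proof (intro exI[of _ "max N1 N2"] allI impI)
        fix m n assume mn: "max N1 N2 \<le> m" "max N1 N2 \<le> n"
        have "qnm (cls (\<lambda>_. Q m) - u m) < e" "qnm (u n - cls (\<lambda>_. Q n)) < e"
          using Q[of m] Q[of n] N2 mn neg[of "u m"] by (auto intro: less_trans)
        moreover have "qnm (u m - u n) < e" using N1 mn by simp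
        ultimately have "qnm (cls (\<lambda>_. Q m) - cls (\<lambda>_. Q n) :: ('f, 'r) qp) < e" by (meson tri)
        then show "padic_abs ?p (Q m - Q n) < e" by (simp add: cls_arith seqs_closed(1) qnm_cls_const qabs_def)
      qed
    qed
    show ?thesis
    proof (intro exI[of _ "cls Q"] allI impI)
      fix e :: real assume e: "e > 0"
      obtain N1 where N1: "\<forall>n\<ge>N1. qnm (cls Q - cls (\<lambda>_. Q n) :: ('f, 'r) qp) < e" using qnm_cls_approx[OF Qs e] by blast
      obtain N2 where N2: "\<forall>n\<ge>N2. 1 / real (Suc n) < e" using small[OF e] by blast
      have "qnm (u n - cls Q) < e" if "n \<ge> max N1 N2" for n
      proof (rule tri)
        show "qnm (u n - cls (\<lambda>_. Q n)) < e" using Q[of n] N2 that by (auto intro: less_trans)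
        show "qnm (cls (\<lambda>_. Q n) - cls Q :: ('f, 'r) qp) < e" using N1 that neg[of "cls Q"] by simp
      qed
      then show "\<exists>N. \<forall>n\<ge>N. qnm (u n - cls Q) < e" by blast
    qed
  qed
qed

section \<open>Isomorphism of the type with the structure \<open>Qp_struct\<close>\<close>

lemma Rep_qp_arith:
  fixes a b :: "('f, 'r) qp"
  defines "p \<equiv> the_prime TYPE('f) TYPE('r)"
  shows "Rep_qp (a + b) = Qp_lift2 p (+) (Rep_qp a) (Rep_qp b)"
    "Rep_qp (a - b) = Qp_lift2 p (-) (Rep_qp a) (Rep_qp b)"
    "Rep_qp (a * b) = Qp_lift2 p (*) (Rep_qp a) (Rep_qp b)"
    "Rep_qp (0 :: ('f, 'r) qp) = Qp_of_rat p 0"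
    "Rep_qp (1 :: ('f, 'r) qp) = Qp_of_rat p 1"
proof -
  obtain X where X: "X \<in> seqs TYPE(('f, 'r) qp)" "a = cls X" by (rule cls_cases)
  obtain Y where Y: "Y \<in> seqs TYPE(('f, 'r) qp)" "b = cls Y" by (rule cls_cases)
  have XY: "X \<in> padic_Cauchy p" "Y \<in> padic_Cauchy p" using X Y by (simp_all add: seqs_def p_def)
  show "Rep_qp (a + b) = Qp_lift2 p (+) (Rep_qp a) (Rep_qp b)"
    using XY by (simp add: Qp_add_class[OF the_prime(1)] X Y cls_arith Rep_cls seqs_closed p_def)
  show "Rep_qp (a - b) = Qp_lift2 p (-) (Rep_qp a) (Rep_qp b)"
    using XY by (simp add: Qp_diff_class[OF the_prime(1)] X Y cls_arith Rep_cls seqs_closed p_def)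
  show "Rep_qp (a * b) = Qp_lift2 p (*) (Rep_qp a) (Rep_qp b)"
    using XY by (simp add: Qp_mult_class[OF the_prime(1)] X Y cls_arith Rep_cls seqs_closed p_def)
  show "Rep_qp (0 :: ('f, 'r) qp) = Qp_of_rat p 0" "Rep_qp (1 :: ('f, 'r) qp) = Qp_of_rat p 1"
    by (simp_all add: zero_qp_def one_qp_def Rep_cls seqs_closed Qp_of_rat_class[OF the_prime(1)] p_def)
qed

lemma Rep_qp_power:
  "Rep_qp (a ^ n :: ('f, 'r) qp) = Qp_power (the_prime TYPE('f) TYPE('r)) (Rep_qp a) n"
  by (induction n) (simp_all add: Qp_power_def Rep_qp_arith)

text \<open>\<open>Rep_qp\<close> is an isomorphism for the symbols of \<open>Lp\<close>. On all
  other symbols both structures have dummy values, hence the restriction to formulas of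
  \<open>Lp\<close>.\<close>

lemma sat_Qp_struct:
  fixes \<phi> :: "('f fsym, 'r rsym) fm"
  defines "p \<equiv> the_prime TYPE('f) TYPE('r)"
  assumes "fm_in (Lp :: ('f fsym, 'r rsym) language) \<phi>"
  shows "sat (Qp_struct p) (Rep_qp \<circ> e) \<phi> \<longleftrightarrow>
    sat (field_struct :: ('f fsym, 'r rsym, ('f, 'r) qp) struct) e \<phi>"
  using assms(2)
proof (induction \<phi> arbitrary: e)
  note Rep_arith = Rep_qp_arith[where ?'f = 'f and ?'r = 'r, folded p_def]
  let ?F = "field_struct :: ('f fsym, 'r rsym, ('f, 'r) qp) struct"
  and ?Q = "Qp_struct p :: ('f fsym, 'r rsym, padic) struct"
  have val: "tm_val ?Q (Rep_qp \<circ> e) t = Rep_qp (tm_val ?F e t)"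
    if "tm_in (Lp :: ('f fsym, 'r rsym) language) t" for e t
    using that
  proof (induction t)
    case (Fn f ts)
    have f: "f \<in> {Zero, One, Add, Sub, Mul}" "length ts = (if f \<in> {Zero, One} then 0 else 2)"
      and ts: "\<And>t. t \<in> set ts \<Longrightarrow> tm_in (Lp :: ('f fsym, 'r rsym) language) t"
      using Fn.prems by (auto simp: Lp_def tm_in.simps(2) list_all_iff)
    show ?case
    proof (cases "f \<in> {Zero, One}")
      case True
      then show ?thesis by (auto simp: Qp_struct_def Rep_arith)
    next
      case False
      then obtain s t where "ts = [s, t]" using f by (auto simp: length_Suc_conv numeral_2_eq_2)
      then show ?thesis using f False Fn.IH[of s] Fn.IH[of t] ts by (auto simp: Qp_struct_def Rep_arith)
    qed
  qed simp
  {
    case (Eq s t)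
    then have "tm_in (Lp :: ('f fsym, 'r rsym) language) s" "tm_in (Lp :: ('f fsym, 'r rsym) language) t"
      by simp_all
    then show ?case by (simp only: sat.simps val Rep_qp_inject)
  next
    case (Rel r ts)
    obtain n t where n: "r = Pow n" "ts = [t]" "tm_in (Lp :: ('f fsym, 'r rsym) language) t"
      using Rel.prems by (auto simp: Lp_def length_Suc_conv)
    have pow: "(\<exists>B\<in>Qp p. Rep_qp a = Qp_power p B n) \<longleftrightarrow> (\<exists>b :: ('f, 'r) qp. a = b ^ n)" for a
      unfolding p_def by (metis Rep_qp Rep_qp_power Rep_qp_inject Rep_qp_cases)
    have rel: "rel_int ?Q (Pow n) as \<longleftrightarrow> (\<exists>B\<in>Qp p. as ! 0 = Qp_power p B n)" for as
      by (simp add: Qp_struct_def)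
    show ?case
      by (simp only: n(1,2) sat.simps list.map val[OF n(3)] rel rel_int_field_struct nth_Cons_0 pow)
  next
    case (Neg \<phi>)
    then show ?case by simp
  next
    case (Conj \<phi> \<psi>)
    then show ?case by simp
  next
    case (Ex i \<phi>)
    have upd: "(Rep_qp \<circ> e)(i := Rep_qp u) = Rep_qp \<circ> e(i := u)" for u
      by (auto simp: fun_eq_iff)
    have "sat ?Q ((Rep_qp \<circ> e)(i := Rep_qp u)) \<phi> \<longleftrightarrow> sat ?F (e(i := u)) \<phi>" for u
      unfolding upd by (rule Ex.IH) (use Ex.prems in simp)
    moreover have "(\<exists>u\<in>univ ?Q. P u) \<longleftrightarrow> (\<exists>u :: ('f, 'r) qp. P (Rep_qp u))" for P
      unfolding Qp_struct_def p_def by (auto intro: Rep_qp elim: Rep_qp_cases)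
    ultimately show ?case by (simp only: sat.simps univ_field_struct bex_UNIV)
  }
qed

lemma holds_Qp_struct_sentence:
  fixes \<phi> :: "('f fsym, 'r rsym) fm"
  assumes "\<phi> \<in> sentences Lp"
  shows "holds (Qp_struct (the_prime TYPE('f) TYPE('r))) \<phi> [] \<longleftrightarrow>
    holds (field_struct :: ('f fsym, 'r rsym, ('f, 'r) qp) struct) \<phi> []"
proof -
  let ?e = "list_env [] :: nat \<Rightarrow> ('f, 'r) qp"
  have "free_vars \<phi> = {}" and fm: "fm_in Lp \<phi>" using assms by (auto simp: sentences_def formulas_def)
  then have "holds (Qp_struct (the_prime TYPE('f) TYPE('r))) \<phi> [] \<longleftrightarrow>
      sat (Qp_struct (the_prime TYPE('f) TYPE('r))) (Rep_qp \<circ> ?e) \<phi>"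
    unfolding holds_list_env by (intro sat_cong) simp
  then show ?thesis by (simp add: sat_Qp_struct[OF fm] holds_list_env)
qed

lemma sublanguage_refl: "sublanguage L L"
  by (simp add: sublanguage_def)

lemma goodF_sentence: "\<psi> \<in> formulas Lp (Suc n) \<Longrightarrow> K \<ge> 2 \<Longrightarrow> Alls 0 n (goodF p \<psi> n K) \<in> sentences Lp"
  unfolding sentences_def by (intro formulas_Alls) (simp add: goodF_formula sublanguage_refl)

lemma pointF_sentence: "Alls 0 2 (Ex 2 (pointF p W u)) \<in> sentences Lp"
proof -
  have "Ex 2 (pointF p W u) \<in> formulas Lp 2"
    by (rule formulas_Ex) (use pointF_formula in simp)
  then show ?thesis unfolding sentences_def by (intro formulas_Alls) (simp only: add_0)
qed

lemma padic_facts_the_prime: "padic_facts TYPE('f) TYPE('r) (the_prime TYPE('f) TYPE('r))"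
  unfolding padic_facts_def
proof (intro conjI allI impI)
  fix n and \<psi> :: "('f fsym, 'r rsym) fm"
  assume \<psi>: "\<psi> \<in> formulas Lp (Suc n) \<and> quantifier_free \<psi>"
  obtain K where "K \<ge> 2" "holds (field_struct :: ('f fsym, 'r rsym, ('f, 'r) qp) struct)
      (Alls 0 n (goodF (the_prime TYPE('f) TYPE('r)) \<psi> n K)) []"
    using qp.qf_goodF \<psi> by blast
  then show "\<exists>K\<ge>2. holds (Qp_struct (the_prime TYPE('f) TYPE('r)))
      (Alls 0 n (goodF (the_prime TYPE('f) TYPE('r)) \<psi> n K)) []"
    using \<psi> by (intro exI[of _ K]) (simp add: holds_Qp_struct_sentence goodF_sentence)
next
  fix s
  obtain W V where "\<And>K. K \<ge> 2 \<Longrightarrow> holds (field_struct :: ('f fsym, 'r rsym, ('f, 'r) qp) struct)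
      (representF (the_prime TYPE('f) TYPE('r)) s W V K) []"
    using qp.holds_representF_field_struct[of s] by blast
  then show "\<exists>W V. \<forall>K\<ge>2. holds (Qp_struct (the_prime TYPE('f) TYPE('r)) :: ('f fsym, 'r rsym, padic) struct)
      (representF (the_prime TYPE('f) TYPE('r)) s W V K) []"
    by (intro exI[of _ W] exI[of _ V]) (simp add: holds_Qp_struct_sentence representF_sentence)
next
  fix W u
  show "holds (Qp_struct (the_prime TYPE('f) TYPE('r)) :: ('f fsym, 'r rsym, padic) struct)
      (Alls 0 2 (Ex 2 (pointF (the_prime TYPE('f) TYPE('r)) W u))) []"
    using qp.holds_pointF_field_struct by (simp add: holds_Qp_struct_sentence pointF_sentence)
next
  fix s
  obtain k where "\<And>K. K \<ge> 2 \<Longrightarrow> holds (field_struct :: ('f fsym, 'r rsym, ('f, 'r) qp) struct)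
      (countF (the_prime TYPE('f) TYPE('r)) s K (Suc (k * K))) []"
    using qp.holds_countF_field_struct[of s] by blast
  then show "\<exists>k. \<forall>K\<ge>2. holds (Qp_struct (the_prime TYPE('f) TYPE('r)) :: ('f fsym, 'r rsym, padic) struct)
      (countF (the_prime TYPE('f) TYPE('r)) s K (Suc (k * K))) []"
    by (intro exI[of _ k]) (simp add: holds_Qp_struct_sentence countF_sentence)
qed

lemma padic_facts: "prime p \<Longrightarrow> padic_facts TYPE('f) TYPE('r) p"
  by (rule the_prime(2)[OF padic_facts_the_prime])

section \<open>Definable functions\<close>

locale skolem_model =
  fixes L :: "('f, 'r) language" and M :: "('f, 'r, 'u) struct"
  assumes is_struct: "is_struct L M"
    and skolem: "\<And>n \<phi>. \<phi> \<in> formulas L (Suc n) \<Longrightarrow> \<exists>\<psi>\<in>formulas L (Suc n). \<forall>a\<in>tuples M n.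
      (\<exists>b\<in>univ M. holds M \<phi> (a @ [b])) \<longrightarrow>
      (\<exists>!b. b \<in> univ M \<and> holds M \<psi> (a @ [b])) \<and> (\<forall>b\<in>univ M. holds M \<psi> (a @ [b]) \<longrightarrow> holds M \<phi> (a @ [b]))"
begin

text \<open>Definability without parameters is handled through relations and functions: closure
  properties replace explicit formulas and the bookkeeping of their variables.\<close>

definition dfn :: "nat \<Rightarrow> ('u list \<Rightarrow> bool) \<Rightarrow> bool" where
  "dfn n R \<longleftrightarrow> (\<exists>\<phi>\<in>formulas L n. \<forall>a\<in>tuples M n. holds M \<phi> a \<longleftrightarrow> R a)"

definition dfun :: "nat \<Rightarrow> ('u list \<Rightarrow> 'u) \<Rightarrow> bool" where
  "dfun n g \<longleftrightarrow> (\<forall>a\<in>tuples M n. g a \<in> univ M) \<and> dfn (Suc n) (\<lambda>a. last a = g (butlast a))"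

lemma dfn_cong: "dfn n R \<Longrightarrow> (\<And>a. a \<in> tuples M n \<Longrightarrow> R a \<longleftrightarrow> R' a) \<Longrightarrow> dfn n R'"
  unfolding dfn_def by blast

lemma dfn_formula: "\<phi> \<in> formulas L n \<Longrightarrow> dfn n (holds M \<phi>)"
  unfolding dfn_def by blast

lemma dfn_conj: "dfn n R \<Longrightarrow> dfn n S \<Longrightarrow> dfn n (\<lambda>a. R a \<and> S a)"
  unfolding dfn_def by (elim bexE) (rule_tac x = "Conj \<phi> \<phi>'" in bexI, auto simp: formulas_connectives)

lemma dfn_ex: "dfn (Suc n) R \<Longrightarrow> dfn n (\<lambda>a. \<exists>u\<in>univ M. R (a @ [u]))"
  unfolding dfn_def
  by (elim bexE, rule_tac x = "Ex n \<phi>" in bexI)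
     (auto simp: holds_Ex tuples_length formulas_Ex tuples_snoc_iff)

lemma tuples_map_nth: "a \<in> tuples M m \<Longrightarrow> set ks \<subseteq> {..<m} \<Longrightarrow> map ((!) a) ks \<in> tuples M (length ks)"
  using tuples_nth[of a M m] by (auto simp: tuples_def)

lemma dfn_subst_vars:
  assumes "dfn k R" "length ks = k" "set ks \<subseteq> {..<m}"
  shows "dfn m (\<lambda>a. R (map ((!) a) ks))"
proof -
  obtain \<phi> where \<phi>: "\<phi> \<in> formulas L k" "\<And>a. a \<in> tuples M k \<Longrightarrow> holds M \<phi> a \<longleftrightarrow> R a"
    using assms(1) by (auto simp: dfn_def)
  have "holds M (subst_vars ks \<phi>) a \<longleftrightarrow> R (map ((!) a) ks)" if "a \<in> tuples M m" for a
    using \<phi> assms that tuples_map_nth[OF that assms(3)]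
    by (subst holds_subst_vars) (auto simp: tuples_length formulas_def)
  then show ?thesis unfolding dfn_def using subst_vars_formulas[OF \<phi>(1) assms(2,3)] by blast
qed

lemma map_nth_take: "length a \<ge> n \<Longrightarrow> map ((!) a) [0..<n] = take n a"
  by (intro nth_equalityI) auto

lemma map_nth_drop: "map ((!) a) [n..<length a] = drop n a"
  by (intro nth_equalityI) auto

lemma dfn_drop: "dfn k R \<Longrightarrow> dfn (m + k) (\<lambda>a. R (drop m a))"
  by (rule dfn_cong[OF dfn_subst_vars[of k R "[m..<m + k]" "m + k"]])
     (auto simp: map_nth_drop[symmetric] tuples_length simp del: map_eq_conv)

lemma dfun_univ: "dfun n g \<Longrightarrow> a \<in> tuples M n \<Longrightarrow> g a \<in> univ M"
  by (simp add: dfun_def)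

lemma dfun_tuples: "(\<And>g. g \<in> set gs \<Longrightarrow> dfun n g) \<Longrightarrow> a \<in> tuples M n \<Longrightarrow> map (\<lambda>g. g a) gs \<in> tuples M (length gs)"
  by (auto simp: tuples_def dfun_def)

lemma dfun_cong: "dfun n g \<Longrightarrow> (\<And>a. a \<in> tuples M n \<Longrightarrow> g a = h a) \<Longrightarrow> dfun n h"
  unfolding dfun_def by (auto elim!: dfn_cong simp: tuples_snoc_iff)

lemma dfun_proj: "i < n \<Longrightarrow> dfun n (\<lambda>a. a ! i)"
proof -
  assume i: "i < n"
  have "Eq (Var n) (Var i) \<in> formulas L (Suc n)" using i by (auto simp: formulas_def)
  then have "dfn (Suc n) (holds M (Eq (Var n) (Var i)))" by (rule dfn_formula)
  then have "dfn (Suc n) (\<lambda>a. last a = butlast a ! i)"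
    by (rule dfn_cong) (use i in \<open>auto simp: tuples_snoc_iff nth_append tuples_length\<close>)
  then show ?thesis using i by (auto simp: dfun_def tuples_nth)
qed

lemma dfun_take:
  assumes "dfun k g" "k \<le> m"
  shows "dfun m (\<lambda>a. g (take k a))"
proof -
  have "dfn (Suc m) (\<lambda>a. last (map ((!) a) ([0..<k] @ [m])) = g (butlast (map ((!) a) ([0..<k] @ [m]))))"
    using assms by (intro dfn_subst_vars[of "Suc k"]) (auto simp: dfun_def)
  then have "dfn (Suc m) (\<lambda>a. last a = g (take k (butlast a)))"
  proof (rule dfn_cong)
    fix a assume "a \<in> tuples M (Suc m)"
    then obtain b u where a: "a = b @ [u]" "length b = m" by (auto simp: tuples_snoc_iff tuples_length)
    then have "map ((!) a) [0..<k] = take k b"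
      using assms(2) by (intro nth_equalityI) (auto simp: nth_append)
    with a show "last (map ((!) a) ([0..<k] @ [m])) = g (butlast (map ((!) a) ([0..<k] @ [m]))) \<longleftrightarrow>
        last a = g (take k (butlast a))" by (simp add: nth_append butlast_append)
  qed
  moreover have "take k a \<in> tuples M k" if "a \<in> tuples M m" for a
    using that assms(2) by (auto simp: tuples_def dest: in_set_takeD)
  ultimately show ?thesis using assms(1) by (auto simp: dfun_def)
qed

text \<open>\<open>R(a, g(a))\<close> is expressed as
  \<open>\<exists>u. u = g(a) \<and> R(a, u)\<close>.\<close>

lemma dfn_comp1:
  assumes "dfn (Suc n) R" "dfun n g"
  shows "dfn n (\<lambda>a. R (a @ [g a]))"
proof -
  have "dfn (Suc n) (\<lambda>a. last a = g (butlast a) \<and> R a)"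
    using assms by (intro dfn_conj) (auto simp: dfun_def)
  from dfn_ex[OF this] show ?thesis
    by (rule dfn_cong) (use dfun_univ[OF assms(2)] in auto)
qed

lemma dfn_comp_append:
  assumes "dfn (n + length gs) R" "\<And>g. g \<in> set gs \<Longrightarrow> dfun n g"
  shows "dfn n (\<lambda>a. R (a @ map (\<lambda>g. g a) gs))"
  using assms
proof (induction gs arbitrary: R rule: rev_induct)
  case (snoc g gs)
  have "dfn (n + length gs) (\<lambda>b. R (b @ [g (take n b)]))"
    using snoc.prems by (intro dfn_comp1 dfun_take) auto
  from snoc.IH[OF this] snoc.prems(2)
  have "dfn n (\<lambda>a. R ((a @ map (\<lambda>g. g a) gs) @ [g (take n (a @ map (\<lambda>g. g a) gs))]))" by simp
  then show ?case by (rule dfn_cong) (simp add: tuples_length)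
qed simp

lemma dfn_comp:
  assumes "dfn (length gs) R" "\<And>g. g \<in> set gs \<Longrightarrow> dfun n g"
  shows "dfn n (\<lambda>a. R (map (\<lambda>g. g a) gs))"
  by (rule dfn_cong[OF dfn_comp_append[OF dfn_drop[OF assms(1), of n] assms(2)]]) (auto simp: tuples_length)

lemma dfun_comp:
  assumes h: "dfun (length gs) h" and gs: "\<And>g. g \<in> set gs \<Longrightarrow> dfun n g"
  shows "dfun n (\<lambda>a. h (map (\<lambda>g. g a) gs))"
proof -
  define gs' where "gs' = map (\<lambda>g a. g (take n a)) gs @ [\<lambda>a. a ! n]"
  have "dfn (length gs') (\<lambda>b. last b = h (butlast b))" using h by (simp add: gs'_def dfun_def)
  then have "dfn (Suc n) (\<lambda>a. last (map (\<lambda>g. g a) gs') = h (butlast (map (\<lambda>g. g a) gs')))"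
    by (rule dfn_comp) (auto simp: gs'_def intro!: dfun_take gs dfun_proj)
  then have "dfn (Suc n) (\<lambda>a. last a = h (map (\<lambda>g. g (butlast a)) gs))"
    by (rule dfn_cong) (auto simp: gs'_def tuples_snoc_iff tuples_length nth_append comp_def)
  then show ?thesis using dfun_univ[OF h dfun_tuples[OF gs]] by (simp add: dfun_def)
qed

lemma dfun_fun_int:
  assumes "f \<in> fsyms L"
  shows "dfun (farity L f) (fun_int M f)"
proof -
  define k where "k = farity L f"
  have "Eq (Var k) (Fn f (map Var [0..<k])) \<in> formulas L (Suc k)"
    using assms by (auto simp: formulas_def k_def tm_in.simps(2) list_all_iff)
  then have "dfn (Suc k) (holds M (Eq (Var k) (Fn f (map Var [0..<k]))))" by (rule dfn_formula)
  then have "dfn (Suc k) (\<lambda>a. last a = fun_int M f (butlast a))"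
  proof (rule dfn_cong)
    fix a assume "a \<in> tuples M (Suc k)"
    then obtain b u where a: "a = b @ [u]" "length b = k" by (auto simp: tuples_snoc_iff tuples_length)
    have "map (\<lambda>x. list_env (b @ [u]) x) [0..<k] = b"
      using a by (intro nth_equalityI) (auto simp: nth_append)
    then show "holds M (Eq (Var k) (Fn f (map Var [0..<k]))) a \<longleftrightarrow> last a = fun_int M f (butlast a)"
      using a by (simp add: comp_def nth_append)
  qed
  then show ?thesis using is_struct assms by (auto simp: dfun_def is_struct_def k_def)
qed

text \<open>The assumption provides values only where a witness exists. Applied to
  \<open>(\<exists>u. \<phi>) \<longrightarrow> \<phi>\<close>, which always has one, it yields a
  total function.\<close>

lemma skolem_fun:
  assumes "dfn (Suc n) R"
  shows "\<exists>g. dfun n g \<and> (\<forall>a\<in>tuples M n. (\<exists>u\<in>univ M. R (a @ [u])) \<longrightarrow> R (a @ [g a]))"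
proof -
  obtain \<phi> where \<phi>: "\<phi> \<in> formulas L (Suc n)" "\<And>a. a \<in> tuples M (Suc n) \<Longrightarrow> holds M \<phi> a \<longleftrightarrow> R a"
    using assms by (auto simp: dfn_def)
  define \<phi>' where "\<phi>' = Imp (Ex n \<phi>) \<phi>"
  have Ex: "Ex n \<phi> \<in> formulas L n" using \<phi> by (intro formulas_Ex) auto
  then have \<phi>': "\<phi>' \<in> formulas L (Suc n)"
    using \<phi> formulas_mono[of n "Suc n" L] by (auto simp: \<phi>'_def formulas_connectives)
  have holds': "holds M \<phi>' (a @ [b]) \<longleftrightarrow> ((\<exists>u\<in>univ M. R (a @ [u])) \<longrightarrow> R (a @ [b]))"
    if "a \<in> tuples M n" "b \<in> univ M" for a b
  proof -
    have "free_vars (Ex n \<phi>) \<subseteq> {..<length a}" using Ex that by (simp add: formulas_def tuples_length)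
    then have "holds M (Ex n \<phi>) (a @ [b]) \<longleftrightarrow> holds M (Ex n \<phi>) a" by (rule holds_append)
    then show ?thesis using that \<phi>(2) by (simp add: \<phi>'_def holds_Ex tuples_length tuples_snoc_iff)
  qed
  obtain u0 where u0: "u0 \<in> univ M" using is_struct by (auto simp: is_struct_def)
  have ex: "\<exists>b\<in>univ M. holds M \<phi>' (a @ [b])" if "a \<in> tuples M n" for a
    using holds'[OF that] u0 by blast
  obtain \<psi> where \<psi>: "\<psi> \<in> formulas L (Suc n)"
    "\<And>a. a \<in> tuples M n \<Longrightarrow> \<exists>!b. b \<in> univ M \<and> holds M \<psi> (a @ [b])"
    "\<And>a b. a \<in> tuples M n \<Longrightarrow> b \<in> univ M \<Longrightarrow> holds M \<psi> (a @ [b]) \<Longrightarrow> holds M \<phi>' (a @ [b])"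
    using skolem[OF \<phi>'] ex by blast
  define g where "g a = (THE b. b \<in> univ M \<and> holds M \<psi> (a @ [b]))" for a
  have g: "g a \<in> univ M \<and> holds M \<psi> (a @ [g a])" if "a \<in> tuples M n" for a
    unfolding g_def by (rule theI'[OF \<psi>(2)[OF that]])
  have "dfn (Suc n) (\<lambda>a. last a = g (butlast a))"
  proof (rule dfn_cong[OF dfn_formula[OF \<psi>(1)]])
    fix a assume "a \<in> tuples M (Suc n)"
    then obtain b u where a: "a = b @ [u]" "b \<in> tuples M n" "u \<in> univ M" by (auto simp: tuples_snoc_iff)
    then show "holds M \<psi> a \<longleftrightarrow> last a = g (butlast a)" using g[OF a(2)] \<psi>(2)[OF a(2)] by auto
  qed
  then have "dfun n g" using g by (simp add: dfun_def)
  moreover have "R (a @ [g a])" if "a \<in> tuples M n" "\<exists>u\<in>univ M. R (a @ [u])" for a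
    using holds'[of a "g a"] \<psi>(3)[of a "g a"] g[of a] that by blast
  ultimately show ?thesis by blast
qed

text \<open>The last witness is quantified away while the others are chosen by induction. With these
  functions inserted into the relation, the last witness too becomes a function of the original
  tuple alone.\<close>

lemma skolem_funs:
  assumes "dfn (n + k) R"
  shows "\<exists>gs. length gs = k \<and> (\<forall>g\<in>set gs. dfun n g) \<and>
    (\<forall>a\<in>tuples M n. (\<exists>c\<in>tuples M k. R (a @ c)) \<longrightarrow> R (a @ map (\<lambda>g. g a) gs))"
  using assms
proof (induction k arbitrary: R)
  case 0
  then show ?case by auto
next
  case (Suc k)
  have "dfn (n + k) (\<lambda>b. \<exists>u\<in>univ M. R (b @ [u]))" using Suc.prems by (intro dfn_ex) simp
  from Suc.IH[OF this] obtain gs where gs: "length gs = k" "\<And>g. g \<in> set gs \<Longrightarrow> dfun n g"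
    "\<And>a. a \<in> tuples M n \<Longrightarrow> \<exists>c\<in>tuples M k. \<exists>u\<in>univ M. R ((a @ c) @ [u]) \<Longrightarrow>
       \<exists>u\<in>univ M. R ((a @ map (\<lambda>g. g a) gs) @ [u])" by blast
  define hs where "hs = map (\<lambda>i a. a ! i) [0..<n] @ map (\<lambda>g a. g (take n a)) gs @ [\<lambda>a. a ! n]"
  have "dfn (Suc n) (\<lambda>a. R (map (\<lambda>h. h a) hs))"
    using Suc.prems gs by (intro dfn_comp) (auto simp: hs_def intro!: dfun_proj dfun_take)
  then have "dfn (Suc n) (\<lambda>b. R (take n b @ map (\<lambda>g. g (take n b)) gs @ [b ! n]))"
    by (rule dfn_cong) (auto simp: hs_def comp_def map_nth_take tuples_length)
  then obtain g where g: "dfun n g"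
    "\<And>a. a \<in> tuples M n \<Longrightarrow> \<exists>u\<in>univ M. R (a @ map (\<lambda>g. g a) gs @ [u]) \<Longrightarrow> R (a @ map (\<lambda>g. g a) gs @ [g a])"
    using skolem_fun[of n "\<lambda>b. R (take n b @ map (\<lambda>g. g (take n b)) gs @ [b ! n])"]
    by (auto simp: tuples_length nth_append)
  show ?case
  proof (intro exI[of _ "gs @ [g]"] conjI ballI impI)
    fix a assume a: "a \<in> tuples M n" and "\<exists>c\<in>tuples M (Suc k). R (a @ c)"
    then have "\<exists>c\<in>tuples M k. \<exists>u\<in>univ M. R ((a @ c) @ [u])"
      unfolding Bex_def tuples_snoc_iff append_assoc by blast
    from gs(3)[OF a this] g(2)[OF a] show "R (a @ map (\<lambda>g. g a) (gs @ [g]))" by simp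
  qed (use gs g in auto)
qed

end

section \<open>Ultrapowers of definable functions\<close>

text \<open>In the order of filters, ultrafilters are the minimal nontrivial ones. Zorn's lemma
  applies because the infimum of a nonempty chain is trivial only if one of its members is.\<close>

lemma ultrafilter_exists:
  fixes F :: "'a filter"
  assumes "F \<noteq> bot"
  shows "\<exists>U\<le>F. U \<noteq> bot \<and> (\<forall>P. eventually P U \<or> eventually (\<lambda>x. \<not> P x) U)"
proof -
  define A where "A = {G. G \<le> F \<and> G \<noteq> bot}"
  have "\<exists>U\<in>A. \<forall>G\<in>A. G \<le> U \<longrightarrow> G = U"
  proof -
    define r where "r = {(G, H). G \<in> A \<and> H \<in> A \<and> H \<le> G}"
    have po: "Partial_order r"
      unfolding r_def partial_order_on_def preorder_on_def refl_on_def trans_def antisym_def Field_def by auto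
    have Field: "Field r = A" unfolding r_def Field_def by auto
    have chain: "\<exists>u\<in>Field r. \<forall>a\<in>C. (a, u) \<in> r" if C: "C \<in> Chains r" for C
    proof (cases "C = {}")
      case True
      then show ?thesis using assms Field by (auto simp: A_def)
    next
      case False
      have CA: "C \<subseteq> A" using C Chains_subset[of r] unfolding Chains_def r_def by auto
      have "eventually P (Inf C) \<longleftrightarrow> (\<exists>b\<in>C. eventually P b)" for P
      proof (rule eventually_Inf_base[OF False])
        show "\<exists>x\<in>C. x \<le> inf a b" if "a \<in> C" "b \<in> C" for a b
          using C that unfolding Chains_def r_def by auto
      qed
      then have "Inf C \<noteq> bot" using CA by (auto simp: trivial_limit_def A_def)
      moreover have "Inf C \<le> F" using False CA by (auto simp: A_def intro: Inf_lower2)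
      ultimately have "Inf C \<in> A" by (simp add: A_def)
      then show ?thesis unfolding Field using CA by (intro bexI[of _ "Inf C"]) (auto simp: r_def Inf_lower)
    qed
    from Zorns_po_lemma[OF po chain] Field show ?thesis unfolding r_def by auto
  qed
  then obtain U where U: "U \<le> F" "U \<noteq> bot" and max: "\<And>G. G \<noteq> bot \<Longrightarrow> G \<le> U \<Longrightarrow> G = U"
    unfolding A_def by (blast intro: order_trans)
  have "eventually P U \<or> eventually (\<lambda>x. \<not> P x) U" for P
  proof (cases "inf U (principal {x. P x}) = bot")
    case True
    then have "eventually (\<lambda>x. \<not> P x) U" by (simp add: trivial_limit_def eventually_inf_principal)
    then show ?thesis ..
  next
    case False
    from max[OF False] have "inf U (principal {x. P x}) = U" by simp
    then have "U \<le> principal {x. P x}" by (metis inf.cobounded2)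
    then show ?thesis by (simp add: le_principal)
  qed
  with U show ?thesis by blast
qed

text \<open>The index set is the set of n-tuples of \<open>M\<close> itself, so that the coordinate
  functions become elements. Definability without parameters keeps the ultrapower small, and the
  Skolem functions keep it large enough for the theorem of Los.\<close>

locale ultrapower = skolem_model L M
  for L :: "('f, 'r) language" and M :: "('f, 'r, ('f, 'r) fm + 'a) struct" +
  fixes n :: nat and U :: "(('f, 'r) fm + 'a) list filter"
  assumes U_not_bot: "U \<noteq> bot" and ultra: "eventually P U \<or> eventually (\<lambda>a. \<not> P a) U"
    and U_tuples: "eventually (\<lambda>a. a \<in> tuples M n) U"
begin

lemma eventually_not: "eventually (\<lambda>a. \<not> P a) U \<longleftrightarrow> \<not> eventually P U"
proof
  assume "eventually (\<lambda>a. \<not> P a) U"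
  show "\<not> eventually P U"
  proof
    assume "eventually P U"
    with \<open>eventually (\<lambda>a. \<not> P a) U\<close> have "eventually (\<lambda>a. False) U" by eventually_elim simp
    then show False using U_not_bot by (simp add: trivial_limit_def)
  qed
qed (use ultra in blast)

text \<open>An element is named by a formula defining a function that agrees with \<open>g\<close>
  almost everywhere. The condition depends on \<open>g\<close> only modulo \<open>U\<close>, so the
  choice yields one formula for each class, and the ultrapower fits into the first summand of the
  type that carries \<open>M\<close>.\<close>

definition code :: "((('f, 'r) fm + 'a) list \<Rightarrow> ('f, 'r) fm + 'a) \<Rightarrow> ('f, 'r) fm" where
  "code g = (SOME \<phi>. \<exists>h. dfun n h \<and> (\<forall>a\<in>tuples M (Suc n). holds M \<phi> a \<longleftrightarrow> last a = h (butlast a)) \<and>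
                        eventually (\<lambda>a. g a = h a) U)"

lemma code_eq_iff:
  assumes "dfun n g" "dfun n g'"
  shows "code g = code g' \<longleftrightarrow> eventually (\<lambda>a. g a = g' a) U"
proof
  assume ev: "eventually (\<lambda>a. g a = g' a) U"
  have "eventually (\<lambda>a. g a = h a) U \<longleftrightarrow> eventually (\<lambda>a. g' a = h a) U" for h
  proof
    assume "eventually (\<lambda>a. g a = h a) U" with ev show "eventually (\<lambda>a. g' a = h a) U"
      by eventually_elim simp
  next
    assume "eventually (\<lambda>a. g' a = h a) U" with ev show "eventually (\<lambda>a. g a = h a) U"
      by eventually_elim simp
  qed
  then show "code g = code g'" by (simp add: code_def)
next
  have ex: "\<exists>h. dfun n h \<and> (\<forall>a\<in>tuples M (Suc n). holds M (code g) a \<longleftrightarrow> last a = h (butlast a)) \<and>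
      eventually (\<lambda>a. g a = h a) U" if "dfun n g" for g
  proof -
    obtain \<phi> where "\<forall>a\<in>tuples M (Suc n). holds M \<phi> a \<longleftrightarrow> last a = g (butlast a)"
      using \<open>dfun n g\<close> unfolding dfun_def dfn_def by blast
    then show ?thesis unfolding code_def using that
      by (intro someI_ex[of "\<lambda>\<phi>. \<exists>h. dfun n h \<and> (\<forall>a\<in>tuples M (Suc n). holds M \<phi> a \<longleftrightarrow> last a = h (butlast a)) \<and>
                        eventually (\<lambda>a. g a = h a) U"] exI[of _ \<phi>] exI[of _ g]) auto
  qed
  assume eq: "code g = code g'"
  obtain h where h: "dfun n h" "\<And>a. a \<in> tuples M (Suc n) \<Longrightarrow> holds M (code g) a \<longleftrightarrow> last a = h (butlast a)"
    "eventually (\<lambda>a. g a = h a) U" using ex[OF assms(1)] by blast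
  obtain h' where h': "dfun n h'" "\<And>a. a \<in> tuples M (Suc n) \<Longrightarrow> holds M (code g) a \<longleftrightarrow> last a = h' (butlast a)"
    "eventually (\<lambda>a. g' a = h' a) U" using ex[OF assms(2)] unfolding eq by blast
  have eq': "h a = h' a" if a: "a \<in> tuples M n" for a
    using h(2)[of "a @ [h a]"] h'(2)[of "a @ [h a]"] dfun_univ[OF h(1) a] a by (auto simp: tuples_snoc_iff)
  from h(3) h'(3) U_tuples show "eventually (\<lambda>a. g a = g' a) U"
    by eventually_elim (simp add: eq')
qed

definition elem :: "((('f, 'r) fm + 'a) list \<Rightarrow> ('f, 'r) fm + 'a) \<Rightarrow> ('f, 'r) fm + 'a" where
  "elem g = Inl (code g)"

definition dec :: "('f, 'r) fm + 'a \<Rightarrow> (('f, 'r) fm + 'a) list \<Rightarrow> ('f, 'r) fm + 'a" where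
  "dec w = (SOME g. dfun n g \<and> elem g = w)"

definition N :: "('f, 'r, ('f, 'r) fm + 'a) struct" where
  "N = \<lparr>univ = elem ` {g. dfun n g},
        fun_int = (\<lambda>f ws. elem (\<lambda>a. fun_int M f (map (\<lambda>w. dec w a) ws))),
        rel_int = (\<lambda>r ws. eventually (\<lambda>a. rel_int M r (map (\<lambda>w. dec w a) ws)) U)\<rparr>"

lemma dec: "w \<in> univ N \<Longrightarrow> dfun n (dec w) \<and> elem (dec w) = w"
proof -
  assume "w \<in> univ N"
  then obtain g where g: "dfun n g \<and> elem g = w" by (auto simp: N_def)
  show "dfun n (dec w) \<and> elem (dec w) = w"
    unfolding dec_def by (rule someI[where P = "\<lambda>g. dfun n g \<and> elem g = w", OF g])
qed

lemma elem_univ: "dfun n g \<Longrightarrow> elem g \<in> univ N"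
  by (simp add: N_def)

lemma elem_eq_iff: "dfun n g \<Longrightarrow> dfun n g' \<Longrightarrow> elem g = elem g' \<longleftrightarrow> eventually (\<lambda>a. g a = g' a) U"
  by (simp add: elem_def code_eq_iff)

lemma dec_elem: "dfun n g \<Longrightarrow> eventually (\<lambda>a. dec (elem g) a = g a) U"
  using elem_eq_iff[of "dec (elem g)" g] dec[OF elem_univ, of g] by simp

lemma dec_eq_iff: "v \<in> univ N \<Longrightarrow> w \<in> univ N \<Longrightarrow> v = w \<longleftrightarrow> eventually (\<lambda>a. dec v a = dec w a) U"
  using elem_eq_iff[of "dec v" "dec w"] dec[of v] dec[of w] by auto

lemma dfun_fun_int_dec:
  assumes "f \<in> fsyms L" "ws \<in> tuples N (farity L f)"
  shows "dfun n (\<lambda>a. fun_int M f (map (\<lambda>w. dec w a) ws))"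
proof -
  have "dfun (length (map dec ws)) (fun_int M f)"
    using dfun_fun_int[OF assms(1)] assms(2) by (simp add: tuples_length)
  then have "dfun n (\<lambda>a. fun_int M f (map (\<lambda>g. g a) (map dec ws)))"
    by (rule dfun_comp) (use assms(2) dec in \<open>auto simp: tuples_def\<close>)
  then show ?thesis by (simp add: comp_def)
qed

lemma is_struct_N: "is_struct L N"
proof -
  have "All 0 (Eq (Var 0) (Var 0)) \<in> formulas L (Suc n)" by (auto simp: formulas_def All_def)
  then obtain g where "dfun n g" using skolem_fun[OF dfn_formula] by blast
  then have "univ N \<noteq> {}" by (auto simp: N_def)
  then show ?thesis unfolding is_struct_def
    using elem_univ[OF dfun_fun_int_dec] by (simp add: N_def)
qed

lemma tm_val_N:
  assumes "tm_in L t" "\<And>i. e i \<in> univ N"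
  shows "tm_val N e t \<in> univ N \<and> eventually (\<lambda>a. dec (tm_val N e t) a = tm_val M (\<lambda>i. dec (e i) a) t) U"
  using assms(1)
proof (induction t)
  case (Var i)
  then show ?case using assms(2) by simp
next
  case (Fn f ts)
  have f: "f \<in> fsyms L" "length ts = farity L f" and ts: "\<And>t. t \<in> set ts \<Longrightarrow> tm_in L t"
    using Fn.prems by (auto simp: tm_in.simps(2) list_all_iff)
  have IH: "tm_val N e t \<in> univ N" "eventually (\<lambda>a. dec (tm_val N e t) a = tm_val M (\<lambda>i. dec (e i) a) t) U"
    if "t \<in> set ts" for t using Fn.IH[OF that ts[OF that]] by auto
  have tup: "map (tm_val N e) ts \<in> tuples N (farity L f)" using IH f by (auto simp: tuples_def)
  define g where "g = (\<lambda>a. fun_int M f (map (\<lambda>w. dec w a) (map (tm_val N e) ts)))"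
  have g: "dfun n g" unfolding g_def by (rule dfun_fun_int_dec[OF f(1) tup])
  have val: "tm_val N e (Fn f ts) = elem g" by (simp add: N_def g_def)
  have "eventually (\<lambda>a. \<forall>t\<in>set ts. dec (tm_val N e t) a = tm_val M (\<lambda>i. dec (e i) a) t) U"
    by (rule eventually_ball_finite) (use IH in auto)
  with dec_elem[OF g] have "eventually (\<lambda>a. dec (tm_val N e (Fn f ts)) a = tm_val M (\<lambda>i. dec (e i) a) (Fn f ts)) U"
  proof eventually_elim
    case (elim a)
    then have "map (\<lambda>t. dec (tm_val N e t) a) ts = map (tm_val M (\<lambda>i. dec (e i) a)) ts" by simp
    then show ?case unfolding val using elim(1) by (simp only: g_def map_map comp_def tm_val.simps)
  qed
  then show ?case using elem_univ[OF g] val by simp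
qed

text \<open>The theorem of Los. In the existential case the witnesses must form a definable function
  of the index; it is obtained by composing a Skolem function with the representatives of the values
  of \<open>e\<close>.\<close>

lemma sat_N:
  assumes "fm_in L \<phi>" "\<And>i. e i \<in> univ N"
  shows "sat N e \<phi> \<longleftrightarrow> eventually (\<lambda>a. sat M (\<lambda>i. dec (e i) a) \<phi>) U"
  using assms
proof (induction \<phi> arbitrary: e)
  case (Eq s t)
  have s: "tm_val N e s \<in> univ N" "eventually (\<lambda>a. dec (tm_val N e s) a = tm_val M (\<lambda>i. dec (e i) a) s) U"
    and t: "tm_val N e t \<in> univ N" "eventually (\<lambda>a. dec (tm_val N e t) a = tm_val M (\<lambda>i. dec (e i) a) t) U"
    using tm_val_N[of _ e] Eq by auto
  have "eventually (\<lambda>a. dec (tm_val N e s) a = dec (tm_val N e t) a) U \<longleftrightarrow>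
      eventually (\<lambda>a. tm_val M (\<lambda>i. dec (e i) a) s = tm_val M (\<lambda>i. dec (e i) a) t) U"
    by (rule eventually_subst, use s(2) t(2) in eventually_elim) simp
  then show ?case using dec_eq_iff[OF s(1) t(1)] by simp
next
  case (Rel r ts)
  have ts: "\<And>t. t \<in> set ts \<Longrightarrow> tm_in L t" using Rel.prems by (auto simp: list_all_iff)
  have "eventually (\<lambda>a. \<forall>t\<in>set ts. dec (tm_val N e t) a = tm_val M (\<lambda>i. dec (e i) a) t) U"
    by (rule eventually_ball_finite) (use tm_val_N[OF ts Rel.prems(2)] in auto)
  then have "eventually (\<lambda>a. map (\<lambda>t. dec (tm_val N e t) a) ts = map (tm_val M (\<lambda>i. dec (e i) a)) ts) U"
    by eventually_elim simp
  then have "eventually (\<lambda>a. rel_int M r (map (\<lambda>t. dec (tm_val N e t) a) ts) \<longleftrightarrow>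
      rel_int M r (map (tm_val M (\<lambda>i. dec (e i) a)) ts)) U"
    by eventually_elim (simp only:)
  then have "eventually (\<lambda>a. rel_int M r (map (\<lambda>t. dec (tm_val N e t) a) ts)) U \<longleftrightarrow>
      eventually (\<lambda>a. rel_int M r (map (tm_val M (\<lambda>i. dec (e i) a)) ts)) U"
    by (rule eventually_subst)
  moreover have "sat N e (Rel r ts) \<longleftrightarrow> eventually (\<lambda>a. rel_int M r (map (\<lambda>t. dec (tm_val N e t) a) ts)) U"
    by (simp add: N_def comp_def)
  ultimately show ?case by simp
next
  case (Neg \<phi>)
  then show ?case by (simp add: eventually_not)
next
  case (Conj \<phi> \<psi>)
  then show ?case by (simp add: eventually_conj_iff)
next
  case (Ex i \<phi>)
  have IH: "sat N (e(i := w)) \<phi> \<longleftrightarrow> eventually (\<lambda>a. sat M ((\<lambda>j. dec (e j) a)(i := dec w a)) \<phi>) U"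
    if "w \<in> univ N" for w
  proof -
    have "sat N (e(i := w)) \<phi> \<longleftrightarrow> eventually (\<lambda>a. sat M (\<lambda>j. dec ((e(i := w)) j) a) \<phi>) U"
      by (rule Ex.IH) (use Ex.prems that in auto)
    moreover have "(\<lambda>j. dec ((e(i := w)) j) a) = (\<lambda>j. dec (e j) a)(i := dec w a)" for a by auto
    ultimately show ?thesis by simp
  qed
  show ?case
  proof
    assume "sat N e (Ex i \<phi>)"
    then obtain w where w: "w \<in> univ N" "sat N (e(i := w)) \<phi>" by auto
    from w(2) have "eventually (\<lambda>a. sat M ((\<lambda>j. dec (e j) a)(i := dec w a)) \<phi>) U" by (simp only: IH[OF w(1)])
    with U_tuples show "eventually (\<lambda>a. sat M (\<lambda>j. dec (e j) a) (Ex i \<phi>)) U"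
      by eventually_elim (use dec[OF w(1)] dfun_univ in auto)
  next
    assume ev: "eventually (\<lambda>a. sat M (\<lambda>j. dec (e j) a) (Ex i \<phi>)) U"
    obtain m where m: "free_vars \<phi> \<subseteq> {..<m}" using finite_free_vars[of \<phi>] finite_nat_iff_bounded by blast
    \<comment> \<open>The quantified variable is moved to an index above all free variables, so that
      the witness is the last entry, as in \<open>skolem_fun\<close>.\<close>
    define \<phi>' where "\<phi>' = rename \<phi> (id(i := m))"
    have "free_vars \<phi>' \<subseteq> {..<Suc m}"
      using free_vars_rename[of \<phi> "id(i := m)"] m by (auto simp: \<phi>'_def split: if_splits)
    then have \<phi>': "\<phi>' \<in> formulas L (Suc m)" using Ex.prems by (simp add: formulas_def fm_in_rename \<phi>'_def)
    have holds': "holds M \<phi>' (b @ [u]) \<longleftrightarrow> sat M (e'(i := u)) \<phi>"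
      if "length b = m" "\<And>j. j < m \<Longrightarrow> e' j = b ! j" for b u e'
      unfolding holds_list_env \<phi>'_def sat_rename
      by (rule sat_cong) (use that m in \<open>auto simp: nth_append\<close>)
    obtain \<sigma> where \<sigma>: "dfun m \<sigma>"
      "\<And>b. b \<in> tuples M m \<Longrightarrow> \<exists>u\<in>univ M. holds M \<phi>' (b @ [u]) \<Longrightarrow> holds M \<phi>' (b @ [\<sigma> b])"
      using skolem_fun[OF dfn_formula[OF \<phi>']] by blast
    define gs where "gs = map (\<lambda>j. dec (e j)) [0..<m]"
    have gs: "\<And>g. g \<in> set gs \<Longrightarrow> dfun n g" using dec Ex.prems by (auto simp: gs_def)
    define g where "g a = \<sigma> (map (\<lambda>h. h a) gs)" for a
    have g: "dfun n g" unfolding g_def using \<sigma>(1) gs by (intro dfun_comp) (auto simp: gs_def)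
    have "eventually (\<lambda>a. sat M ((\<lambda>j. dec (e j) a)(i := dec (elem g) a)) \<phi>) U"
      using ev U_tuples dec_elem[OF g]
    proof eventually_elim
      case (elim a)
      define b where "b = map (\<lambda>h. h a) gs"
      have b: "length b = m" "\<And>j. j < m \<Longrightarrow> dec (e j) a = b ! j" by (auto simp: b_def gs_def)
      have "map (\<lambda>h. h a) gs \<in> tuples M (length gs)" by (rule dfun_tuples) (use gs elim(2) in auto)
      then have "b \<in> tuples M m" by (simp add: b_def gs_def)
      moreover have "\<exists>u\<in>univ M. holds M \<phi>' (b @ [u])"
        using elim(1) holds'[OF b] by auto
      ultimately have "holds M \<phi>' (b @ [\<sigma> b])" by (rule \<sigma>(2))
      then show ?case using holds'[OF b] elim(3) by (simp add: g_def b_def)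
    qed
    then have "sat N (e(i := elem g)) \<phi>" by (simp only: IH[OF elem_univ[OF g]])
    then show "sat N e (Ex i \<phi>)" using elem_univ[OF g] by auto
  qed
qed

text \<open>The classes of the coordinate functions, i.e. the class of the identity: the generic
  tuple, which satisfies exactly the formulas that hold almost everywhere.\<close>

definition gen :: "(('f, 'r) fm + 'a) list" where
  "gen = map (\<lambda>i. elem (\<lambda>a. a ! i)) [0..<n]"

lemma gen_tuples: "gen \<in> tuples N n"
  using elem_univ[OF dfun_proj] by (auto simp: gen_def tuples_def)

lemma holds_N_gen:
  assumes "\<phi> \<in> formulas L n"
  shows "holds N \<phi> gen \<longleftrightarrow> eventually (holds M \<phi>) U"
proof -
  obtain w0 where w0: "w0 \<in> univ N" using is_struct_N by (auto simp: is_struct_def)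
  define e where "e i = (if i < n then elem (\<lambda>a. a ! i) else w0)" for i
  have e: "e i \<in> univ N" for i using w0 elem_univ[OF dfun_proj] by (auto simp: e_def)
  have fm: "fm_in L \<phi>" "free_vars \<phi> \<subseteq> {..<n}" using assms by (auto simp: formulas_def)
  have "holds N \<phi> gen \<longleftrightarrow> sat N e \<phi>"
    unfolding holds_list_env by (rule sat_cong) (use fm in \<open>auto simp: gen_def e_def list_env_def\<close>)
  also have "\<dots> \<longleftrightarrow> eventually (\<lambda>a. sat M (\<lambda>i. dec (e i) a) \<phi>) U" by (rule sat_N[OF fm(1) e])
  also have "\<dots> \<longleftrightarrow> eventually (holds M \<phi>) U"
  proof (rule eventually_subst)
    have "eventually (\<lambda>a. \<forall>i\<in>{..<n}. dec (e i) a = a ! i) U"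
      by (rule eventually_ball_finite) (use dec_elem[OF dfun_proj] in \<open>auto simp: e_def\<close>)
    with U_tuples show "eventually (\<lambda>a. sat M (\<lambda>i. dec (e i) a) \<phi> \<longleftrightarrow> holds M \<phi> a) U"
    proof eventually_elim
      case (elim a)
      then show ?case unfolding holds_list_env
        by (intro sat_cong) (use fm in \<open>auto simp: tuples_length\<close>)
    qed
  qed
  finally show ?thesis .
qed

lemma is_model_N:
  assumes "is_model L T M" "T \<subseteq> sentences L"
  shows "is_model L T N"
  unfolding is_model_def
proof (intro conjI ballI is_struct_N)
  fix \<phi> assume \<phi>: "\<phi> \<in> T"
  then have fm: "fm_in L \<phi>" "free_vars \<phi> = {}" using assms(2) by (auto simp: sentences_def formulas_def)
  have closed: "holds S \<phi> a \<longleftrightarrow> holds S \<phi> []" for S :: "('f, 'r, ('f, 'r) fm + 'a) struct" and a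
    unfolding holds_list_env by (rule sat_cong) (use fm in auto)
  have "holds M \<phi> []" using assms(1) \<phi> by (simp add: is_model_def)
  then have "eventually (holds M \<phi>) U" using closed[of M] by (simp add: always_eventually)
  then show "holds N \<phi> []" using holds_N_gen[of \<phi>] fm closed[of N gen] by (simp add: formulas_def)
qed

end

section \<open>Models of P-minimal theories\<close>

lemma model_skolem:
  assumes "definable_skolem_functions (U :: 'u itself) L T" "is_model L T (M :: ('f, 'r, 'u) struct)"
  shows "skolem_model L M"
proof
  show "is_struct L M" using assms(2) by (simp add: is_model_def)
  fix n \<phi> assume "\<phi> \<in> formulas L (Suc n)"
  then have "\<phi> \<in> formulas L (n + 1)" by simp
  then obtain \<psi> where "\<psi> \<in> formulas L (n + 1)"
    "\<forall>M :: ('f, 'r, 'u) struct. is_model L T M \<longrightarrow>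
          (\<forall>a\<in>tuples M n. (\<exists>b\<in>univ M. holds M \<phi> (a @ [b])) \<longrightarrow>
             (\<exists>!b. b \<in> univ M \<and> holds M \<psi> (a @ [b])) \<and>
             (\<forall>b\<in>univ M. holds M \<psi> (a @ [b]) \<longrightarrow> holds M \<phi> (a @ [b])))"
    using assms(1) unfolding definable_skolem_functions_def by blast
  then show "\<exists>\<psi>\<in>formulas L (Suc n). \<forall>a\<in>tuples M n.
      (\<exists>b\<in>univ M. holds M \<phi> (a @ [b])) \<longrightarrow>
      (\<exists>!b. b \<in> univ M \<and> holds M \<psi> (a @ [b])) \<and> (\<forall>b\<in>univ M. holds M \<psi> (a @ [b]) \<longrightarrow> holds M \<phi> (a @ [b]))"
    using assms(2) by (intro bexI[of _ \<psi>]) auto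
qed

lemma model_sentence:
  assumes "P_minimal U p L T" "is_model L T M" "\<sigma> \<in> sentences Lp" "holds (Qp_struct p) \<sigma> []"
  shows "holds M \<sigma> []"
  using assms unfolding P_minimal_def is_model_def pCF_def by blast

text \<open>Repeating the first centre fills up the list, and similarity for more precision is
  finer. Hence the set of parameters where \<open>K\<close> fails decreases as \<open>K\<close>
  grows.\<close>

lemma goodF_mono:
  assumes \<phi>: "\<phi> \<in> formulas L (Suc n)" and b: "b \<in> tuples M n" and K: "2 \<le> K" "K \<le> K'"
    and good: "holds M (goodF p \<phi> n K) b"
  shows "holds M (goodF p \<phi> n K') b"
proof -
  obtain c where c: "c \<in> tuples M K" "c ! 0 \<noteq> c ! 1" "\<And>x x'. x \<in> univ M \<Longrightarrow> x' \<in> univ M \<Longrightarrow>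
      simM M p K (set c) x x' \<Longrightarrow> holds M \<phi> (x # b) \<longleftrightarrow> holds M \<phi> (x' # b)"
    using good holds_goodF[OF \<phi> b K(1)] by blast
  define c' where "c' = c @ replicate (K' - K) (c ! 0)"
  have l: "length c = K" using c by (simp add: tuples_length)
  then have c0: "c ! 0 \<in> set c" using K by (intro nth_mem) simp
  have "set c \<subseteq> univ M" using c by (simp add: tuples_def)
  moreover from this c0 have "c ! 0 \<in> univ M" by blast
  ultimately have "c' \<in> tuples M K'" "set c \<subseteq> set c'" "c' ! 0 \<noteq> c' ! 1"
    using c(2) c0 l K by (auto simp: c'_def tuples_def nth_append)
  moreover have "simM M p K (set c) x x'" if "simM M p K' (set c') x x'" for x x'
    by (rule simM_mono[OF that K(2)]) (use \<open>set c \<subseteq> set c'\<close> in simp)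
  ultimately show ?thesis using c(3) K holds_goodF[OF \<phi> b, of K'] by (auto intro!: bexI[of _ c'])
qed

text \<open>If no \<open>K\<close> serves all parameters, some ultrafilter contains for every
  \<open>K\<close> the set where it fails. In the ultrapower, the set defined by
  \<open>\<phi>\<close> over \<open>gen\<close> is defined by a quantifier-free
  \<open>\<psi>\<close> over some \<open>d\<close>, and a sentence of \<open>pCF\<close> provides a
  bound for \<open>\<psi>\<close> and all its parameters. This bound then works at
  \<open>gen\<close>, hence almost everywhere, contrary to the choice of the ultrafilter.\<close>

lemma uniform_centres:
  fixes M :: "('f fsym, 'r rsym, ('f fsym, 'r rsym, 'a) universe) struct"
    and U :: "('f fsym, 'r rsym, 'a) universe itself"
  assumes p: "prime p" and sub: "sublanguage Lp L" and min: "P_minimal U p L T"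
    and sk: "definable_skolem_functions U L T" and M: "is_model L T M" and \<phi>: "\<phi> \<in> formulas L (Suc n)"
  shows "\<exists>K\<ge>2. \<forall>b\<in>tuples M n. holds M (goodF p \<phi> n K) b"
proof (rule ccontr)
  assume "\<not> ?thesis"
  then have bad: "\<exists>b\<in>tuples M n. \<not> holds M (goodF p \<phi> n K) b" if "K \<ge> 2" for K using that by blast
  \<comment> \<open>The shift by 2 ensures that there are at least two centres for every
    index.\<close>
  define Bad where "Bad K = {b \<in> tuples M n. \<not> holds M (goodF p \<phi> n (K + 2)) b}" for K
  define F where "F = (INF K. principal (Bad K))"
  have anti: "Bad K' \<subseteq> Bad K" if "K \<le> K'" for K K'
    using goodF_mono[OF \<phi>, of _ M "K + 2" "K' + 2"] that by (auto simp: Bad_def)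
  have ev: "eventually P F \<longleftrightarrow> (\<exists>K. eventually P (principal (Bad K)))" for P
    unfolding F_def
  proof (subst eventually_INF_base)
    show "\<exists>x\<in>UNIV. principal (Bad x) \<le> inf (principal (Bad a)) (principal (Bad b))" for a b
      using anti[of a "max a b"] anti[of b "max a b"] by (intro bexI[of _ "max a b"]) auto
  qed auto
  have "Bad K \<noteq> {}" for K using bad[of "K + 2"] by (auto simp: Bad_def)
  then have "F \<noteq> bot" by (auto simp: trivial_limit_def ev eventually_principal)
  then obtain V where V: "V \<le> F" "V \<noteq> bot" "\<And>P. eventually P V \<or> eventually (\<lambda>x. \<not> P x) V"
    using ultrafilter_exists[of F] by blast
  have in_Bad: "eventually (\<lambda>b. b \<in> Bad K) V" for K
    by (rule filter_leD[OF V(1)]) (auto simp: ev eventually_principal)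
  interpret skolem_model L M by (rule model_skolem[OF sk M])
  interpret ultrapower L M n V
  proof
    show "eventually (\<lambda>a. a \<in> tuples M n) V"
      using in_Bad[of 0] by eventually_elim (simp add: Bad_def)
  qed (use V in auto)
  have N: "is_model L T N" using M min by (intro is_model_N) (auto simp: P_minimal_def)
  define X where "X = {a \<in> univ N. holds N \<phi> ([a] @ gen)}"
  have "definable_subset N (formulas L) X"
    unfolding definable_subset_def X_def using \<phi> gen_tuples
    by (intro exI[of _ n] bexI[of _ \<phi>] bexI[of _ gen]) auto
  then have "definable_subset N (\<lambda>k. {\<phi> \<in> formulas Lp k. quantifier_free \<phi>}) X"
    using min N by (auto simp: P_minimal_def)
  then obtain m \<psi> d where \<psi>: "\<psi> \<in> formulas Lp (Suc m)" "quantifier_free \<psi>" "d \<in> tuples N m"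
    and X: "X = {a \<in> univ N. holds N \<psi> ([a] @ d)}"
    unfolding definable_subset_def by auto
  obtain K where K: "K \<ge> 2" "holds (Qp_struct p) (Alls 0 m (goodF p \<psi> m K)) []"
    using padic_facts[OF p, where ?'f = 'f and ?'r = 'r] \<psi> unfolding padic_facts_def by blast
  have "holds N (Alls 0 m (goodF p \<psi> m K)) []"
    by (rule model_sentence[OF min N goodF_sentence[OF \<psi>(1) K(1)] K(2)])
  then have "holds N (goodF p \<psi> m K) d" using \<psi>(3) by (simp add: holds_Alls)
  moreover have "holds N \<psi> (a # d) \<longleftrightarrow> holds N \<phi> (a # gen)" if "a \<in> univ N" for a
    using X that by (auto simp: X_def)
  \<comment> \<open>\<open>goodF\<close> depends on the formula and the parameters only through the
    set that they define.\<close>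
  ultimately have "holds N (goodF p \<phi> n K) gen"
    by (simp add: holds_goodF[OF \<psi>(1,3) K(1)] holds_goodF[OF \<phi> gen_tuples K(1)])
  then have "eventually (holds M (goodF p \<phi> n K)) V"
    using holds_N_gen goodF_formula[OF \<phi> sub K(1)] by blast
  moreover have "K - 2 + 2 = K" using K by simp
  then have "eventually (\<lambda>b. \<not> holds M (goodF p \<phi> n K) b) V"
    using in_Bad[of "K - 2"] unfolding Bad_def by (auto elim: eventually_mono)
  ultimately have "eventually (\<lambda>b. False) V" by eventually_elim simp
  then show False using V(2) by (simp add: trivial_limit_def)
qed

text \<open>The interface between algebra and combinatorics: besides Skolem functions, only uniform
  centres and the first-order forms of (2) and (3) enter the counting of types.\<close>

locale centred_model = skolem_model L M
  for L :: "('f fsym, 'r rsym) language" and M :: "('f fsym, 'r rsym, 'u) struct" +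
  fixes p :: nat
  assumes sub: "sublanguage Lp L"
    and good: "\<phi> \<in> formulas L (Suc n) \<Longrightarrow> \<exists>K\<ge>2. \<forall>b\<in>tuples M n. holds M (goodF p \<phi> n K) b"
    and represent: "\<exists>W V. \<forall>K\<ge>2. holds M (representF p s W V K) []"
    and point: "holds M (Alls 0 2 (Ex 2 (pointF p W u))) []"
    and count: "\<exists>k. \<forall>K\<ge>2. holds M (countF p s K (Suc (k * K))) []"

lemma model_centred:
  fixes M :: "('f fsym, 'r rsym, ('f fsym, 'r rsym, 'a) universe) struct"
    and U :: "('f fsym, 'r rsym, 'a) universe itself"
  assumes p: "prime p" and sub: "sublanguage Lp L" and min: "P_minimal U p L T"
    and sk: "definable_skolem_functions U L T" and M: "is_model L T M"
  shows "centred_model L M p"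
proof -
  interpret skolem_model L M by (rule model_skolem[OF sk M])
  note facts = padic_facts[OF p, where ?'f = 'f and ?'r = 'r, unfolded padic_facts_def]
  show ?thesis
  proof
    show "\<exists>K\<ge>2. \<forall>b\<in>tuples M n. holds M (goodF p \<phi> n K) b" if "\<phi> \<in> formulas L (Suc n)" for \<phi> n
      by (rule uniform_centres[OF assms that])
    show "\<exists>W V. \<forall>K\<ge>2. holds M (representF p s W V K) []" for s
      using facts model_sentence[OF min M representF_sentence] by meson
    show "holds M (Alls 0 2 (Ex 2 (pointF p W u))) []" for W u
      using facts model_sentence[OF min M pointF_sentence] by meson
    show "\<exists>k. \<forall>K\<ge>2. holds M (countF p s K (Suc (k * K))) []" for s
      using facts model_sentence[OF min M countF_sentence] by meson
  qed (rule sub)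
qed

text \<open>Preimages of \<open>N\<close> distinct values would form a list contradicting the
  assumption, which has the shape that \<open>countF\<close> supplies.\<close>

lemma card_range_less:
  assumes "\<And>xs. length xs = N \<Longrightarrow> set xs \<subseteq> A \<Longrightarrow> \<exists>j<N. \<exists>i<j. f (xs ! i) = f (xs ! j)"
  shows "finite (f ` A) \<and> card (f ` A) < N"
proof (rule ccontr)
  assume contr: "\<not> ?thesis"
  obtain S where S: "S \<subseteq> f ` A" "card S = N" "finite S"
  proof (cases "finite (f ` A)")
    case True
    then show ?thesis using obtain_subset_with_card_n[of N "f ` A"] contr that by (auto simp: not_less)
  next
    case False
    then show ?thesis using infinite_arbitrarily_large[of "f ` A" N] that by blast
  qed
  obtain ys where ys: "set ys = S" "length ys = N" "distinct ys"
    using finite_distinct_list[OF S(3)] S(2) distinct_card by metis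
  define xs where "xs = map (inv_into A f) ys"
  have "\<And>y. y \<in> set ys \<Longrightarrow> inv_into A f y \<in> A \<and> f (inv_into A f y) = y"
    using S ys by (auto intro: inv_into_into f_inv_into_f)
  then have "set xs \<subseteq> A" "length xs = N" "\<And>i. i < N \<Longrightarrow> f (xs ! i) = ys ! i"
    using ys by (auto simp: xs_def)
  then show False using assms[of xs] ys by (metis distinct_conv_nth less_irrefl less_trans)
qed

lemma tp_eqI:
  "(\<And>\<phi> b. \<phi> \<in> \<Delta> \<Longrightarrow> b \<in> B \<Longrightarrow> holds M \<phi> (a @ b) \<longleftrightarrow> holds M \<phi> (a' @ b)) \<Longrightarrow> tp M \<Delta> a B = tp M \<Delta> a' B"
  by (auto simp: tp_def)

lemma tuples_1: "a \<in> tuples M 1 \<longleftrightarrow> (\<exists>x\<in>univ M. a = [x])"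
  by (auto simp: tuples_def length_Suc_conv)

lemma types_1: "types M 1 \<Delta> B = (\<lambda>x. tp M \<Delta> [x] B) ` univ M"
  unfolding types_def tuples_1 by auto

section \<open>Types in one variable and the strong VC2 property\<close>

context centred_model begin

lemma dfun_drop:
  assumes "dfun k g"
  shows "dfun (m + k) (\<lambda>a. g (drop m a))"
proof -
  define ps :: "('u list \<Rightarrow> 'u) list" where "ps = map (\<lambda>i a. a ! i) [m..<m + k]"
  have "dfun (m + k) (\<lambda>a. g (map (\<lambda>q. q a) ps))"
    by (rule dfun_comp) (use assms in \<open>auto simp: ps_def intro!: dfun_proj\<close>)
  then show ?thesis
    by (rule dfun_cong) (auto simp: ps_def comp_def tuples_length map_nth_drop[symmetric] simp del: map_eq_conv)
qed

text \<open>Skolem functions for \<open>centresF\<close> select the centres, so that each centre is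
  a definable function of a single parameter tuple.\<close>

lemma centre_funs:
  assumes "\<phi> \<in> formulas L (Suc n)"
  shows "\<exists>K gs. length gs \<ge> 2 \<and> (\<forall>g\<in>set gs. dfun n g) \<and> (\<forall>b\<in>tuples M n. (gs ! 0) b \<noteq> (gs ! 1) b) \<and>
    (\<forall>b\<in>tuples M n. \<forall>x\<in>univ M. \<forall>x'\<in>univ M. simM M p K (set (map (\<lambda>g. g b) gs)) x x' \<longrightarrow>
       (holds M \<phi> (x # b) \<longleftrightarrow> holds M \<phi> (x' # b)))"
proof -
  obtain K where K: "K \<ge> 2" "\<And>b. b \<in> tuples M n \<Longrightarrow> holds M (goodF p \<phi> n K) b" using good[OF assms] by blast
  have "dfn (n + K) (holds M (centresF p \<phi> n K))" by (rule dfn_formula[OF centresF_formula[OF assms sub K(1)]])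
  from skolem_funs[OF this] obtain gs where gs: "length gs = K" "\<And>g. g \<in> set gs \<Longrightarrow> dfun n g"
    "\<And>b. b \<in> tuples M n \<Longrightarrow> \<exists>c\<in>tuples M K. holds M (centresF p \<phi> n K) (b @ c) \<Longrightarrow>
        holds M (centresF p \<phi> n K) (b @ map (\<lambda>g. g b) gs)" by blast
  have "(gs ! 0) b \<noteq> (gs ! 1) b \<and> (\<forall>x\<in>univ M. \<forall>x'\<in>univ M. simM M p K (set (map (\<lambda>g. g b) gs)) x x' \<longrightarrow>
       (holds M \<phi> (x # b) \<longleftrightarrow> holds M \<phi> (x' # b)))" if b: "b \<in> tuples M n" for b
  proof -
    have "map (\<lambda>g. g b) gs \<in> tuples M (length gs)" by (rule dfun_tuples) (use gs b in auto)
    then have tup: "map (\<lambda>g. g b) gs \<in> tuples M K" using gs by simp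
    have "\<exists>c\<in>tuples M K. holds M (centresF p \<phi> n K) (b @ c)"
      using K(2)[OF b] b unfolding goodF_def by (simp add: holds_Exs tuples_length)
    from gs(3)[OF b this] show ?thesis
      using holds_centresF[OF assms b tup K(1)] gs(1) K(1) by auto
  qed
  then show ?thesis using gs K by (intro exI[of _ K] exI[of _ gs]) auto
qed

lemma centre_funs_finite:
  assumes "finite \<Delta>" "\<Delta> \<subseteq> formulas L (Suc n)"
  shows "\<exists>K gs. length gs \<ge> 2 \<and> (\<forall>g\<in>set gs. dfun n g) \<and> (\<forall>b\<in>tuples M n. (gs ! 0) b \<noteq> (gs ! 1) b) \<and>
    (\<forall>\<phi>\<in>\<Delta>. \<forall>b\<in>tuples M n. \<forall>x\<in>univ M. \<forall>x'\<in>univ M. simM M p K (set (map (\<lambda>g. g b) gs)) x x' \<longrightarrow>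
       (holds M \<phi> (x # b) \<longleftrightarrow> holds M \<phi> (x' # b)))"
  using assms
proof (induction \<Delta> rule: finite_induct)
  case empty
  \<comment> \<open>A tautology supplies two functions with distinct values even when
    \<open>\<Delta>\<close> is empty.\<close>
  have "All 0 (Eq (Var 0) (Var 0)) \<in> formulas L (Suc n)" by (auto simp: formulas_def All_def)
  from centre_funs[OF this] show ?case by blast
next
  case (insert \<phi> \<Delta>)
  obtain K gs where 1: "length gs \<ge> 2" "\<And>g. g \<in> set gs \<Longrightarrow> dfun n g" "\<And>b. b \<in> tuples M n \<Longrightarrow> (gs ! 0) b \<noteq> (gs ! 1) b"
    "\<And>\<phi> b x x'. \<phi> \<in> \<Delta> \<Longrightarrow> b \<in> tuples M n \<Longrightarrow> x \<in> univ M \<Longrightarrow> x' \<in> univ M \<Longrightarrow>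
       simM M p K (set (map (\<lambda>g. g b) gs)) x x' \<Longrightarrow> holds M \<phi> (x # b) \<longleftrightarrow> holds M \<phi> (x' # b)"
    using insert.IH insert.prems by (metis insert_subset)
  obtain K' hs where 2: "\<And>g. g \<in> set hs \<Longrightarrow> dfun n g"
    "\<And>b x x'. b \<in> tuples M n \<Longrightarrow> x \<in> univ M \<Longrightarrow> x' \<in> univ M \<Longrightarrow>
       simM M p K' (set (map (\<lambda>g. g b) hs)) x x' \<Longrightarrow> holds M \<phi> (x # b) \<longleftrightarrow> holds M \<phi> (x' # b)"
    using centre_funs[of \<phi> n] insert.prems by (metis insert_subset)
  have "simM M p K (set (map (\<lambda>g. g b) gs)) x x'" "simM M p K' (set (map (\<lambda>g. g b) hs)) x x'"
    if "simM M p (max K K') (set (map (\<lambda>g. g b) (gs @ hs))) x x'" for b x x'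
    by (rule simM_mono[OF that]; simp)+
  then have "holds M \<psi> (x # b) \<longleftrightarrow> holds M \<psi> (x' # b)"
    if "simM M p (max K K') (set (map (\<lambda>g. g b) (gs @ hs))) x x'" "\<psi> \<in> insert \<phi> \<Delta>" "b \<in> tuples M n"
      "x \<in> univ M" "x' \<in> univ M" for \<psi> b x x'
    using that 1(4) 2(2) by (metis insert_iff)
  moreover have "length (gs @ hs) \<ge> 2" "(gs @ hs) ! 0 = gs ! 0" "(gs @ hs) ! 1 = gs ! 1"
    using 1(1) by (auto simp: nth_append)
  moreover have "\<forall>g\<in>set (gs @ hs). dfun n g" using 1(2) 2(1) by auto
  ultimately show ?case using 1(3) by (intro exI[of _ "max K K'"] exI[of _ "gs @ hs"]) metis
qed

text \<open>Points that are similar relative to the centres of all elements of \<open>B\<close>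
  together have the same type over \<open>B\<close>. The list \<open>ts\<close> can nevertheless be
  chosen before \<open>B\<close>, because a representative involves only two of these centres and a
  rational from a fixed finite set.\<close>

lemma types_realised:
  assumes \<Delta>: "finite \<Delta>" "\<Delta> \<subseteq> formulas L (Suc n)"
  shows "\<exists>ts k. (\<forall>t\<in>set ts. dfun (n + n) t) \<and>
    (\<forall>B. finite B \<longrightarrow> B \<noteq> {} \<longrightarrow> B \<subseteq> tuples M n \<longrightarrow>
       (\<forall>x\<in>univ M. \<exists>t\<in>set ts. \<exists>b1\<in>B. \<exists>b2\<in>B. \<forall>\<phi>\<in>\<Delta>. \<forall>b\<in>B. holds M \<phi> (x # b) \<longleftrightarrow> holds M \<phi> (t (b1 @ b2) # b)) \<and>
       finite (types M 1 \<Delta> B) \<and> card (types M 1 \<Delta> B) \<le> k * card B)"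
proof -
  obtain K gs where gs: "length gs \<ge> 2" "\<And>g. g \<in> set gs \<Longrightarrow> dfun n g" "\<And>b. b \<in> tuples M n \<Longrightarrow> (gs ! 0) b \<noteq> (gs ! 1) b"
    and sim: "\<And>\<phi> b x x'. \<phi> \<in> \<Delta> \<Longrightarrow> b \<in> tuples M n \<Longrightarrow> x \<in> univ M \<Longrightarrow> x' \<in> univ M \<Longrightarrow>
       simM M p K (set (map (\<lambda>g. g b) gs)) x x' \<Longrightarrow> holds M \<phi> (x # b) \<longleftrightarrow> holds M \<phi> (x' # b)"
    using centre_funs_finite[OF \<Delta>] by metis
  \<comment> \<open>\<open>W\<close>, \<open>V\<close> and \<open>k\<close> depend on the precision
    \<open>K\<close> but not on the number \<open>K'\<close> of centres, which will grow with
    \<open>B\<close>.\<close>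
  obtain W V where WV: "\<And>K'. K' \<ge> 2 \<Longrightarrow> holds M (representF p K W V K') []" using represent[of K] by blast
  obtain k where k: "\<And>K'. K' \<ge> 2 \<Longrightarrow> holds M (countF p K K' (Suc (k * K'))) []" using count[of K] by blast
  have "\<exists>h. dfun 2 h \<and> (\<forall>a\<in>tuples M 2. holds M (pointF p W u) (a @ [h a]))" for u
  proof -
    have "pointF p W u \<in> formulas L (Suc 2)"
      using formulas_sublanguage[OF sub] pointF_formula by fastforce
    from skolem_fun[OF dfn_formula[OF this]] obtain h where h: "dfun 2 h"
      "\<And>a. a \<in> tuples M 2 \<Longrightarrow> \<exists>v\<in>univ M. holds M (pointF p W u) (a @ [v]) \<Longrightarrow> holds M (pointF p W u) (a @ [h a])"
      by blast
    have "\<exists>v\<in>univ M. holds M (pointF p W u) (a @ [v])" if "a \<in> tuples M 2" for a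
      using point[of W u] that by (simp add: holds_Alls holds_Ex tuples_length)
    with h show ?thesis by blast
  qed
  then obtain h where h: "\<And>u. dfun 2 (h u)" "\<And>u a. a \<in> tuples M 2 \<Longrightarrow> holds M (pointF p W u) (a @ [h u a])"
    by metis
  \<comment> \<open>All combinations of two centre functions and a numerator; the first function is
    evaluated at b1, the second at b2.\<close>
  define ts where "ts = [(\<lambda>a. h u [g (take n a), g' (drop n a)]). g \<leftarrow> gs, g' \<leftarrow> gs, u \<leftarrow> [0..<p ^ V]]"
  have ts: "dfun (n + n) t" if t': "t \<in> set ts" for t
  proof -
    obtain g g' u where t: "t = (\<lambda>a. h u [g (take n a), g' (drop n a)])" "g \<in> set gs" "g' \<in> set gs"
      using t' by (auto simp: ts_def)
    have "dfun (n + n) (\<lambda>a. h u (map (\<lambda>q. q a) [\<lambda>a. g (take n a), \<lambda>a. g' (drop n a)]))"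
      by (rule dfun_comp) (use h(1) t gs in \<open>auto simp: numeral_2_eq_2 intro!: dfun_take dfun_drop\<close>)
    then show ?thesis by (simp add: t)
  qed
  have main: "(\<forall>x\<in>univ M. \<exists>t\<in>set ts. \<exists>b1\<in>B. \<exists>b2\<in>B. \<forall>\<phi>\<in>\<Delta>. \<forall>b\<in>B. holds M \<phi> (x # b) \<longleftrightarrow> holds M \<phi> (t (b1 @ b2) # b)) \<and>
       finite (types M 1 \<Delta> B) \<and> card (types M 1 \<Delta> B) \<le> (k * length gs) * card B"
    if B: "finite B" "B \<noteq> {}" "B \<subseteq> tuples M n" for B
  proof -
    obtain bs where bs: "set bs = B" "length bs = card B" using finite_distinct_list[OF B(1)] distinct_card by metis
    define cs where "cs = concat (map (\<lambda>b. map (\<lambda>g. g b) gs) bs)"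
    have set_cs: "set cs = (\<Union>b\<in>B. set (map (\<lambda>g. g b) gs))" by (simp add: cs_def bs)
    have "length cs = length gs * length bs"
      unfolding cs_def by (induction bs) auto
    then have len: "length cs = length gs * card B" by (simp add: bs)
    have "card B \<ge> 1" using B by (simp add: Suc_le_eq card_gt_0_iff)
    then have len2: "length cs \<ge> 2" unfolding len using gs(1) mult_le_mono[of 2 "length gs" 1 "card B"] by simp
    \<comment> \<open>The centres of the first element of \<open>B\<close> head the list, so its
      first two entries are distinct.\<close>
    obtain b0 bs' where b0: "bs = b0 # bs'" using bs B by (cases bs) auto
    then have "cs ! 0 = (gs ! 0) b0" "cs ! 1 = (gs ! 1) b0" using gs(1) by (auto simp: cs_def nth_append)
    moreover have "b0 \<in> tuples M n" using b0 bs B by auto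
    ultimately have ne: "cs ! 0 \<noteq> cs ! 1" using gs(3) by simp
    have "set cs \<subseteq> univ M" unfolding set_cs using gs(2) B(3) dfun_univ by fastforce
    then have tup: "cs \<in> tuples M (length cs)" by (simp add: tuples_def)
    have sim_imp: "holds M \<phi> (x # b) \<longleftrightarrow> holds M \<phi> (x' # b)"
      if "simM M p K (set cs) x x'" "\<phi> \<in> \<Delta>" "b \<in> B" "x \<in> univ M" "x' \<in> univ M" for x x' \<phi> b
    proof -
      have "simM M p K (set (map (\<lambda>g. g b) gs)) x x'"
        by (rule simM_mono[OF that(1)]) (use that(3) in \<open>auto simp: set_cs\<close>)
      then show ?thesis using sim that B by blast
    qed
    show ?thesis
    proof (intro conjI ballI)
      fix x assume x: "x \<in> univ M"
      obtain c d u where cd: "c \<in> set cs" "d \<in> set cs" "u < p ^ V"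
        "\<And>x'. x' \<in> univ M \<Longrightarrow> holds M (pointF p W u) [c, d, x'] \<Longrightarrow> simM M p K (set cs) x x'"
        using WV[OF len2] holds_representF[OF len2] tup ne x by metis
      obtain b1 g where b1: "b1 \<in> B" "g \<in> set gs" "c = g b1" using cd(1) by (auto simp: set_cs)
      obtain b2 g' where b2: "b2 \<in> B" "g' \<in> set gs" "d = g' b2" using cd(2) by (auto simp: set_cs)
      define t where "t = (\<lambda>a. h u [g (take n a), g' (drop n a)])"
      have t: "t \<in> set ts" unfolding ts_def t_def using b1(2) b2(2) cd(3)
        by (simp, intro bexI[of _ g] bexI[of _ g'] image_eqI[of _ _ u]) simp_all
      have cd_tup: "[c, d] \<in> tuples M 2" using cd(1,2) \<open>set cs \<subseteq> univ M\<close> by (auto simp: tuples_def)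
      have "length b1 = n" using b1 B by (auto simp: tuples_def)
      then have tb: "t (b1 @ b2) = h u [c, d]" using b1 b2 by (simp add: t_def)
      then have "simM M p K (set cs) x (t (b1 @ b2))"
        using cd(4)[of "h u [c, d]"] h(2)[OF cd_tup] dfun_univ[OF h(1) cd_tup] by simp
      then have "\<forall>\<phi>\<in>\<Delta>. \<forall>b\<in>B. holds M \<phi> (x # b) \<longleftrightarrow> holds M \<phi> (t (b1 @ b2) # b)"
        using sim_imp x dfun_univ[OF h(1) cd_tup] by (simp add: tb)
      then show "\<exists>t\<in>set ts. \<exists>b1\<in>B. \<exists>b2\<in>B. \<forall>\<phi>\<in>\<Delta>. \<forall>b\<in>B. holds M \<phi> (x # b) \<longleftrightarrow> holds M \<phi> (t (b1 @ b2) # b)"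
        using t b1 b2 by blast
    next
      have "finite (types M 1 \<Delta> B) \<and> card (types M 1 \<Delta> B) < Suc (k * length cs)"
        unfolding types_1
      proof (rule card_range_less)
        fix xs assume xs: "length xs = Suc (k * length cs)" "set xs \<subseteq> univ M"
        then have "xs \<in> tuples M (Suc (k * length cs))" by (simp add: tuples_def)
        then obtain i j where ij: "j < Suc (k * length cs)" "i < j" "simM M p K (set cs) (xs ! i) (xs ! j)"
          using k[OF len2] holds_countF[OF len2] tup ne by metis
        have "xs ! i \<in> univ M" "xs ! j \<in> univ M" using ij xs nth_mem[of i xs] nth_mem[of j xs] by auto
        then have "tp M \<Delta> [xs ! i] B = tp M \<Delta> [xs ! j] B"
          using sim_imp[OF ij(3)] by (intro tp_eqI) simp
        then show "\<exists>j<Suc (k * length cs). \<exists>i<j. tp M \<Delta> [xs ! i] B = tp M \<Delta> [xs ! j] B" using ij by blast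
      qed
      then show "finite (types M 1 \<Delta> B)" "card (types M 1 \<Delta> B) \<le> (k * length gs) * card B"
        by (simp_all add: len)
    qed
  qed
  show ?thesis by (intro exI[of _ ts] exI[of _ "k * length gs"]) (use ts main in blast)
qed

lemma dfn_instance:
  assumes t: "dfun (n + n) t" and \<phi>: "\<phi> \<in> formulas L (Suc n)"
  shows "dfn (n + (n + n)) (\<lambda>a. holds M \<phi> (t (drop n a) # take n a))"
proof -
  define gs where "gs = (\<lambda>a. t (drop n a)) # map (\<lambda>i a. a ! i) [0..<n]"
  have "dfn (n + (n + n)) (\<lambda>a. holds M \<phi> (map (\<lambda>g. g a) gs))"
    by (rule dfn_comp) (use dfn_formula[OF \<phi>] dfun_drop[OF t, of n] in \<open>auto simp: gs_def intro!: dfun_proj\<close>)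
  then show ?thesis
    by (rule dfn_cong) (simp add: gs_def comp_def tuples_length map_nth_take)
qed

text \<open>The definition with index i at b1, b2 describes the element
  \<open>(ts ! i) (b1 @ b2)\<close>. This yields coherence: the element exists and realises the set
  for arbitrary b1, b2, not only for those that arise from a type over \<open>B\<close>.\<close>

lemma strong_VC_2: "strong_VC 2 L M"
  unfolding strong_VC_def
proof (intro allI impI)
  fix n \<Delta> assume \<Delta>: "finite \<Delta> \<and> \<Delta> \<noteq> {} \<and> \<Delta> \<subseteq> formulas L (1 + n)"
  then have sub: "\<Delta> \<subseteq> formulas L (Suc n)" by simp
  obtain ts where ts: "\<And>t. t \<in> set ts \<Longrightarrow> dfun (n + n) t"
    "\<And>B x. finite B \<Longrightarrow> B \<noteq> {} \<Longrightarrow> B \<subseteq> tuples M n \<Longrightarrow> x \<in> univ M \<Longrightarrow>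
       \<exists>t\<in>set ts. \<exists>b1\<in>B. \<exists>b2\<in>B. \<forall>\<phi>\<in>\<Delta>. \<forall>b\<in>B. holds M \<phi> (x # b) \<longleftrightarrow> holds M \<phi> (t (b1 @ b2) # b)"
    using types_realised[OF _ sub] \<Delta> by metis
  have "\<forall>i \<phi>. \<exists>\<psi>. i < length ts \<longrightarrow> \<phi> \<in> \<Delta> \<longrightarrow> \<psi> \<in> formulas L (n + (n + n)) \<and>
      (\<forall>a\<in>tuples M (n + (n + n)). holds M \<psi> a \<longleftrightarrow> holds M \<phi> ((ts ! i) (drop n a) # take n a))"
    using dfn_instance[OF ts(1)] sub unfolding dfn_def by (meson nth_mem subsetD)
  then obtain F where F: "\<And>i \<phi>. i < length ts \<Longrightarrow> \<phi> \<in> \<Delta> \<Longrightarrow> F i \<phi> \<in> formulas L (n + (n + n))"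
    "\<And>i \<phi> a. i < length ts \<Longrightarrow> \<phi> \<in> \<Delta> \<Longrightarrow> a \<in> tuples M (n + (n + n)) \<Longrightarrow>
       holds M (F i \<phi>) a \<longleftrightarrow> holds M \<phi> ((ts ! i) (drop n a) # take n a)" by metis
  have F': "holds M (F i \<phi>) (b @ concat [b1, b2]) \<longleftrightarrow> holds M \<phi> ((ts ! i) (b1 @ b2) # b)"
    if "i < length ts" "\<phi> \<in> \<Delta>" "b \<in> tuples M n" "b1 \<in> tuples M n" "b2 \<in> tuples M n" for i \<phi> b b1 b2
    using F(2)[OF that(1,2), of "b @ b1 @ b2"] that by (simp add: tuples_append tuples_length)
  have "coherent_def_types L M 1 n \<Delta> 2 {..<length ts} F"
    unfolding coherent_def_types_def
  proof (intro conjI ballI allI impI)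
    show "uniform_def_types L M 1 n \<Delta> 2 {..<length ts} F"
      unfolding uniform_def_types_def
    proof (intro conjI ballI allI impI)
      show "F i \<phi> \<in> formulas L ((1 + 2) * n)" if "i \<in> {..<length ts}" "\<phi> \<in> \<Delta>" for i \<phi>
        using F(1)[of i \<phi>] that by (simp add: numeral_3_eq_3)
      fix B q assume "B \<subseteq> tuples M n \<and> finite B \<and> B \<noteq> {} \<and> q \<in> types M 1 \<Delta> B"
      then have B: "B \<subseteq> tuples M n" "finite B" "B \<noteq> {}" "q \<in> types M 1 \<Delta> B" by auto
      then obtain x where x: "x \<in> univ M" "q = tp M \<Delta> [x] B" by (auto simp: types_1 simp del: One_nat_def)
      obtain t b1 b2 where t: "t \<in> set ts" "b1 \<in> B" "b2 \<in> B"
        "\<forall>\<phi>\<in>\<Delta>. \<forall>b\<in>B. holds M \<phi> (x # b) \<longleftrightarrow> holds M \<phi> (t (b1 @ b2) # b)"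
        using ts(2)[OF B(2,3,1) x(1)] by blast
      obtain i where i: "i < length ts" "t = ts ! i" using t(1) by (auto simp: in_set_conv_nth)
      have "(True, \<phi>, b) \<in> q \<longleftrightarrow> holds M (F i \<phi>) (b @ concat [b1, b2])" if "\<phi> \<in> \<Delta>" "b \<in> B" for \<phi> b
      proof -
        have "(True, \<phi>, b) \<in> q \<longleftrightarrow> holds M \<phi> (x # b)" using that by (auto simp: x tp_def)
        also have "\<dots> \<longleftrightarrow> holds M (F i \<phi>) (b @ concat [b1, b2])"
          using t that B i F'[of i \<phi> b b1 b2] by (auto simp del: concat.simps)
        finally show ?thesis .
      qed
      then show "\<exists>bs. length bs = 2 \<and> set bs \<subseteq> B \<and>
           (\<exists>i\<in>{..<length ts}. \<forall>\<phi>\<in>\<Delta>. \<forall>b\<in>B. (True, \<phi>, b) \<in> q \<longleftrightarrow> holds M (F i \<phi>) (b @ concat bs))"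
        using i t by (intro exI[of _ "[b1, b2]"]) (auto simp del: concat.simps)
    qed auto
  next
    fix i bs assume i: "i \<in> {..<length ts}" and "length bs = 2 \<and> set bs \<subseteq> tuples M n"
    then obtain b1 b2 where bs: "bs = [b1, b2]" "b1 \<in> tuples M n" "b2 \<in> tuples M n"
      by (auto simp: length_Suc_conv numeral_2_eq_2)
    define x where "x = (ts ! i) (b1 @ b2)"
    have "dfun (n + n) (ts ! i)" using ts(1) i by simp
    then have "x \<in> univ M" unfolding x_def by (rule dfun_univ) (use bs in \<open>simp add: tuples_append\<close>)
    then have "[x] \<in> tuples M 1" by (simp add: tuples_def)
    moreover have "holds M \<phi> ([x] @ b)"
      if "\<phi> \<in> \<Delta>" "b \<in> tuples M n" "holds M (F i \<phi>) (b @ concat bs)" for \<phi> b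
      using that F'[of i \<phi> b b1 b2] i bs by (simp add: x_def)
    ultimately show "consistent_with M 1
          {(\<phi>, b) |\<phi> b. \<phi> \<in> \<Delta> \<and> b \<in> tuples M n \<and> holds M (F i \<phi>) (b @ concat bs)}"
      unfolding consistent_with_def by (intro allI impI bexI[of _ "[x]"]) auto
  qed
  then show "\<exists>I F. coherent_def_types L M 1 n \<Delta> 2 I F" by blast
qed

section \<open>Counting types in several variables\<close>

text \<open>Let x be the first variable and a the others. Applied to x with parameters
  \<open>a @ b\<close>, \<open>types_realised\<close> replaces x by
  \<open>t ((a @ b1) @ a @ b2)\<close>, which turns each \<open>\<phi>\<close> into a formula
  \<open>G t \<phi>\<close> in a with parameters b1, b2, b. The type is determined by t, b1, b2 and
  the type of a for these formulas; the choices of b1 and b2 raise the exponent by 2.\<close>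

lemma card_types_Suc:
  assumes \<Delta>: "finite \<Delta>" "\<Delta> \<subseteq> formulas L (Suc m + n)"
    and IH: "\<And>n \<Delta>. finite \<Delta> \<Longrightarrow> \<Delta> \<subseteq> formulas L (m + n) \<Longrightarrow> \<exists>k. \<forall>B. finite B \<longrightarrow> B \<noteq> {} \<longrightarrow> B \<subseteq> tuples M n \<longrightarrow>
      finite (types M m \<Delta> B) \<and> card (types M m \<Delta> B) \<le> k * card B ^ r"
  shows "\<exists>k. \<forall>B. finite B \<longrightarrow> B \<noteq> {} \<longrightarrow> B \<subseteq> tuples M n \<longrightarrow>
      finite (types M (Suc m) \<Delta> B) \<and> card (types M (Suc m) \<Delta> B) \<le> k * card B ^ (r + 2)"
proof -
  define q where "q = m + n"
  have \<Delta>': "\<Delta> \<subseteq> formulas L (Suc q)" using \<Delta> by (simp add: q_def)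
  obtain ts where ts: "\<And>t. t \<in> set ts \<Longrightarrow> dfun (q + q) t"
    "\<And>B x. finite B \<Longrightarrow> B \<noteq> {} \<Longrightarrow> B \<subseteq> tuples M q \<Longrightarrow> x \<in> univ M \<Longrightarrow>
       \<exists>t\<in>set ts. \<exists>b1\<in>B. \<exists>b2\<in>B. \<forall>\<phi>\<in>\<Delta>. \<forall>b\<in>B. holds M \<phi> (x # b) \<longleftrightarrow> holds M \<phi> (t (b1 @ b2) # b)"
    using types_realised[OF \<Delta>(1) \<Delta>'] by metis
  have "\<exists>\<psi>. t \<in> set ts \<longrightarrow> \<phi> \<in> \<Delta> \<longrightarrow> \<psi> \<in> formulas L (m + (n + n + n)) \<and>
      (\<forall>a\<in>tuples M m. \<forall>b1\<in>tuples M n. \<forall>b2\<in>tuples M n. \<forall>b\<in>tuples M n.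
         holds M \<psi> (a @ b1 @ b2 @ b) \<longleftrightarrow> holds M \<phi> (t ((a @ b1) @ a @ b2) # a @ b))" for t \<phi>
  proof (cases "t \<in> set ts \<and> \<phi> \<in> \<Delta>")
    case True
    \<comment> \<open>\<open>dfn_instance\<close> reads (a, b), (a, b1), (a, b2), whereas the new
      formula is to contain a once, followed by b1, b2, b; \<open>ks\<close> reorders and duplicates
      accordingly.\<close>
    define ks where "ks = [0..<m] @ [m + n + n..<m + n + n + n] @ [0..<m] @ [m..<m + n] @ [0..<m] @ [m + n..<m + n + n]"
    have "dfn (q + (q + q)) (\<lambda>a. holds M \<phi> (t (drop q a) # take q a))"
      using True \<Delta>' ts(1) by (intro dfn_instance) auto
    then have "dfn (m + (n + n + n)) (\<lambda>a. holds M \<phi> (t (drop q (map ((!) a) ks)) # take q (map ((!) a) ks)))"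
      by (rule dfn_subst_vars) (auto simp: ks_def q_def)
    then obtain \<psi> where \<psi>: "\<psi> \<in> formulas L (m + (n + n + n))" "\<And>a. a \<in> tuples M (m + (n + n + n)) \<Longrightarrow>
        holds M \<psi> a \<longleftrightarrow> holds M \<phi> (t (drop q (map ((!) a) ks)) # take q (map ((!) a) ks))"
      unfolding dfn_def by blast
    have "holds M \<psi> (a @ b1 @ b2 @ b) \<longleftrightarrow> holds M \<phi> (t ((a @ b1) @ a @ b2) # a @ b)"
      if "a \<in> tuples M m" "b1 \<in> tuples M n" "b2 \<in> tuples M n" "b \<in> tuples M n" for a b1 b2 b
    proof -
      define c where "c = a @ b1 @ b2 @ b"
      have l: "length a = m" "length b1 = n" "length b2 = n" "length b = n" using that by (simp_all add: tuples_length)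
      have maps: "map ((!) c) [0..<m] = a" "map ((!) c) [m..<m + n] = b1" "map ((!) c) [m + n..<m + n + n] = b2"
        "map ((!) c) [m + n + n..<m + n + n + n] = b"
        unfolding c_def using l by (intro nth_equalityI; auto simp: nth_append)+
      have "map ((!) c) ks = (a @ b) @ (a @ b1) @ a @ b2" unfolding ks_def map_append maps by simp
      moreover have "c \<in> tuples M (m + (n + n + n))" using that unfolding c_def by (auto simp: tuples_def)
      ultimately show ?thesis using \<psi>(2)[of c] l by (simp add: c_def q_def)
    qed
    then show ?thesis using \<psi>(1) by blast
  qed blast
  then obtain G where G: "\<And>t \<phi>. t \<in> set ts \<Longrightarrow> \<phi> \<in> \<Delta> \<Longrightarrow> G t \<phi> \<in> formulas L (m + (n + n + n))"
    "\<And>t \<phi> a b1 b2 b. t \<in> set ts \<Longrightarrow> \<phi> \<in> \<Delta> \<Longrightarrow> a \<in> tuples M m \<Longrightarrow> b1 \<in> tuples M n \<Longrightarrow> b2 \<in> tuples M n \<Longrightarrow>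
       b \<in> tuples M n \<Longrightarrow> holds M (G t \<phi>) (a @ b1 @ b2 @ b) \<longleftrightarrow> holds M \<phi> (t ((a @ b1) @ a @ b2) # a @ b)"
    by metis
  have "\<exists>k. t \<in> set ts \<longrightarrow> (\<forall>B. finite B \<longrightarrow> B \<noteq> {} \<longrightarrow> B \<subseteq> tuples M (n + n + n) \<longrightarrow>
      finite (types M m (G t ` \<Delta>) B) \<and> card (types M m (G t ` \<Delta>) B) \<le> k * card B ^ r)" for t
  proof (cases "t \<in> set ts")
    case True
    then show ?thesis using IH[of "G t ` \<Delta>" "n + n + n"] G(1) \<Delta>(1) by blast
  qed blast
  then obtain k where k: "\<And>t B. t \<in> set ts \<Longrightarrow> finite B \<Longrightarrow> B \<noteq> {} \<Longrightarrow> B \<subseteq> tuples M (n + n + n) \<Longrightarrow>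
      finite (types M m (G t ` \<Delta>) B) \<and> card (types M m (G t ` \<Delta>) B) \<le> k t * card B ^ r"
    by metis
  show ?thesis
  proof (intro exI[of _ "\<Sum>t\<in>set ts. k t"] allI impI)
    fix B assume B: "finite B" "B \<noteq> {}" "B \<subseteq> tuples M n"
    \<comment> \<open>With b1 and b2 fixed there are as many triples as elements of
      \<open>B\<close>, so the induction hypothesis contributes \<open>card B ^ r\<close> although
      the parameters have become three times as long.\<close>
    define S where "S b1 b2 = (\<lambda>b. b1 @ b2 @ b) ` B" for b1 b2
    have S: "finite (S b1 b2)" "S b1 b2 \<noteq> {}" "S b1 b2 \<subseteq> tuples M (n + n + n)" "card (S b1 b2) = card B"
      if "b1 \<in> B" "b2 \<in> B" for b1 b2
    proof -
      have "b1 @ b2 @ b \<in> tuples M (n + (n + n))" if "b \<in> B" for b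
        using that \<open>b1 \<in> B\<close> \<open>b2 \<in> B\<close> B(3) by (intro tuples_append) auto
      then show "S b1 b2 \<subseteq> tuples M (n + n + n)" by (auto simp: S_def add.assoc)
    qed (use B in \<open>auto simp: S_def card_image inj_on_def\<close>)
    \<comment> \<open>Reads the type of \<open>x # a\<close> over \<open>B\<close> off the type
      \<open>\<tau>\<close> of a over \<open>S b1 b2\<close>, by consulting its positive
      elements.\<close>
    define H where "H t b1 b2 \<tau> = {(True, \<phi>, b) |\<phi> b. \<phi> \<in> \<Delta> \<and> b \<in> B \<and> (True, G t \<phi>, b1 @ b2 @ b) \<in> \<tau>} \<union>
        {(False, \<phi>, b) |\<phi> b. \<phi> \<in> \<Delta> \<and> b \<in> B \<and> (True, G t \<phi>, b1 @ b2 @ b) \<notin> \<tau>}"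
      for t b1 b2 and \<tau> :: "(bool \<times> ('f fsym, 'r rsym) fm \<times> 'u list) set"
    define Z where "Z = (\<lambda>(t, b1, b2). H t b1 b2 ` types M m (G t ` \<Delta>) (S b1 b2))"
    have sub: "types M (Suc m) \<Delta> B \<subseteq> (\<Union>z\<in>set ts \<times> B \<times> B. Z z)"
    proof
      fix \<tau> assume "\<tau> \<in> types M (Suc m) \<Delta> B"
      then obtain x a where a: "x \<in> univ M" "a \<in> tuples M m" "\<tau> = tp M \<Delta> (x # a) B"
        by (auto simp: types_def tuples_Suc_iff)
      have aB: "finite ((@) a ` B)" "(@) a ` B \<noteq> {}" "(@) a ` B \<subseteq> tuples M q"
        using B tuples_append[OF a(2)] by (auto simp: q_def)
      obtain t b1 b2 where t: "t \<in> set ts" "b1 \<in> B" "b2 \<in> B"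
        "\<And>\<phi> b. \<phi> \<in> \<Delta> \<Longrightarrow> b \<in> B \<Longrightarrow> holds M \<phi> (x # a @ b) \<longleftrightarrow> holds M \<phi> (t ((a @ b1) @ a @ b2) # a @ b)"
        using ts(2)[OF aB a(1)] by auto
      have "holds M \<phi> ((x # a) @ b) \<longleftrightarrow> (True, G t \<phi>, b1 @ b2 @ b) \<in> tp M (G t ` \<Delta>) a (S b1 b2)"
        if "\<phi> \<in> \<Delta>" "b \<in> B" for \<phi> b
      proof -
        have "(True, G t \<phi>, b1 @ b2 @ b) \<in> tp M (G t ` \<Delta>) a (S b1 b2) \<longleftrightarrow> holds M (G t \<phi>) (a @ b1 @ b2 @ b)"
          using that by (auto simp: tp_def S_def)
        moreover have "b1 \<in> tuples M n" "b2 \<in> tuples M n" "b \<in> tuples M n" using t that B(3) by auto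
        ultimately show ?thesis using G(2)[OF t(1) that(1) a(2)] t(4)[OF that] by simp
      qed
      then have "\<tau> = H t b1 b2 (tp M (G t ` \<Delta>) a (S b1 b2))"
        unfolding a(3) tp_def[of M \<Delta>] H_def by blast
      moreover have "tp M (G t ` \<Delta>) a (S b1 b2) \<in> types M m (G t ` \<Delta>) (S b1 b2)"
        using a(2) by (auto simp: types_def)
      ultimately have "\<tau> \<in> Z (t, b1, b2)" by (simp add: Z_def)
      then show "\<tau> \<in> (\<Union>z\<in>set ts \<times> B \<times> B. Z z)" using t by blast
    qed
    have Z: "finite (Z (t, b1, b2))" "card (Z (t, b1, b2)) \<le> k t * card B ^ r"
      if "t \<in> set ts" "b1 \<in> B" "b2 \<in> B" for t b1 b2
    proof -
      note kS = k[OF that(1) S(1-3)[OF that(2,3)]]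
      show "finite (Z (t, b1, b2))" using kS by (simp add: Z_def)
      have "card (Z (t, b1, b2)) \<le> card (types M m (G t ` \<Delta>) (S b1 b2))"
        unfolding Z_def prod.case using kS by (intro card_image_le) simp
      then show "card (Z (t, b1, b2)) \<le> k t * card B ^ r"
        using kS S(4)[OF that(2,3)] by simp
    qed
    have fin: "finite (\<Union>z\<in>set ts \<times> B \<times> B. Z z)" using B Z by auto
    have "card (types M (Suc m) \<Delta> B) \<le> card (\<Union>z\<in>set ts \<times> B \<times> B. Z z)" using sub fin by (rule card_mono[rotated])
    also have "\<dots> \<le> (\<Sum>z\<in>set ts \<times> B \<times> B. card (Z z))" using B by (intro card_UN_le) auto
    also have "\<dots> \<le> (\<Sum>z\<in>set ts \<times> B \<times> B. k (fst z) * card B ^ r)"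
      using Z by (intro sum_mono) auto
    also have "\<dots> = (\<Sum>t\<in>set ts. \<Sum>y\<in>B \<times> B. k t * card B ^ r)"
      by (subst sum.cartesian_product) (simp add: case_prod_beta)
    also have "\<dots> = (\<Sum>t\<in>set ts. k t) * card B ^ (r + 2)"
      unfolding sum_distrib_right
      by (intro sum.cong refl) (simp add: card_cartesian_product power2_eq_square power_add)
    finally show "finite (types M (Suc m) \<Delta> B) \<and>
        card (types M (Suc m) \<Delta> B) \<le> (\<Sum>t\<in>set ts. k t) * card B ^ (r + 2)"
      using finite_subset[OF sub fin] by simp
  qed
qed

text \<open>With \<open>Suc m\<close> variables the exponent \<open>2 * m + 1\<close> is twice the
  number of variables minus 1: 1 for a single variable, where the bound is linear, and 2 for each
  further one.\<close>

lemma card_types: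
  assumes "finite \<Delta>" "\<Delta> \<subseteq> formulas L (Suc m + n)"
  shows "\<exists>k. \<forall>B. finite B \<longrightarrow> B \<noteq> {} \<longrightarrow> B \<subseteq> tuples M n \<longrightarrow>
      finite (types M (Suc m) \<Delta> B) \<and> card (types M (Suc m) \<Delta> B) \<le> k * card B ^ (2 * m + 1)"
  using assms
proof (induction m arbitrary: n \<Delta>)
  case 0
  have "\<Delta> \<subseteq> formulas L (Suc n)" using 0 by simp
  from types_realised[OF 0(1) this] show ?case
    by (elim exE conjE, rule_tac x = k in exI) simp
next
  case (Suc m)
  from card_types_Suc[OF Suc.prems Suc.IH] show ?case by simp
qed

lemma dual_vc_density_le:
  assumes "finite \<Delta>" "\<Delta> \<subseteq> formulas L (m + n)" "m \<ge> 1"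
  shows "dual_vc_density M m n \<Delta> \<le> ereal (2 * real m - 1)"
proof -
  obtain m' where m: "m = Suc m'" using assms(3) by (cases m) auto
  obtain k where k: "\<And>B. finite B \<Longrightarrow> B \<noteq> {} \<Longrightarrow> B \<subseteq> tuples M n \<Longrightarrow> card (types M m \<Delta> B) \<le> k * card B ^ (2 * m' + 1)"
    using card_types[of \<Delta> m' n] assms unfolding m by metis
  have shatter: "dual_shatter M m n \<Delta> t \<le> k * t ^ (2 * m' + 1)" if "t \<ge> 1" for t
  proof (cases "{B. B \<subseteq> tuples M n \<and> finite B \<and> card B = t} = {}")
    \<comment> \<open>The supremum of the empty set of natural numbers is 0.\<close>
    case True
    then show ?thesis unfolding dual_shatter_def by (simp add: Sup_nat_def)
  next
    case False
    then show ?thesis unfolding dual_shatter_def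
      by (rule cSUP_least) (use k that in fastforce)
  qed
  have "(\<lambda>t. real (dual_shatter M m n \<Delta> t)) \<in> O[sequentially](\<lambda>t. real t powr (2 * real m - 1))"
  proof (rule bigoI[of _ "real k"])
    show "eventually (\<lambda>t. norm (real (dual_shatter M m n \<Delta> t)) \<le> real k * norm (real t powr (2 * real m - 1))) sequentially"
      using eventually_ge_at_top[of 1]
    proof eventually_elim
      case (elim t)
      have "real (dual_shatter M m n \<Delta> t) \<le> real (k * t ^ (2 * m' + 1))"
        using shatter[OF elim] by (rule of_nat_mono)
      also have "\<dots> = real k * real t powr (real (2 * m' + 1))"
        using elim by (simp only: of_nat_mult of_nat_power powr_realpow)
      also have "real (2 * m' + 1) = 2 * real m - 1" by (simp add: m)
      finally show ?case by simp
    qed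
  qed
  then show ?thesis unfolding dual_vc_density_def using assms(3) by (intro Inf_lower) auto
qed

end

theorem theorem7p2:
  fixes p :: nat
    and L :: "('f fsym, 'r rsym) language"
    and T :: "('f fsym, 'r rsym) fm set"
    and U :: "('f fsym, 'r rsym, 'a) universe itself"
  assumes "prime p"
    and "sublanguage Lp L"
    and "P_minimal U p L T"
    and "definable_skolem_functions U L T"
  shows "theory_strong_VC U 2 L T \<and>
    (\<forall>M :: ('f fsym, 'r rsym, ('f fsym, 'r rsym, 'a) universe) struct.
       is_model L T M \<longrightarrow>
       (\<forall>m n \<Delta>. m \<ge> 1 \<and> finite \<Delta> \<and> \<Delta> \<subseteq> formulas L (m + n) \<longrightarrow>
          dual_vc_density M m n \<Delta> \<le> ereal (2 * real m - 1)))"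
proof -
  have centred: "centred_model L M p" if "is_model L T M"
    for M :: "('f fsym, 'r rsym, ('f fsym, 'r rsym, 'a) universe) struct"
    using assms that by (rule model_centred)
  show ?thesis
    unfolding theory_strong_VC_def
    using centred_model.strong_VC_2[OF centred] centred_model.dual_vc_density_le[OF centred] by blast
qed

end
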